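(* There are absolute constants $0<c_1<C_1<\infty$ such that, as $n\to\infty$, $$\mathbb{P}\left(n^{n/2}e^{-C_1n}\le|\operatorname{Per}(M_n)|\le n^{n/2}e^{-c_1n}\right)=1-o(1).$$
   Context: $M_n=(\xi_{ij})_{1\le i,j\le n}$ is an $n\times n$ random matrix whose entries are independent Rademacher random variables, i.e. $\mathbb{P}(\xi_{ij}=1)=\mathbb{P}(\xi_{ij}=-1)=\tfrac12$. The permanent is $\operatorname{Per}(M_n)=\sum_{\sigma\in S_n}\prod_{i=1}^n\xi_{i,\sigma(i)}$, where $S_n$ is the symmetric group on $\{1,\dots,n\}$. *)

theory Defs
  imports "HOL-Probability.Probability" "Jordan_Normal_Form.Matrix"
begin

definition per :: "'a :: comm_ring_1 mat \<Rightarrow> 'a" where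
  "per A = (if dim_row A = dim_col A
     then (\<Sum>p \<in> {p. p permutes {0..<dim_row A}}. \<Prod>i = 0..<dim_row A. A $$ (i, p i))
     else 0)"

definition rademacher_pmf :: "real pmf" where
  "rademacher_pmf = pmf_of_set {-1, 1}"

text \<open>
  The law of the random matrix is the product law of its entries, with rows and columns indexed
  from \<open>0\<close>. The default value \<open>0\<close> is taken only at positions outside the matrix and is discarded.
\<close>

definition rademacher_mat_pmf :: "nat \<Rightarrow> real mat pmf" where
  "rademacher_mat_pmf n =
     map_pmf (mat n n) (Pi_pmf ({0..<n} \<times> {0..<n}) 0 (\<lambda>_. rademacher_pmf))"

lemma pmf_rademacher_pmf: "pmf rademacher_pmf 1 = 1 / 2" "pmf rademacher_pmf (-1) = 1 / 2"
  by (simp_all add: rademacher_pmf_def)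

lemma map_pmf_rademacher_mat_entry:
  assumes "i < n" "j < n"
  shows "map_pmf (\<lambda>A. A $$ (i, j)) (rademacher_mat_pmf n) = rademacher_pmf"
proof -
  have "map_pmf (\<lambda>A. A $$ (i, j)) (rademacher_mat_pmf n)
      = map_pmf (\<lambda>f. f (i, j)) (Pi_pmf ({0..<n} \<times> {0..<n}) 0 (\<lambda>_. rademacher_pmf))"
    using assms by (simp add: rademacher_mat_pmf_def pmf.map_comp o_def)
  then show ?thesis
    using assms by (simp add: Pi_pmf_component)
qed

lemma indep_vars_rademacher_mat_entries:
  "prob_space.indep_vars (measure_pmf (rademacher_mat_pmf n)) (\<lambda>_. borel)
     (\<lambda>(i, j) A. A $$ (i, j)) ({0..<n} \<times> {0..<n})"
proof -
  let ?I = "{0..<n} \<times> {0..<n}"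
  let ?P = "Pi_pmf ?I 0 (\<lambda>_. rademacher_pmf)"
  let ?X = "\<lambda>x A. A $$ x :: real"
  have "prob_space.indep_vars (measure_pmf ?P) (\<lambda>_. count_space UNIV) (\<lambda>x f. f x) ?I"
    by (rule indep_vars_Pi_pmf) simp
  then have P: "measure_pmf.prob ?P (\<Inter>x\<in>J. (\<lambda>f. f x) -` B x) =
      (\<Prod>x\<in>J. measure_pmf.prob ?P ((\<lambda>f. f x) -` B x))"
    if "J \<subseteq> ?I" "J \<noteq> {}" "finite J" for J and B :: "nat \<times> nat \<Rightarrow> real set"
    using prob_space.indep_varsD[OF measure_pmf.prob_space_axioms, of ?P _ _ ?I J B] that by auto
  have Q: "measure_pmf.prob (rademacher_mat_pmf n) (\<Inter>x\<in>J. ?X x -` B x) =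
      (\<Prod>x\<in>J. measure_pmf.prob (rademacher_mat_pmf n) (?X x -` B x))"
    if J: "J \<subseteq> ?I" "J \<noteq> {}" "finite J" for J and B :: "nat \<times> nat \<Rightarrow> real set"
  proof -
    have v: "mat n n -` (?X x -` B x) = (\<lambda>f. f x) -` B x" if "x \<in> J" for x
      using that J(1) by (cases x) auto
    show ?thesis
      using P[OF J, of B] v by (simp add: rademacher_mat_pmf_def vimage_INT)
  qed
  have "prob_space.indep_vars (measure_pmf (rademacher_mat_pmf n)) (\<lambda>_. borel) ?X ?I"
    unfolding prob_space.indep_vars_def2[OF measure_pmf.prob_space_axioms]
      prob_space.indep_sets_def[OF measure_pmf.prob_space_axioms]
  proof (intro conjI ballI allI impI)
    fix J A assume J: "J \<subseteq> ?I" "J \<noteq> {}" "finite J"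
      and A: "A \<in> (\<Pi> x\<in>J. {?X x -` B \<inter> space (measure_pmf (rademacher_mat_pmf n)) |B. B \<in> sets borel})"
    then have "\<forall>x\<in>J. \<exists>B. A x = ?X x -` B" by (fastforce simp: Pi_iff)
    then obtain B where B: "\<And>x. x \<in> J \<Longrightarrow> A x = ?X x -` B x" by metis
    then have "\<Inter> (A ` J) = (\<Inter>x\<in>J. ?X x -` B x)" by auto
    then show "measure_pmf.prob (rademacher_mat_pmf n) (\<Inter> (A ` J)) =
        (\<Prod>x\<in>J. measure_pmf.prob (rademacher_mat_pmf n) (A x))"
      using Q[OF J, of B] B by simp
  qed auto
  then show ?thesis by (simp add: case_prod_unfold)
qed

end

theory Submission
  imports Defs "HOL-Real_Asymp.Real_Asymp"
begin

text \<open>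
  The upper bound is a second moment computation: the expectation of \<open>Per\<^sup>2\<close> is \<open>n!\<close>, which is
  exponentially smaller than \<open>n\<^sup>n\<close>, so Markov's inequality applies.

  For the lower bound the matrix is revealed one line (a row or a column) at a time. After \<open>k\<close> lines
  the relevant data are the permanents of all \<open>k \<times> k\<close> minors on these lines. They are indexed by
  the set \<open>C\<close> of positions that are still uncovered, and the next line \<open>x\<close> turns this family \<open>z\<close> into
  \<open>D \<mapsto> (\<Sum>j. x j * z (insert j D))\<close>, which is Laplace expansion (\<open>laplace_step\<close>). Three
  different mechanisms keep the minors large, depending on the number \<open>N = card C\<close> of uncovered
  positions.

  \<^item> While \<open>N\<close> is at least about \<open>sqrt n\<close>, the sum \<open>Q\<close> of the squares of all minors is followed. Its
    conditional expectation after one step is \<open>N * Q\<close>. The new sum of squares is the squared length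
    of a random signed sum of vectors, each of which carries at most a fraction \<open>1 / N\<close> of the total
    variance. Hence it satisfies a small ball estimate (\<open>vector_small_ball\<close>), and a small negative
    power of its ratio to \<open>N * Q\<close> has bounded expectation (\<open>negative_moment\<close>). Multiplying over the
    steps, \<open>Q\<close> falls short of the product of the factors \<open>N\<close> by at most \<open>exp (O n)\<close>, except with
    probability tending to \<open>0\<close> (\<open>mass_lower_tail\<close>).

  \<^item> A single large minor survives one more line with probability at least \<open>1 - 1 / 2 ^ N\<close>
    (\<open>exists_surviving_child\<close>). If a line fails, it can be set aside. When \<open>L\<close> lines may be set aside,
    the process reaches \<open>N = 0\<close> with failure probability \<open>O ((3 / 4) ^ L)\<close> (\<open>absorb_lines\<close>).

  \<^item> The last \<open>L\<close> rows need many large minors, since a signed sum with few large coefficients can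
    vanish with constant probability. If \<open>m\<close> large minors have pairwise disjoint complements of size
    \<open>L\<close>, the permanent is large with probability tending to \<open>1\<close> as \<open>m\<close> grows with \<open>L\<close> fixed
    (\<open>disjoint_heavy_minors_survive\<close>).

  The link between the last two mechanisms is transposition. Consider only the first \<open>n - L\<close> rows
  and let \<open>W\<close> be a set of about \<open>sqrt n\<close> columns. Expanding along the columns outside \<open>W\<close> first, and then
  along those of \<open>W\<close> with \<open>L\<close> of them set aside, produces a large minor whose \<open>L\<close> missing columns all
  lie in \<open>W\<close> (\<open>heavy_minor_in_window\<close>). Doing this for many disjoint windows \<open>W\<close> gives the disjoint
  complements that the expansion along the last \<open>L\<close> rows requires (\<open>permanent_lower_tail\<close>).
\<close>

section \<open>Averages over random signs\<close>

text \<open>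
  The average of \<open>f\<close> over all assignments of signs to the coordinates in \<open>I\<close>, all other coordinates
  being kept from \<open>w\<close>. The result is again a function of a point \<open>w\<close>, so conditional expectations
  are averages over part of the coordinates, and Fubini's theorem becomes \<open>sign_avg_union\<close> below.
\<close>

definition sign_avg :: "'i set \<Rightarrow> (('i \<Rightarrow> real) \<Rightarrow> real) \<Rightarrow> ('i \<Rightarrow> real) \<Rightarrow> real" where
  "sign_avg I f w =
     (\<Sum>T\<in>Pow I. f (\<lambda>i. if i \<in> T then 1 else if i \<in> I then -1 else w i)) / 2 ^ card I"

lemma sign_avg_empty [simp]: "sign_avg {} f w = f w"
  by (simp add: sign_avg_def)

lemma sign_avg_insert:
  assumes "finite I" "i \<notin> I"
  shows "sign_avg (insert i I) f w =
    (sign_avg I f (w(i := 1)) + sign_avg I f (w(i := -1))) / 2"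
proof -
  let ?g = "\<lambda>J T w k. if k \<in> T then 1 else if k \<in> J then -1 else (w k :: real)"
  have 1: "?g (insert i I) T w = ?g I T (w(i := -1))" if "T \<in> Pow I" for T
    using that assms by (auto simp: fun_eq_iff)
  have 2: "?g (insert i I) (insert i T) w = ?g I T (w(i := 1))" if "T \<in> Pow I" for T
    using that assms by (auto simp: fun_eq_iff)
  have inj: "inj_on (insert i) (Pow I)"
    using assms(2) by (auto simp: inj_on_def)
  have "(\<Sum>T\<in>Pow (insert i I). f (?g (insert i I) T w)) =
      (\<Sum>T\<in>Pow I. f (?g (insert i I) T w)) + (\<Sum>T\<in>insert i ` Pow I. f (?g (insert i I) T w))"
    unfolding Pow_insert using assms by (intro sum.union_disjoint) auto
  also have "(\<Sum>T\<in>insert i ` Pow I. f (?g (insert i I) T w)) =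
      (\<Sum>T\<in>Pow I. f (?g (insert i I) (insert i T) w))"
    using inj by (simp add: sum.reindex o_def)
  also have "\<dots> = (\<Sum>T\<in>Pow I. f (?g I T (w(i := 1))))"
    using 2 by (intro sum.cong) auto
  also have "(\<Sum>T\<in>Pow I. f (?g (insert i I) T w)) = (\<Sum>T\<in>Pow I. f (?g I T (w(i := -1))))"
    using 1 by (intro sum.cong) auto
  finally show ?thesis
    using assms unfolding sign_avg_def by (simp add: field_simps)
qed

lemma sign_avg_union:
  assumes "finite A" "finite B" "A \<inter> B = {}"
  shows "sign_avg (A \<union> B) f w = sign_avg A (sign_avg B f) w"
  using assms(1,3)
proof (induction A arbitrary: w rule: finite_induct)
  case (insert a A)
  then show ?case
    using assms(2) by (simp add: sign_avg_insert)
qed simp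

lemma sign_avg_mono_signs:
  assumes "\<And>w'. (\<And>i. i \<in> I \<Longrightarrow> w' i \<in> {1, -1}) \<Longrightarrow> (\<And>i. i \<notin> I \<Longrightarrow> w' i = w i) \<Longrightarrow> f w' \<le> g w'"
  shows "sign_avg I f w \<le> sign_avg I g w"
  unfolding sign_avg_def by (intro divide_right_mono sum_mono assms) auto

lemma sign_avg_mono: "(\<And>w'. f w' \<le> g w') \<Longrightarrow> sign_avg I f w \<le> sign_avg I g w"
  by (rule sign_avg_mono_signs)

text \<open>
  Quantities that depend only on coordinates outside \<open>I\<close> are constants for the average over \<open>I\<close>;
  all conditioning arguments use this form.
\<close>

lemma sign_avg_cong_outside:
  assumes "\<And>w'. (\<And>i. i \<notin> I \<Longrightarrow> w' i = w i) \<Longrightarrow> f w' = g w'"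
  shows "sign_avg I f w = sign_avg I g w"
  by (intro antisym sign_avg_mono_signs) (auto simp: assms)

lemma sign_avg_const [simp]: "finite I \<Longrightarrow> sign_avg I (\<lambda>_. c) w = c"
  by (simp add: sign_avg_def card_Pow)

lemma sign_avg_add: "sign_avg I (\<lambda>w. f w + g w) w = sign_avg I f w + sign_avg I g w"
  by (simp add: sign_avg_def sum.distrib add_divide_distrib)

lemma sign_avg_cmult: "sign_avg I (\<lambda>w. c * f w) w = c * sign_avg I f w"
  by (simp add: sign_avg_def flip: sum_distrib_left)

lemma sign_avg_divide: "sign_avg I (\<lambda>w. f w / c) w = sign_avg I f w / c"
  using sign_avg_cmult[of I "1 / c" f w] by simp

lemma sign_avg_sum: "sign_avg I (\<lambda>w. \<Sum>x\<in>X. f x w) w = (\<Sum>x\<in>X. sign_avg I (f x) w)"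
  unfolding sign_avg_def by (subst sum.swap) (simp add: sum_divide_distrib)

lemma sign_avg_nonneg: "(\<And>w'. 0 \<le> f w') \<Longrightarrow> 0 \<le> sign_avg I f w"
  unfolding sign_avg_def by (intro divide_nonneg_nonneg sum_nonneg) auto

lemma sign_avg_le_const: "finite I \<Longrightarrow> (\<And>w'. f w' \<le> c) \<Longrightarrow> sign_avg I f w \<le> c"
  using sign_avg_mono[of f "\<lambda>_. c" I w] by simp

text \<open>
  The restriction records that \<open>g\<close> looks only at the coordinates in the range of \<open>e\<close>.
\<close>

lemma sign_avg_reindex:
  assumes "finite R" "inj_on e R"
  shows "sign_avg (e ` R) (\<lambda>w. g (\<lambda>i\<in>R. w (e i))) w0 = sign_avg R (\<lambda>z. g (restrict z R)) z0"
proof -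
  have inj: "inj_on ((`) e) (Pow R)"
    using assms(2) by (simp add: inj_on_image_Pow)
  have Pow: "Pow (e ` R) = (`) e ` Pow R"
    by (simp add: image_Pow_surj)
  have eq: "(\<lambda>i\<in>R. if e i \<in> e ` T then 1 else if e i \<in> e ` R then -1 else w0 (e i)) =
      restrict (\<lambda>i. if i \<in> T then 1 else if i \<in> R then -1 else z0 i) R" if "T \<in> Pow R" for T
    using that assms(2) by (auto simp: restrict_def fun_eq_iff inj_on_eq_iff subset_iff)
  show ?thesis
    unfolding sign_avg_def Pow sum.reindex[OF inj] o_def
    using assms by (auto simp: card_image intro!: arg_cong2[of _ _ _ _ "(/)"] sum.cong arg_cong[of _ _ g] eq)
qed

lemma sign_avg_markov:
  assumes "c > 0" "\<And>w. f w \<ge> 0"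
  shows "sign_avg I (\<lambda>w. of_bool (c \<le> f w)) w \<le> sign_avg I f w / c"
  unfolding sign_avg_divide[symmetric] using assms by (intro sign_avg_mono) auto

text \<open>
  The shift \<open>c\<close> is there for the induction on \<open>J\<close>: fixing one sign adds a vector to it. The same
  device is used for the fourth moment and for the cosine.
\<close>

lemma sign_avg_vector_second:
  fixes c :: "'d \<Rightarrow> real" and v :: "'i \<Rightarrow> 'd \<Rightarrow> real" and X :: "'d set"
  assumes "finite J"
  shows "sign_avg J (\<lambda>w. \<Sum>d\<in>X. (c d + (\<Sum>j\<in>J. w j * v j d))\<^sup>2) w0 =
    (\<Sum>d\<in>X. (c d)\<^sup>2) + (\<Sum>j\<in>J. \<Sum>d\<in>X. (v j d)\<^sup>2)"
  using assms
proof (induction J arbitrary: c w0 rule: finite_induct)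
  case (insert i J)
  have *: "sign_avg J (\<lambda>w. \<Sum>d\<in>X. (c d + (\<Sum>j\<in>insert i J. w j * v j d))\<^sup>2) (w0(i := s)) =
      (\<Sum>d\<in>X. (c d + s * v i d)\<^sup>2) + (\<Sum>j\<in>J. \<Sum>d\<in>X. (v j d)\<^sup>2)" for s
  proof -
    have "sign_avg J (\<lambda>w. \<Sum>d\<in>X. (c d + (\<Sum>j\<in>insert i J. w j * v j d))\<^sup>2) (w0(i := s)) =
      sign_avg J (\<lambda>w. \<Sum>d\<in>X. ((c d + s * v i d) + (\<Sum>j\<in>J. w j * v j d))\<^sup>2) (w0(i := s))"
      using insert.hyps by (intro sign_avg_cong_outside) (simp add: add.assoc)
    then show ?thesis using insert.IH by simp
  qed
  have "(\<Sum>d\<in>X. (c d + v i d)\<^sup>2) + (\<Sum>d\<in>X. (c d - v i d)\<^sup>2) = 2 * ((\<Sum>d\<in>X. (c d)\<^sup>2) + (\<Sum>d\<in>X. (v i d)\<^sup>2))"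
    by (simp add: sum.distrib[symmetric] sum_distrib_left power2_eq_square algebra_simps)
  then show ?case
    unfolding sign_avg_insert[OF insert.hyps] * using insert.hyps by (simp add: algebra_simps)
qed simp

text \<open>
  Khinchine's inequality with exponent four for vectors. Averaging over the sign of \<open>v\<close> produces
  \<open>(|c|\<^sup>2 + |v|\<^sup>2)\<^sup>2 + 4 (c \<bullet> v)\<^sup>2\<close>, and the Cauchy--Schwarz inequality bounds the last term; this is
  where the coefficient 6 comes from.
\<close>

lemma sign_avg_vector_fourth:
  fixes c :: "'d \<Rightarrow> real" and v :: "'i \<Rightarrow> 'd \<Rightarrow> real" and X :: "'d set"
  assumes "finite J"
  defines "\<sigma> \<equiv> \<lambda>J. \<Sum>j\<in>J. \<Sum>d\<in>X. (v j d)\<^sup>2"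
  shows "sign_avg J (\<lambda>w. (\<Sum>d\<in>X. (c d + (\<Sum>j\<in>J. w j * v j d))\<^sup>2)\<^sup>2) w0 \<le>
    (\<Sum>d\<in>X. (c d)\<^sup>2)\<^sup>2 + 6 * (\<Sum>d\<in>X. (c d)\<^sup>2) * \<sigma> J + 3 * (\<sigma> J)\<^sup>2"
  using assms(1)
proof (induction J arbitrary: c w0 rule: finite_induct)
  case (insert i J)
  define A where "A = (\<Sum>d\<in>X. (c d)\<^sup>2)"
  define b where "b = (\<Sum>d\<in>X. (v i d)\<^sup>2)"
  define m where "m = (\<Sum>d\<in>X. c d * v i d)"
  define S where "S = \<sigma> J"
  have S: "\<sigma> (insert i J) = b + S"
    using insert.hyps by (simp add: \<sigma>_def b_def S_def)
  have exp: "(\<Sum>d\<in>X. (c d + s * v i d)\<^sup>2) = A + 2 * s * m + s\<^sup>2 * b" for s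
    unfolding A_def b_def m_def
    by (simp add: sum.distrib[symmetric] sum_distrib_left power2_eq_square algebra_simps)
  have *: "sign_avg J (\<lambda>w. (\<Sum>d\<in>X. (c d + (\<Sum>j\<in>insert i J. w j * v j d))\<^sup>2)\<^sup>2) (w0(i := s)) \<le>
      (A + 2 * s * m + s\<^sup>2 * b)\<^sup>2 + 6 * (A + 2 * s * m + s\<^sup>2 * b) * S + 3 * S\<^sup>2" for s
  proof -
    have "sign_avg J (\<lambda>w. (\<Sum>d\<in>X. (c d + (\<Sum>j\<in>insert i J. w j * v j d))\<^sup>2)\<^sup>2) (w0(i := s)) =
      sign_avg J (\<lambda>w. (\<Sum>d\<in>X. ((c d + s * v i d) + (\<Sum>j\<in>J. w j * v j d))\<^sup>2)\<^sup>2) (w0(i := s))"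
      using insert.hyps by (intro sign_avg_cong_outside) (simp add: add.assoc)
    also have "\<dots> \<le> (\<Sum>d\<in>X. (c d + s * v i d)\<^sup>2)\<^sup>2 + 6 * (\<Sum>d\<in>X. (c d + s * v i d)\<^sup>2) * \<sigma> J + 3 * (\<sigma> J)\<^sup>2"
      by (rule insert.IH)
    finally show ?thesis unfolding exp S_def .
  qed
  have cs: "m\<^sup>2 \<le> A * b"
    unfolding m_def A_def b_def by (rule Cauchy_Schwarz_ineq_sum)
  have "sign_avg (insert i J) (\<lambda>w. (\<Sum>d\<in>X. (c d + (\<Sum>j\<in>insert i J. w j * v j d))\<^sup>2)\<^sup>2) w0 \<le>
      ((A + 2 * m + b)\<^sup>2 + 6 * (A + 2 * m + b) * S + 3 * S\<^sup>2 +
       ((A - 2 * m + b)\<^sup>2 + 6 * (A - 2 * m + b) * S + 3 * S\<^sup>2)) / 2"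
    unfolding sign_avg_insert[OF insert.hyps]
    by (intro divide_right_mono add_mono order.trans[OF *]) auto
  also have "\<dots> = (A + b)\<^sup>2 + 4 * m\<^sup>2 + 6 * (A + b) * S + 3 * S\<^sup>2"
    by (simp add: power2_eq_square algebra_simps)
  also have "\<dots> \<le> A\<^sup>2 + 6 * A * (b + S) + 3 * (b + S)\<^sup>2"
  proof -
    have "4 * m\<^sup>2 \<le> 4 * (A * b) + 2 * b\<^sup>2" using cs zero_le_power2[of b] by linarith
    then show ?thesis by (simp add: power2_eq_square algebra_simps)
  qed
  finally show ?case unfolding S A_def .
qed (simp add: \<sigma>_def)

lemma sign_avg_cos:
  assumes "finite J"
  shows "sign_avg J (\<lambda>w. cos (c + (\<Sum>j\<in>J. w j * a j))) w0 = cos c * (\<Prod>j\<in>J. cos (a j))"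
  using assms
proof (induction J arbitrary: c w0 rule: finite_induct)
  case (insert i J)
  have *: "sign_avg J (\<lambda>w. cos (c + (\<Sum>j\<in>insert i J. w j * a j))) (w0(i := s)) =
      cos (c + s * a i) * (\<Prod>j\<in>J. cos (a j))" for s
  proof -
    have "sign_avg J (\<lambda>w. cos (c + (\<Sum>j\<in>insert i J. w j * a j))) (w0(i := s)) =
      sign_avg J (\<lambda>w. cos ((c + s * a i) + (\<Sum>j\<in>J. w j * a j))) (w0(i := s))"
      using insert.hyps by (intro sign_avg_cong_outside) (simp add: add.assoc)
    then show ?thesis using insert.IH by simp
  qed
  show ?case
    unfolding sign_avg_insert[OF insert.hyps] * using insert.hyps
    by (simp add: cos_add cos_diff algebra_simps)
qed simp

section \<open>Small ball estimates for random signed sums\<close>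

lemma sign_avg_swap:
  "sign_avg I (\<lambda>w. sign_avg K (\<lambda>z. f w z) z0) w0 = sign_avg K (\<lambda>z. sign_avg I (\<lambda>w. f w z) w0) z0"
  unfolding sign_avg_def
  by (subst (2) sum_divide_distrib[symmetric], subst sum.swap)
     (simp add: sum_divide_distrib mult.commute)

lemma sign_avg_integral:
  fixes f :: "('i \<Rightarrow> real) \<Rightarrow> real \<Rightarrow> real"
  assumes "\<And>w. integrable M (f w)"
  shows "sign_avg I (\<lambda>w. integral\<^sup>L M (f w)) w0 = integral\<^sup>L M (\<lambda>x. sign_avg I (\<lambda>w. f w x) w0)"
  unfolding sign_avg_def using assms by simp

text \<open>
  The Gaussian is its own Fourier transform. This writes a smooth majorant of the indicator of an
  interval as an average of cosines, whose sign averages factorise.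
\<close>

lemma gaussian_integral_cos:
  "integrable lborel (\<lambda>g. std_normal_density g * cos (g * x))"
  "(LINT g|lborel. std_normal_density g * cos (g * x)) = exp (- x\<^sup>2 / 2)"
proof -
  interpret real_distribution std_normal_distribution by (rule real_dist_normal_dist)
  show "integrable lborel (\<lambda>g. std_normal_density g * cos (g * x))"
    by (rule Bochner_Integration.integrable_bound[OF integrable_normal_density[of 1 0]])
       (auto simp: abs_mult mult_left_le)
  have "exp (- x\<^sup>2 / 2) = Re (char std_normal_distribution x)"
    by (simp add: char_std_normal_distribution)
  also have "\<dots> = (LINT g|std_normal_distribution. Re (iexp (x * g)))"
    unfolding char_def by (intro integral_Re[symmetric] integrable_iexp) auto
  also have "\<dots> = (LINT g|std_normal_distribution. cos (g * x))"
    by (simp add: Re_exp mult.commute)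
  also have "\<dots> = (LINT g|lborel. std_normal_density g * cos (g * x))"
    by (subst integral_density) auto
  finally show "(LINT g|lborel. std_normal_density g * cos (g * x)) = exp (- x\<^sup>2 / 2)" ..
qed

lemma gaussian_integral_exp:
  assumes "b \<ge> 0"
  shows "integrable lborel (\<lambda>g. std_normal_density g * exp (- b * g\<^sup>2))"
    and "(LINT g|lborel. std_normal_density g * exp (- b * g\<^sup>2)) = 1 / sqrt (1 + 2 * b)"
proof -
  define s where "s = 1 / sqrt (1 + 2 * b)"
  have s: "s > 0" "s\<^sup>2 = 1 / (1 + 2 * b)" using assms by (auto simp: s_def power_divide)
  have b': "1 + 2 * b > 0" using assms by simp
  have *: "std_normal_density g * exp (- b * g\<^sup>2) = s * normal_density 0 s g" for g
  proof -
    have e: "- g\<^sup>2 / 2 + - b * g\<^sup>2 = - g\<^sup>2 / (2 * s\<^sup>2)"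
      unfolding s(2) using b' by (simp add: field_simps)
    have "sqrt (2 * pi * s\<^sup>2) = sqrt (2 * pi) * s" using s(1) by (simp only: real_sqrt_mult real_sqrt_abs abs_of_pos)
    then have "s * normal_density 0 s g = 1 / sqrt (2 * pi) * exp (- g\<^sup>2 / (2 * s\<^sup>2))"
      using s(1) by (simp add: normal_density_def)
    also have "\<dots> = std_normal_density g * exp (- b * g\<^sup>2)"
      unfolding e[symmetric] exp_add std_normal_density_def by simp
    finally show ?thesis ..
  qed
  show "integrable lborel (\<lambda>g. std_normal_density g * exp (- b * g\<^sup>2))"
    unfolding * by (intro integrable_mult_right integrable_normal_density s)
  show "(LINT g|lborel. std_normal_density g * exp (- b * g\<^sup>2)) = 1 / sqrt (1 + 2 * b)"
    unfolding * using integral_normal_density[OF s(1)] by (simp add: s_def)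
qed

text \<open>
  The constant 4 in place of the optimal 2 makes the fourth order Taylor polynomial sufficient.
\<close>

lemma cos_le_exp:
  fixes x :: real
  assumes "\<bar>x\<bar> \<le> 1"
  shows "0 \<le> cos x" "cos x \<le> exp (- x\<^sup>2 / 4)"
proof -
  have "1 < pi / 2" using pi_gt3 by simp
  then show "0 \<le> cos x" using assms by (intro cos_ge_zero) auto
  obtain t where t: "cos x = (\<Sum>m<4. cos_coeff m * x ^ m) + cos (t + 1/2 * real 4 * pi) / fact 4 * x ^ 4"
    using Maclaurin_cos_expansion[of x 4] by blast
  have "(\<Sum>m<4. cos_coeff m * x ^ m) = 1 - x\<^sup>2 / 2"
    by (simp add: numeral_eq_Suc cos_coeff_Suc sin_coeff_Suc)
  then have "cos x = 1 - x\<^sup>2 / 2 + cos (t + 1/2 * real 4 * pi) * (x ^ 4 / 24)"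
    using t by (simp add: fact_numeral)
  also have "\<dots> \<le> 1 - x\<^sup>2 / 2 + 1 * (x ^ 4 / 24)"
    by (intro add_left_mono mult_right_mono) auto
  also have "x ^ 4 \<le> x\<^sup>2"
  proof -
    have "x\<^sup>2 \<le> 1" using assms by (simp add: abs_square_le_1)
    then have "x\<^sup>2 * x\<^sup>2 \<le> x\<^sup>2 * 1" by (intro mult_left_mono) auto
    then show ?thesis by (simp add: power_add[symmetric])
  qed
  then have "1 - x\<^sup>2 / 2 + 1 * (x ^ 4 / 24) \<le> 1 + (- x\<^sup>2 / 4)"
    using zero_le_power2[of x] by linarith
  also have "\<dots> \<le> exp (- x\<^sup>2 / 4)" by (rule exp_ge_add_one_self)
  finally show "cos x \<le> exp (- x\<^sup>2 / 4)" .
qed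

text \<open>
  The indicator of \<open>|S| \<le> \<tau>\<close> is at most \<open>2 * exp (- (S / \<tau>)\<^sup>2 / 2)\<close>, which is a Gaussian average of
  \<open>cos (g * S / \<tau>)\<close>. Averaging over the signs gives the product of the \<open>cos (g * a j / \<tau>)\<close>. As long as
  all arguments are at most 1 this product is at most \<open>exp (- g\<^sup>2 s\<^sup>2 / (4 \<tau>\<^sup>2))\<close>, whose Gaussian
  average is of order \<open>\<tau> / s\<close>. The remaining values of \<open>g\<close> are rare by Chebyshev's inequality and
  account for the term with \<open>m\<close>.
\<close>

lemma sign_sum_small_ball:
  fixes a :: "'i \<Rightarrow> real"
  assumes J: "finite J" and \<tau>: "\<tau> > 0" and m: "\<And>j. j \<in> J \<Longrightarrow> (a j)\<^sup>2 \<le> m"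
    and s: "s > 0" "s\<^sup>2 = (\<Sum>j\<in>J. (a j)\<^sup>2)"
  shows "sign_avg J (\<lambda>w. of_bool (\<bar>\<Sum>j\<in>J. w j * a j\<bar> \<le> \<tau>)) w0 \<le> 3 * \<tau> / s + 2 * m / \<tau>\<^sup>2"
proof -
  let ?S = "\<lambda>w. \<Sum>j\<in>J. w j * (a j / \<tau>)"
  have m0: "m \<ge> 0"
  proof -
    from s have "J \<noteq> {}" by auto
    then show ?thesis using m order.trans[OF zero_le_power2] by blast
  qed
  have S: "(\<Sum>j\<in>J. w j * a j) = \<tau> * ?S w" for w
    using \<tau> by (simp add: sum_distrib_left)
  have "of_bool (\<bar>\<Sum>j\<in>J. w j * a j\<bar> \<le> \<tau>) \<le> 2 * exp (- (?S w)\<^sup>2 / 2)" for w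
  proof (cases "\<bar>\<Sum>j\<in>J. w j * a j\<bar> \<le> \<tau>")
    case True
    then have "\<bar>?S w\<bar> \<le> 1" unfolding S using \<tau> by (simp add: abs_mult)
    then have "(?S w)\<^sup>2 \<le> 1" by (simp add: abs_square_le_1)
    then have "1 \<le> 2 * (1 + - (?S w)\<^sup>2 / 2)" by simp
    also have "\<dots> \<le> 2 * exp (- (?S w)\<^sup>2 / 2)"
      by (intro mult_left_mono exp_ge_add_one_self) auto
    finally show ?thesis using True by simp
  qed auto
  then have "sign_avg J (\<lambda>w. of_bool (\<bar>\<Sum>j\<in>J. w j * a j\<bar> \<le> \<tau>)) w0 \<le>
      sign_avg J (\<lambda>w. 2 * (LINT g|lborel. std_normal_density g * cos (g * ?S w))) w0"
    unfolding gaussian_integral_cos(2) by (rule sign_avg_mono)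
  also have "\<dots> = 2 * (LINT g|lborel. std_normal_density g * sign_avg J (\<lambda>w. cos (g * ?S w)) w0)"
    by (simp add: sign_avg_cmult sign_avg_integral gaussian_integral_cos(1))
  also have "\<dots> \<le> 2 * (LINT g|lborel. std_normal_density g * exp (- (s\<^sup>2 / (4 * \<tau>\<^sup>2)) * g\<^sup>2)
                    + m / \<tau>\<^sup>2 * (std_normal_density g * g ^ 2))"
  proof (intro mult_left_mono integral_mono)
    have "(\<lambda>g. std_normal_density g * sign_avg J (\<lambda>w. cos (g * ?S w)) w0) =
        (\<lambda>g. sign_avg J (\<lambda>w. std_normal_density g * cos (g * ?S w)) w0)"
      by (simp add: sign_avg_cmult)
    then show "integrable lborel (\<lambda>g. std_normal_density g * sign_avg J (\<lambda>w. cos (g * ?S w)) w0)"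
      unfolding sign_avg_def by (simp add: gaussian_integral_cos(1))
    have "integrable lborel (\<lambda>g. std_normal_density g * g ^ 2)"
      by (rule integrable_std_normal_moment)
    then show "integrable lborel (\<lambda>g. std_normal_density g * exp (- (s\<^sup>2 / (4 * \<tau>\<^sup>2)) * g\<^sup>2)
                    + m / \<tau>\<^sup>2 * (std_normal_density g * g ^ 2))"
      by (intro Bochner_Integration.integrable_add integrable_mult_right gaussian_integral_exp(1)) auto
    fix g :: real
    have "sign_avg J (\<lambda>w. cos (g * ?S w)) w0 =
        sign_avg J (\<lambda>w. cos (0 + (\<Sum>j\<in>J. w j * (g * a j / \<tau>)))) w0"
      by (simp add: sum_distrib_left mult_ac)
    also have "\<dots> = (\<Prod>j\<in>J. cos (g * a j / \<tau>))"
      by (subst sign_avg_cos[OF J]) simp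
    also have "\<dots> \<le> exp (- (s\<^sup>2 / (4 * \<tau>\<^sup>2)) * g\<^sup>2) + m / \<tau>\<^sup>2 * g ^ 2"
    proof (cases "m / \<tau>\<^sup>2 * g ^ 2 \<le> 1")
      case True
      have "\<bar>g * a j / \<tau>\<bar> \<le> 1" if "j \<in> J" for j
      proof -
        have "(g * a j / \<tau>)\<^sup>2 = (a j)\<^sup>2 / \<tau>\<^sup>2 * g\<^sup>2" by (simp add: power_mult_distrib power_divide)
        also have "\<dots> \<le> m / \<tau>\<^sup>2 * g\<^sup>2" by (intro mult_right_mono divide_right_mono m that) auto
        finally show ?thesis using True by (simp only: abs_square_le_1[symmetric])
      qed
      then have "(\<Prod>j\<in>J. cos (g * a j / \<tau>)) \<le> (\<Prod>j\<in>J. exp (- (g * a j / \<tau>)\<^sup>2 / 4))"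
        by (intro prod_mono conjI cos_le_exp) auto
      also have "\<dots> = exp (\<Sum>j\<in>J. - (g * a j / \<tau>)\<^sup>2 / 4)" by (rule exp_sum[OF J, symmetric])
      also have "(\<Sum>j\<in>J. - (g * a j / \<tau>)\<^sup>2 / 4) = (\<Sum>j\<in>J. - (g\<^sup>2 / (4 * \<tau>\<^sup>2)) * (a j)\<^sup>2)"
        by (intro sum.cong refl) (simp add: power_mult_distrib power_divide)
      also have "\<dots> = - (s\<^sup>2 / (4 * \<tau>\<^sup>2)) * g\<^sup>2"
        unfolding sum_distrib_left[symmetric] s(2)[symmetric] by simp
      finally show ?thesis using m0 by (smt (verit) divide_nonneg_nonneg mult_nonneg_nonneg zero_le_power2)
    next
      case False
      have "(\<Prod>j\<in>J. cos (g * a j / \<tau>)) \<le> \<bar>\<Prod>j\<in>J. cos (g * a j / \<tau>)\<bar>" by simp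
      also have "\<dots> \<le> (\<Prod>j\<in>J. 1)" unfolding abs_prod by (intro prod_mono) auto
      finally show ?thesis using False by (smt (verit) exp_ge_zero prod.neutral_const)
    qed
    finally show "std_normal_density g * sign_avg J (\<lambda>w. cos (g * ?S w)) w0
        \<le> std_normal_density g * exp (- (s\<^sup>2 / (4 * \<tau>\<^sup>2)) * g\<^sup>2)
                    + m / \<tau>\<^sup>2 * (std_normal_density g * g ^ 2)"
      using mult_left_mono[of "sign_avg J (\<lambda>w. cos (g * ?S w)) w0"
          "exp (- (s\<^sup>2 / (4 * \<tau>\<^sup>2)) * g\<^sup>2) + m / \<tau>\<^sup>2 * g ^ 2" "std_normal_density g"]
      by (simp add: distrib_left mult_ac)
  qed auto
  also have "\<dots> = 2 * (1 / sqrt (1 + 2 * (s\<^sup>2 / (4 * \<tau>\<^sup>2))) + m / \<tau>\<^sup>2)"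
  proof -
    have "(LINT g|lborel. std_normal_density g * g ^ 2) = 1"
      using integral_std_normal_moment_even[of 1] by simp
    moreover have b: "s\<^sup>2 / (4 * \<tau>\<^sup>2) \<ge> 0" by simp
    ultimately show ?thesis
      by (subst Bochner_Integration.integral_add)
         (simp_all only: gaussian_integral_exp[OF b] integrable_mult_right integrable_std_normal_moment
           integral_mult_right_zero mult_1_right)
  qed
  also have "1 / sqrt (1 + 2 * (s\<^sup>2 / (4 * \<tau>\<^sup>2))) \<le> 3 / 2 * \<tau> / s"
  proof -
    have "(2 * s / (3 * \<tau>))\<^sup>2 \<le> 1 + 2 * (s\<^sup>2 / (4 * \<tau>\<^sup>2))"
      using \<tau> by (simp add: power_divide power_mult_distrib field_simps)
    then have "2 * s / (3 * \<tau>) \<le> sqrt (1 + 2 * (s\<^sup>2 / (4 * \<tau>\<^sup>2)))" by (rule real_le_rsqrt)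
    then have "1 / sqrt (1 + 2 * (s\<^sup>2 / (4 * \<tau>\<^sup>2))) \<le> 1 / (2 * s / (3 * \<tau>))"
      using s(1) \<tau> by (intro divide_left_mono mult_pos_pos) (auto simp: add_pos_nonneg)
    then show ?thesis by simp
  qed
  finally show ?thesis by (simp add: algebra_simps)
qed

text \<open>
  The Paley--Zygmund inequality for a variable whose second moment is at most three times the square
  of its mean, which is what the fourth moment bound supplies for sums of squares of signed sums.
\<close>

lemma paley_zygmund_half:
  assumes I: "finite I" and f: "\<And>w. f w \<ge> 0" and A: "A > 0"
    and "sign_avg I f w0 = A" "sign_avg I (\<lambda>w. (f w)\<^sup>2) w0 \<le> 3 * A\<^sup>2"
  shows "1 / 12 \<le> sign_avg I (\<lambda>w. of_bool (A / 2 \<le> f w)) w0"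
proof -
  (* Young's inequality with weight 6 * A, chosen to balance 3 * A\<^sup>2 against A. *)
  have "f w \<le> A / 2 + ((f w)\<^sup>2 / (12 * A) + 3 * A * of_bool (A / 2 \<le> f w))" for w
  proof (cases "A / 2 \<le> f w")
    case True
    have "0 \<le> (f w - 6 * A)\<^sup>2 / (12 * A)" using A by simp
    also have "\<dots> = (f w)\<^sup>2 / (12 * A) + 3 * A - f w"
      using A by (simp add: power2_eq_square field_simps)
    finally show ?thesis using True A by simp
  qed (use A in \<open>auto simp: add_increasing2\<close>)
  then have "sign_avg I f w0 \<le>
      sign_avg I (\<lambda>w. A / 2 + ((f w)\<^sup>2 / (12 * A) + 3 * A * of_bool (A / 2 \<le> f w))) w0"
    by (rule sign_avg_mono)
  then have "A \<le> A / 2 + sign_avg I (\<lambda>w. (f w)\<^sup>2) w0 / (12 * A) +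
      3 * A * sign_avg I (\<lambda>w. of_bool (A / 2 \<le> f w)) w0"
    using assms(4) I by (simp add: sign_avg_add sign_avg_divide sign_avg_cmult)
  also have "sign_avg I (\<lambda>w. (f w)\<^sup>2) w0 / (12 * A) \<le> 3 * A\<^sup>2 / (12 * A)"
    using assms(5) A by (intro divide_right_mono) auto
  also have "3 * A\<^sup>2 / (12 * A) = A / 4" using A by (simp add: power2_eq_square)
  finally have "A * 1 \<le> A * (12 * sign_avg I (\<lambda>w. of_bool (A / 2 \<le> f w)) w0)" by simp
  then show ?thesis using A by (subst (asm) mult_le_cancel_left_pos) auto
qed

text \<open>
  The vector sum \<open>V\<close> is projected on an independent random sign vector \<open>h\<close>. With probability at
  least 1/24 the projected coefficients \<open>a j\<close> have total square at least half of the expected value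
  (Paley--Zygmund) and none of them is dominant (fourth moments). If \<open>|V| \<le> s\<close> then the projection of
  \<open>V\<close> is at most \<open>7 * s\<close> with probability at least 48/49, by Chebyshev's inequality. Since \<open>h\<close> is
  independent of the signs in \<open>V\<close>, the probability of \<open>|V| \<le> s\<close> is at most 48 times the worst scalar
  small ball probability over good \<open>h\<close>.
\<close>

lemma vector_small_ball:
  fixes v :: "'i \<Rightarrow> 'd \<Rightarrow> real"
  assumes J: "finite J" and X: "finite X"
    and W: "\<And>j. j \<in> J \<Longrightarrow> (\<Sum>d\<in>X. (v j d)\<^sup>2) \<le> W" "W > 0"
    and A: "(\<Sum>j\<in>J. \<Sum>d\<in>X. (v j d)\<^sup>2) = N * W" and N: "N > 0" and t: "t > 0"
  shows "sign_avg J (\<lambda>w. of_bool ((\<Sum>d\<in>X. (\<Sum>j\<in>J. w j * v j d)\<^sup>2) \<le> t\<^sup>2 * (N * W))) w0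
    \<le> 1500 * (t + 1 / (t\<^sup>2 * sqrt N))"
proof -
  let ?V = "\<lambda>w d. \<Sum>j\<in>J. w j * v j d"
  let ?a = "\<lambda>h j. \<Sum>d\<in>X. h d * v j d"
  let ?A = "N * W"
  define f where "f = (\<lambda>h. \<Sum>j\<in>J. (?a h j)\<^sup>2)"
  define g where "g = (\<lambda>h. \<Sum>j\<in>J. (?a h j) ^ 4)"
  define s where "s = t * sqrt ?A"
  define G where "G = (\<lambda>h. ?A / 2 \<le> f h \<and> g h \<le> 72 * W * ?A)"
  define h0 :: "'d \<Rightarrow> real" where "h0 = (\<lambda>_. 0)"
  have A0: "?A > 0" using N W by simp
  have s: "s > 0" "s\<^sup>2 = t\<^sup>2 * ?A" using A0 t N W by (auto simp: s_def power_mult_distrib)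
  have A': "(\<Sum>d\<in>X. \<Sum>j\<in>J. (v j d)\<^sup>2) = ?A"
    using A by (subst sum.swap)
  have Ef: "sign_avg X f h0 = ?A"
    using sign_avg_vector_second[OF X, where X = J and c = "\<lambda>_. 0" and v = "\<lambda>d j. v j d" and ?w0.0 = h0]
    by (simp add: f_def A')
  have "sign_avg X (\<lambda>h. (f h)\<^sup>2) h0 \<le> 3 * ?A\<^sup>2"
    using sign_avg_vector_fourth[OF X, where X = J and c = "\<lambda>_. 0" and v = "\<lambda>d j. v j d" and ?w0.0 = h0]
    by (simp add: f_def A')
  then have Gf: "1 / 12 \<le> sign_avg X (\<lambda>h. of_bool (?A / 2 \<le> f h)) h0"
    using Ef A0 by (intro paley_zygmund_half[OF X]) (auto simp: f_def intro: sum_nonneg)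
  have Eg: "sign_avg X g h0 \<le> 3 * W * ?A"
  proof -
    have "sign_avg X (\<lambda>h. (?a h j) ^ 4) h0 \<le> 3 * W * (\<Sum>d\<in>X. (v j d)\<^sup>2)" if j: "j \<in> J" for j
    proof -
      have "sign_avg X (\<lambda>h. (?a h j) ^ 4) h0 \<le> 3 * (\<Sum>d\<in>X. (v j d)\<^sup>2)\<^sup>2"
        using sign_avg_vector_fourth[OF X, where X = "{j}" and c = "\<lambda>_. 0" and v = "\<lambda>d j. v j d" and ?w0.0 = h0]
        by simp
      also have "\<dots> \<le> 3 * (W * (\<Sum>d\<in>X. (v j d)\<^sup>2))"
        unfolding power2_eq_square[of "sum _ _"]
        using W(1)[OF j] by (intro mult_left_mono mult_right_mono) (auto intro: sum_nonneg)
      finally show ?thesis by simp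
    qed
    then have "sign_avg X g h0 \<le> (\<Sum>j\<in>J. 3 * W * (\<Sum>d\<in>X. (v j d)\<^sup>2))"
      unfolding g_def sign_avg_sum by (rule sum_mono)
    then show ?thesis by (simp add: sum_distrib_left[symmetric] A)
  qed
  have "sign_avg X (\<lambda>h. of_bool (72 * W * ?A \<le> g h)) h0 \<le> sign_avg X g h0 / (72 * W * ?A)"
    using A0 W by (intro sign_avg_markov) (auto simp: g_def intro!: sum_nonneg)
  also have "\<dots> \<le> 3 * W * ?A / (72 * W * ?A)"
    using A0 W by (intro divide_right_mono Eg) auto
  also have "\<dots> = 1 / 24" using N W by simp
  finally have Gg: "sign_avg X (\<lambda>h. of_bool (72 * W * ?A \<le> g h)) h0 \<le> 1 / 24" .
  have proj: "(\<Sum>d\<in>X. h d * ?V w d) = (\<Sum>j\<in>J. w j * ?a h j)" for h w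
    unfolding sum_distrib_left by (subst sum.swap) (simp add: mult_ac)
  (* 1/12 - 1/24 - 1/49 is at least 1/48. *)
  have key: "of_bool ((\<Sum>d\<in>X. (?V w d)\<^sup>2) \<le> t\<^sup>2 * ?A) \<le>
      48 * sign_avg X (\<lambda>h. of_bool (G h \<and> \<bar>\<Sum>j\<in>J. w j * ?a h j\<bar> \<le> 7 * s)) h0" for w
  proof (cases "(\<Sum>d\<in>X. (?V w d)\<^sup>2) \<le> t\<^sup>2 * ?A")
    case True
    let ?P = "\<lambda>h. \<Sum>j\<in>J. w j * ?a h j"
    have "sign_avg X (\<lambda>h. of_bool ((7 * s)\<^sup>2 \<le> (?P h)\<^sup>2)) h0 \<le>
        sign_avg X (\<lambda>h. (?P h)\<^sup>2) h0 / (7 * s)\<^sup>2"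
      using s(1) by (intro sign_avg_markov) auto
    also have "sign_avg X (\<lambda>h. (?P h)\<^sup>2) h0 = (\<Sum>d\<in>X. (?V w d)\<^sup>2)"
      using sign_avg_vector_second[OF X, where X = "{()}" and c = "\<lambda>_. 0" and v = "\<lambda>d _. ?V w d" and ?w0.0 = h0]
      by (simp add: proj)
    also have "\<dots> / (7 * s)\<^sup>2 \<le> s\<^sup>2 / (7 * s)\<^sup>2"
      using True unfolding s(2)[symmetric] by (rule divide_right_mono) (rule zero_le_power2)
    also have "\<dots> = 1 / 49" using s(1) by (simp add: power_mult_distrib)
    finally have P: "sign_avg X (\<lambda>h. of_bool ((7 * s)\<^sup>2 \<le> (?P h)\<^sup>2)) h0 \<le> 1 / 49" .
    have "of_bool (?A / 2 \<le> f h) \<le> of_bool (G h \<and> \<bar>?P h\<bar> \<le> 7 * s) +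
        (of_bool (72 * W * ?A \<le> g h) + of_bool ((7 * s)\<^sup>2 \<le> (?P h)\<^sup>2) :: real)" for h
    proof -
      have "(7 * s)\<^sup>2 \<le> (?P h)\<^sup>2" if "\<not> \<bar>?P h\<bar> \<le> 7 * s"
        using that s by (intro abs_le_square_iff[THEN iffD1]) auto
      then show ?thesis unfolding G_def by auto
    qed
    then have "sign_avg X (\<lambda>h. of_bool (?A / 2 \<le> f h)) h0 \<le>
       sign_avg X (\<lambda>h. of_bool (G h \<and> \<bar>?P h\<bar> \<le> 7 * s) +
        (of_bool (72 * W * ?A \<le> g h) + of_bool ((7 * s)\<^sup>2 \<le> (?P h)\<^sup>2))) h0"
      by (rule sign_avg_mono)
    with Gf Gg P show ?thesis using True by (simp add: sign_avg_add)
  qed (auto intro!: sign_avg_nonneg)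
  have bound: "sign_avg J (\<lambda>w. of_bool (G h \<and> \<bar>\<Sum>j\<in>J. w j * ?a h j\<bar> \<le> 7 * s)) w0 \<le>
      30 * t + 1 / (2 * t\<^sup>2 * sqrt N)" for h
  proof (cases "G h")
    case True
    then have fh: "?A / 2 \<le> f h" and gh: "g h \<le> 72 * W * ?A" by (auto simp: G_def)
    have f0: "f h > 0" using fh A0 by linarith
    have sq: "(u\<^sup>2)\<^sup>2 = u ^ 4" for u :: real by (simp flip: power_mult)
    have "(?a h j)\<^sup>2 \<le> 9 * W * sqrt N" if "j \<in> J" for j
    proof -
      have "(?a h j) ^ 4 \<le> g h"
        unfolding g_def using J that by (intro member_le_sum) auto
      also have "\<dots> \<le> 72 * W * ?A" by (rule gh)
      also have "\<dots> \<le> (9 * W * sqrt N)\<^sup>2"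
        using N W by (simp add: power_mult_distrib power2_eq_square)
      finally have "((?a h j)\<^sup>2)\<^sup>2 \<le> (9 * W * sqrt N)\<^sup>2" unfolding sq .
      moreover have "0 \<le> 9 * W * sqrt N" using N W by simp
      ultimately show ?thesis by (rule power2_le_imp_le)
    qed
    then have "sign_avg J (\<lambda>w. of_bool (\<bar>\<Sum>j\<in>J. w j * ?a h j\<bar> \<le> 7 * s)) w0 \<le>
        3 * (7 * s) / sqrt (f h) + 2 * (9 * W * sqrt N) / (7 * s)\<^sup>2"
      using s f0 by (intro sign_sum_small_ball J) (auto simp: f_def)
    also have "3 * (7 * s) / sqrt (f h) \<le> 30 * t"
    proof -
      have "21 * sqrt ?A \<le> 30 * sqrt (?A / 2)"
      proof (rule power2_le_imp_le)
        show "(21 * sqrt ?A)\<^sup>2 \<le> (30 * sqrt (?A / 2))\<^sup>2"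
          using A0 N W by (simp add: power_mult_distrib)
      qed (use A0 in auto)
      also have "\<dots> \<le> 30 * sqrt (f h)" using fh by simp
      finally have "t * (21 * sqrt ?A) \<le> t * (30 * sqrt (f h))" using t by simp
      then show ?thesis using f0 by (simp add: s_def field_simps)
    qed
    also have "2 * (9 * W * sqrt N) / (7 * s)\<^sup>2 \<le> 1 / (2 * t\<^sup>2 * sqrt N)"
    proof -
      have "2 * (9 * W * sqrt N) * (2 * t\<^sup>2 * sqrt N) = 36 * (W * t\<^sup>2) * (sqrt N * sqrt N)"
        by (simp add: algebra_simps)
      also have "\<dots> = 36 * s\<^sup>2" unfolding s(2) using N by simp
      also have "\<dots> \<le> 1 * (7 * s)\<^sup>2" by (simp add: power_mult_distrib)
      finally have le: "2 * (9 * W * sqrt N) * (2 * t\<^sup>2 * sqrt N) \<le> 1 * (7 * s)\<^sup>2" .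
      have "2 * t\<^sup>2 * sqrt N > 0" "(7 * s)\<^sup>2 > 0" using s(1) t N by auto
      with le show ?thesis
        by (simp only: pos_divide_le_eq pos_le_divide_eq times_divide_eq_left)
    qed
    finally show ?thesis using True by simp
  next
    case False
    then show ?thesis using J t N by simp
  qed
  have "sign_avg J (\<lambda>w. of_bool ((\<Sum>d\<in>X. (?V w d)\<^sup>2) \<le> t\<^sup>2 * ?A)) w0 \<le>
    sign_avg J (\<lambda>w. 48 * sign_avg X (\<lambda>h. of_bool (G h \<and> \<bar>\<Sum>j\<in>J. w j * ?a h j\<bar> \<le> 7 * s)) h0) w0"
    by (intro sign_avg_mono key)
  also have "\<dots> = 48 * sign_avg X (\<lambda>h. sign_avg J (\<lambda>w. of_bool (G h \<and> \<bar>\<Sum>j\<in>J. w j * ?a h j\<bar> \<le> 7 * s)) w0) h0"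
    unfolding sign_avg_cmult by (subst sign_avg_swap) (rule refl)
  also have "\<dots> \<le> 48 * (30 * t + 1 / (2 * t\<^sup>2 * sqrt N))"
    by (intro mult_left_mono sign_avg_le_const X bound) auto
  also have "\<dots> = 1440 * t + 24 * (1 / (t\<^sup>2 * sqrt N))" by simp
  also have "\<dots> \<le> 1500 * (t + 1 / (t\<^sup>2 * sqrt N))"
    unfolding distrib_left using t N by (intro add_mono mult_right_mono) auto
  finally show ?thesis .
qed

section \<open>One step of the Laplace expansion\<close>

text \<open>
  If \<open>z C\<close> is the permanent of the lines read so far on the positions outside \<open>C\<close>, this is the same
  data after the line \<open>x\<close> has been read. Indexing by the complement makes the step independent of
  the number of lines.
\<close>

definition laplace_step ::
    "nat set \<Rightarrow> (nat \<Rightarrow> real) \<Rightarrow> (nat set \<Rightarrow> real) \<Rightarrow> nat set \<Rightarrow> real" where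
  "laplace_step R x z D = (\<Sum>j\<in>R - D. x j * z (insert j D))"

abbreviation level :: "nat set \<Rightarrow> nat \<Rightarrow> nat set set" where
  "level R N \<equiv> {C. C \<subseteq> R \<and> card C = N}"

text \<open>
  The sum of the squares of all minors with \<open>N\<close> uncovered positions.
\<close>

definition mass :: "nat set \<Rightarrow> nat \<Rightarrow> (nat set \<Rightarrow> real) \<Rightarrow> real" where
  "mass R N z = (\<Sum>C\<in>level R N. (z C)\<^sup>2)"

lemma finite_level [simp]: "finite R \<Longrightarrow> finite (level R N)"
  by (rule finite_subset[of _ "Pow R"]) auto

lemma mass_nonneg: "0 \<le> mass R N z"
  by (simp add: mass_def sum_nonneg)

lemma laplace_step_cong:
  "(\<And>j. j \<in> R \<Longrightarrow> x j = y j) \<Longrightarrow> laplace_step R x z = laplace_step R y z"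
  by (auto simp: laplace_step_def fun_eq_iff intro!: sum.cong)

lemma laplace_step_linear:
  assumes "finite R"
  shows "laplace_step R x z D = (\<Sum>j\<in>R. x j * (if j \<in> D then 0 else z (insert j D)))"
proof -
  have "(\<Sum>j\<in>R. x j * (if j \<in> D then 0 else z (insert j D))) =
      (\<Sum>j\<in>R - D. x j * (if j \<in> D then 0 else z (insert j D)))"
    using assms by (intro sum.mono_neutral_right) auto
  then show ?thesis by (simp add: laplace_step_def)
qed

text \<open>
  Both sides enumerate the pairs of a set and one of its elements.
\<close>

lemma sum_level_insert:
  assumes "finite R"
  shows "(\<Sum>D\<in>level R N. \<Sum>j\<in>R - D. F j (insert j D)) = (\<Sum>C\<in>level R (Suc N). \<Sum>j\<in>C. F j C)"
proof -
  have fin: "finite D" if "D \<subseteq> R" for D using that assms finite_subset by blast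
  have "(\<Sum>D\<in>level R N. \<Sum>j\<in>R - D. F j (insert j D)) =
      (\<Sum>(D, j)\<in>Sigma (level R N) (\<lambda>D. R - D). F j (insert j D))"
    using assms by (subst sum.Sigma) auto
  also have "\<dots> = (\<Sum>(C, j)\<in>Sigma (level R (Suc N)) (\<lambda>C. C). F j C)"
    by (rule sum.reindex_bij_witness[of _ "\<lambda>(C, j). (C - {j}, j)" "\<lambda>(D, j). (insert j D, j)"])
       (auto simp: insert_absorb fin)
  also have "\<dots> = (\<Sum>C\<in>level R (Suc N). \<Sum>j\<in>C. F j C)"
    using assms by (subst sum.Sigma) (auto intro: fin)
  finally show ?thesis .
qed

lemma sum_step_vectors:
  assumes "finite R"
  shows "(\<Sum>j\<in>R. \<Sum>D\<in>level R N. (if j \<in> D then 0 else z (insert j D))\<^sup>2) =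
    real (Suc N) * mass R (Suc N) z"
proof -
  have "(\<Sum>j\<in>R. \<Sum>D\<in>level R N. (if j \<in> D then 0 else z (insert j D))\<^sup>2) =
      (\<Sum>D\<in>level R N. \<Sum>j\<in>R. if j \<in> D then 0 else (z (insert j D))\<^sup>2)"
    by (subst sum.swap) (auto intro!: sum.cong)
  also have "\<dots> = (\<Sum>D\<in>level R N. \<Sum>j\<in>R - D. (z (insert j D))\<^sup>2)"
    using assms by (intro sum.cong refl sum.mono_neutral_cong_right) auto
  also have "\<dots> = (\<Sum>C\<in>level R (Suc N). \<Sum>j\<in>C. (z C)\<^sup>2)"
    by (rule sum_level_insert[OF assms])
  also have "\<dots> = real (Suc N) * mass R (Suc N) z"
    by (simp add: mass_def sum_distrib_left)
  finally show ?thesis .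
qed

lemma mass_step_eq:
  assumes "finite R"
  shows "mass R N (laplace_step R x z) =
    (\<Sum>D\<in>level R N. (\<Sum>j\<in>R. x j * (if j \<in> D then 0 else z (insert j D)))\<^sup>2)"
  unfolding mass_def laplace_step_linear[OF assms] ..

lemma sign_avg_mass_step:
  assumes "finite R"
  shows "sign_avg R (\<lambda>x. mass R N (laplace_step R x z)) x0 = real (Suc N) * mass R (Suc N) z"
  unfolding mass_step_eq[OF assms] sum_step_vectors[OF assms, symmetric]
  using sign_avg_vector_second[OF assms, where X = "level R N" and c = "\<lambda>_. 0"
      and v = "\<lambda>j D. if j \<in> D then 0 else z (insert j D)" and ?w0.0 = x0] by simp

text \<open>
  No single sign of the new line carries more than a fraction \<open>1 / (N + 1)\<close> of the expected mass; this
  is the low influence condition of the small ball estimate.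
\<close>

lemma influence_le_mass:
  assumes "finite R" "j \<in> R"
  shows "(\<Sum>D\<in>level R N. (if j \<in> D then 0 else z (insert j D))\<^sup>2) \<le> mass R (Suc N) z"
proof -
  have fin: "finite D" if "D \<subseteq> R" for D using that assms finite_subset by blast
  have inj: "inj_on (insert j) {D \<in> level R N. j \<notin> D}"
    by (auto simp: inj_on_def)
  have "(\<Sum>D\<in>level R N. (if j \<in> D then 0 else z (insert j D))\<^sup>2) =
      (\<Sum>D\<in>{D \<in> level R N. j \<notin> D}. (z (insert j D))\<^sup>2)"
    using assms by (intro sum.mono_neutral_cong_right) auto
  also have "\<dots> = (\<Sum>C\<in>insert j ` {D \<in> level R N. j \<notin> D}. (z C)\<^sup>2)"
    using inj by (simp add: sum.reindex)
  also have "\<dots> \<le> mass R (Suc N) z"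
    unfolding mass_def using assms by (intro sum_mono2) (auto simp: fin)
  finally show ?thesis .
qed

lemma mass_step_small_ball:
  assumes "finite R" "mass R (Suc N) z > 0" "t > 0"
  shows "sign_avg R (\<lambda>x. of_bool (mass R N (laplace_step R x z) \<le>
      t\<^sup>2 * (real (Suc N) * mass R (Suc N) z))) x0 \<le> 1500 * (t + 1 / (t\<^sup>2 * sqrt (real (Suc N))))"
  unfolding mass_step_eq[OF assms(1)]
  using assms by (intro vector_small_ball influence_le_mass sum_step_vectors) auto

text \<open>
  The conditions concern different coordinates, hence are independent, and each fails for at least
  one of the two signs.
\<close>

lemma sign_avg_all_bad:
  assumes "finite C" "\<And>j. j \<in> C \<Longrightarrow> \<not> (P j 1 \<and> P j (-1))"
  shows "sign_avg C (\<lambda>x. of_bool (\<forall>j\<in>C. P j (x j))) x0 \<le> 1 / 2 ^ card C"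
  using assms
proof (induction C arbitrary: x0 rule: finite_induct)
  case (insert i C)
  have *: "sign_avg C (\<lambda>x. of_bool (\<forall>j\<in>insert i C. P j (x j))) (x0(i := s)) \<le>
      of_bool (P i s) * (1 / 2 ^ card C)" for s
  proof -
    have "sign_avg C (\<lambda>x. of_bool (\<forall>j\<in>insert i C. P j (x j))) (x0(i := s)) =
       sign_avg C (\<lambda>x. of_bool (P i s) * of_bool (\<forall>j\<in>C. P j (x j))) (x0(i := s))"
      using insert.hyps by (intro sign_avg_cong_outside) auto
    also have "\<dots> \<le> of_bool (P i s) * (1 / 2 ^ card C)"
      unfolding sign_avg_cmult using insert by (intro mult_left_mono insert.IH) auto
    finally show ?thesis .
  qed
  have "of_bool (P i 1) + of_bool (P i (-1)) \<le> (1 :: real)"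
    using insert.prems[of i] by auto
  then have "(of_bool (P i 1) + of_bool (P i (-1))) * (1 / 2 ^ card C) \<le> 1 * (1 / 2 ^ card C :: real)"
    by (intro mult_right_mono) auto
  with *[of 1] *[of "-1"] show ?case
    unfolding sign_avg_insert[OF insert.hyps] using insert.hyps by (simp add: algebra_simps)
qed simp

text \<open>
  The coefficient of \<open>x j\<close> in the new minor at \<open>C - {j}\<close> is \<open>z C\<close>, and the signs of the other elements
  of \<open>C\<close> do not occur there. Given the signs outside \<open>C\<close>, at least one value of \<open>x j\<close> makes the new
  minor as large as \<open>z C\<close>, independently for the different \<open>j\<close>.
\<close>

lemma exists_surviving_child:
  assumes R: "finite R" and C: "C \<subseteq> R"
  shows "sign_avg R (\<lambda>x. of_bool (\<forall>j\<in>C. \<bar>laplace_step R x z (C - {j})\<bar> < \<bar>z C\<bar>)) x0 \<le> 1 / 2 ^ card C"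
proof -
  have fC: "finite C" using assms finite_subset by blast
  define b where "b = (\<lambda>x j. \<Sum>i\<in>R - C. x i * z (insert i (C - {j})))"
  have step: "laplace_step R x z (C - {j}) = x j * z C + b x j" if "j \<in> C" for x j
  proof -
    have "R - (C - {j}) = insert j (R - C)" using that C by auto
    then show ?thesis
      using that R by (simp add: laplace_step_def b_def insert_absorb)
  qed
  have "sign_avg R (\<lambda>x. of_bool (\<forall>j\<in>C. \<bar>laplace_step R x z (C - {j})\<bar> < \<bar>z C\<bar>)) x0 =
     sign_avg ((R - C) \<union> C) (\<lambda>x. of_bool (\<forall>j\<in>C. \<bar>x j * z C + b x j\<bar> < \<bar>z C\<bar>)) x0"
    using C by (auto simp: step Un_absorb2 intro!: arg_cong2[of _ _ _ _ "\<lambda>I f. sign_avg I f x0"])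
  also have "\<dots> = sign_avg (R - C) (sign_avg C (\<lambda>x. of_bool (\<forall>j\<in>C. \<bar>x j * z C + b x j\<bar> < \<bar>z C\<bar>))) x0"
    using R fC by (intro sign_avg_union) auto
  also have "\<dots> \<le> 1 / 2 ^ card C"
  proof (rule sign_avg_le_const)
    fix y
    have "sign_avg C (\<lambda>x. of_bool (\<forall>j\<in>C. \<bar>x j * z C + b x j\<bar> < \<bar>z C\<bar>)) y =
        sign_avg C (\<lambda>x. of_bool (\<forall>j\<in>C. \<bar>x j * z C + b y j\<bar> < \<bar>z C\<bar>)) y"
    proof (rule sign_avg_cong_outside)
      fix x assume "\<And>i. i \<notin> C \<Longrightarrow> x i = y i"
      then have "b x j = b y j" for j unfolding b_def by (intro sum.cong) auto
      then show "of_bool (\<forall>j\<in>C. \<bar>x j * z C + b x j\<bar> < \<bar>z C\<bar>) =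
          (of_bool (\<forall>j\<in>C. \<bar>x j * z C + b y j\<bar> < \<bar>z C\<bar>) :: real)" by simp
    qed
    also have "\<dots> \<le> 1 / 2 ^ card C"
      using fC by (rule sign_avg_all_bad) auto
    finally show "sign_avg C (\<lambda>x. of_bool (\<forall>j\<in>C. \<bar>x j * z C + b x j\<bar> < \<bar>z C\<bar>)) y \<le> 1 / 2 ^ card C" .
  qed (use R in auto)
  finally show ?thesis .
qed

text \<open>
  A crude bound that fails only with exponentially small probability. It controls the rare steps that
  the small ball estimate, with its polynomial error term, cannot exclude. Minors without a
  surviving child carry at most half of the mass, by Markov's inequality, and every new minor is the
  child of at most \<open>card R\<close> old ones.
\<close>

lemma mass_step_not_tiny:
  assumes R: "finite R"
  shows "sign_avg R (\<lambda>x. of_bool (mass R N (laplace_step R x z) < mass R (Suc N) z / (2 * real (card R)))) x0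
    \<le> 2 / 2 ^ Suc N"
proof (cases "mass R (Suc N) z = 0")
  case True
  moreover have "\<not> mass R N y < 0" for y using mass_nonneg[of R N y] by simp
  ultimately show ?thesis using R by simp
next
  case False
  define W where "W = mass R (Suc N) z"
  have W: "W > 0" using False mass_nonneg[of R "Suc N" z] by (simp add: W_def)
  have fin: "finite D" if "D \<subseteq> R" for D using that assms finite_subset by blast
  define bad where "bad = (\<lambda>x C. \<forall>j\<in>C. \<bar>laplace_step R x z (C - {j})\<bar> < \<bar>z C\<bar>)"
  define B where "B = (\<lambda>x. \<Sum>C\<in>level R (Suc N). (z C)\<^sup>2 * of_bool (bad x C))"
  have R0: "card R > 0"
  proof -
    have "level R (Suc N) \<noteq> {}" using False unfolding mass_def by (metis sum.empty)
    then show ?thesis using R by (auto simp: card_gt_0_iff)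
  qed
  have imp: "W / 2 \<le> B x" if x: "mass R N (laplace_step R x z) < W / (2 * real (card R))" for x
  proof -
    let ?y = "laplace_step R x z"
    have "(\<Sum>C\<in>level R (Suc N). (z C)\<^sup>2 * of_bool (\<not> bad x C)) \<le>
        (\<Sum>C\<in>level R (Suc N). \<Sum>j\<in>C. (?y (C - {j}))\<^sup>2)"
    proof (rule sum_mono)
      fix C assume C: "C \<in> level R (Suc N)"
      show "(z C)\<^sup>2 * of_bool (\<not> bad x C) \<le> (\<Sum>j\<in>C. (?y (C - {j}))\<^sup>2)"
      proof (cases "bad x C")
        case False
        then obtain j where j: "j \<in> C" "\<bar>z C\<bar> \<le> \<bar>?y (C - {j})\<bar>"
          by (auto simp: bad_def not_less)
        have "(z C)\<^sup>2 \<le> (?y (C - {j}))\<^sup>2" using j(2) by (simp add: abs_le_square_iff)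
        also have "\<dots> \<le> (\<Sum>j\<in>C. (?y (C - {j}))\<^sup>2)"
          using j(1) C fin by (intro member_le_sum) auto
        finally show ?thesis using False by simp
      qed (auto intro: sum_nonneg)
    qed
    also have "\<dots> = (\<Sum>D\<in>level R N. \<Sum>j\<in>R - D. (?y (insert j D - {j}))\<^sup>2)"
      by (rule sum_level_insert[OF R, symmetric])
    also have "\<dots> \<le> (\<Sum>D\<in>level R N. real (card R) * (?y D)\<^sup>2)"
    proof (rule sum_mono)
      fix D
      have "(\<Sum>j\<in>R - D. (?y (insert j D - {j}))\<^sup>2) = real (card (R - D)) * (?y D)\<^sup>2"
        by simp
      also have "\<dots> \<le> real (card R) * (?y D)\<^sup>2"
        using R by (intro mult_right_mono) (auto intro: card_mono)
      finally show "(\<Sum>j\<in>R - D. (?y (insert j D - {j}))\<^sup>2) \<le> real (card R) * (?y D)\<^sup>2" .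
    qed
    also have "\<dots> = real (card R) * mass R N ?y"
      by (simp add: mass_def sum_distrib_left)
    also have "\<dots> \<le> W / 2"
      using x R0 by (simp add: field_simps)
    finally have "(\<Sum>C\<in>level R (Suc N). (z C)\<^sup>2 * of_bool (\<not> bad x C)) \<le> W / 2" .
    moreover have "W = (\<Sum>C\<in>level R (Suc N). (z C)\<^sup>2 * of_bool (\<not> bad x C)) + B x"
      unfolding W_def mass_def B_def sum.distrib[symmetric] by (intro sum.cong) auto
    ultimately show ?thesis by simp
  qed
  have "sign_avg R (\<lambda>x. of_bool (mass R N (laplace_step R x z) < W / (2 * real (card R)))) x0 \<le>
      sign_avg R (\<lambda>x. of_bool (W / 2 \<le> B x)) x0"
    using imp by (intro sign_avg_mono) auto
  also have "\<dots> \<le> sign_avg R B x0 / (W / 2)"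
    using W by (intro sign_avg_markov) (auto simp: B_def intro!: sum_nonneg)
  also have "sign_avg R B x0 \<le> (\<Sum>C\<in>level R (Suc N). (z C)\<^sup>2 * (1 / 2 ^ Suc N))"
    unfolding B_def sign_avg_sum sign_avg_cmult
  proof (intro sum_mono mult_left_mono)
    fix C assume "C \<in> level R (Suc N)"
    then show "sign_avg R (\<lambda>x. of_bool (bad x C)) x0 \<le> 1 / 2 ^ Suc N"
      using exists_surviving_child[OF R, of C z x0] by (auto simp: bad_def)
  qed auto
  also have "\<dots> = W / 2 ^ Suc N"
    by (simp add: W_def mass_def sum_divide_distrib)
  finally show ?thesis using W by (simp add: W_def divide_right_mono)
qed

text \<open>
  The small ball bound is linear in \<open>t = sqrt Q\<close> down to \<open>t\<close> of order \<open>N powr (- 1 / 6)\<close>, so a dyadic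
  decomposition of the values of \<open>Q\<close> gives a convergent geometric series for any exponent below
  1/2. Below this scale the probability is of order \<open>N powr (- 1 / 6)\<close> while \<open>Q powr (- 1 / 32)\<close> is at
  most \<open>N powr (5 / 32)\<close> for \<open>Q \<ge> r\<close>, and \<open>5 / 32 < 1 / 6\<close>.
\<close>

lemma negative_moment:
  fixes Q :: "(nat \<Rightarrow> real) \<Rightarrow> real"
  assumes I: "finite I" and N: "N \<ge> 1"
    and ball: "\<And>t. t > 0 \<Longrightarrow> sign_avg I (\<lambda>x. of_bool (Q x \<le> t\<^sup>2)) x0 \<le> 1500 * (t + 1 / (t\<^sup>2 * sqrt N))"
    and r: "1 / N ^ 5 \<le> r"
  shows "sign_avg I (\<lambda>x. of_bool (r \<le> Q x) * Q x powr (- 1 / 32)) x0 \<le> 30000"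
proof -
  define \<beta> :: real where "\<beta> = 4 powr (1 / 32)"
  have \<beta>: "\<beta> > 0" "\<beta> \<le> 3 / 2"
  proof -
    have "\<beta> ^ 32 = 4" by (simp add: \<beta>_def powr_realpow[symmetric] powr_powr)
    also have "\<dots> \<le> (3 / 2) ^ 32" by (simp add: power_divide)
    finally show "\<beta> \<le> 3 / 2" using power_le_imp_le_base[of \<beta> 31 "3 / 2"] by simp
  qed (simp add: \<beta>_def)
  have "\<exists>k. sqrt N < 8 ^ k" by (rule real_arch_pow) simp
  (* For i \<le> K the choice t = 1 / 2 ^ i makes the error term 1 / (t\<^sup>2 * sqrt N) at most t. *)
  define k where "k = (LEAST k. sqrt N < 8 ^ k)"
  have k: "sqrt N < 8 ^ k" unfolding k_def by (rule LeastI_ex) fact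
  have "k \<noteq> 0" using k N by (intro notI) simp
  then obtain K where K: "k = Suc K" by (cases k) auto
  have K1: "8 ^ K \<le> sqrt N"
  proof (rule ccontr)
    assume "\<not> 8 ^ K \<le> sqrt N"
    then have "k \<le> K" unfolding k_def by (intro Least_le) simp
    then show False by (simp add: K)
  qed
  have P: "sign_avg I (\<lambda>x. of_bool (Q x \<le> 1 / 4 ^ i)) x0 \<le> 3000 / 2 ^ i" if i: "i \<le> K" for i
  proof -
    have e: "((1 / 2 ^ i)\<^sup>2 :: real) = 1 / 4 ^ i"
      by (simp add: power_divide power_mult[symmetric] mult.commute[of i] power_mult)
    have "(8::real) ^ i \<le> 8 ^ K" using i by (intro power_increasing) auto
    also note K1
    finally have s: "2 ^ i * 4 ^ i \<le> sqrt N" by (simp add: power_mult_distrib[symmetric])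
    have "1 / ((1 / 2 ^ i)\<^sup>2 * sqrt N) = 4 ^ i / sqrt N" unfolding e by simp
    also have "\<dots> \<le> 1 / 2 ^ i"
      using s N by (simp add: divide_simps mult.commute split: if_splits)
    finally show ?thesis
      using ball[of "1 / 2 ^ i"] unfolding e by simp
  qed
  have N5: "N powr (5 / 32) \<le> 2 * 2 ^ K"
  proof -
    have "N powr (5 / 32) \<le> N powr (1 / 6)" using N by (intro powr_mono) auto
    also have "\<dots> = sqrt N powr (1 / 3)"
      using N by (simp add: powr_half_sqrt[symmetric] powr_powr)
    also have "\<dots> \<le> (8 ^ k) powr (1 / 3)"
      using k N by (intro powr_mono2) auto
    also have "(8::real) ^ k = (2 ^ k) powr 3"
      by (simp add: powr_numeral power_mult[symmetric] mult.commute[of k] power_mult)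
    also have "((2 ^ k) powr 3) powr (1 / 3) = (2 ^ k :: real)" unfolding powr_powr by simp
    finally show ?thesis by (simp add: K)
  qed
  have pt: "of_bool (r \<le> Q x) * Q x powr (- 1 / 32) \<le>
     1 + ((\<Sum>i<K. \<beta> ^ Suc i * of_bool (Q x \<le> 1 / 4 ^ i)) + N powr (5 / 32) * of_bool (Q x \<le> 1 / 4 ^ K))" for x
  proof (cases "r \<le> Q x")
    case True
    have r0: "0 < 1 / N ^ 5" using N by simp
    have q: "0 < Q x" using r0 r True by linarith
    have s0: "0 \<le> (\<Sum>i<K. \<beta> ^ Suc i * of_bool (Q x \<le> 1 / 4 ^ i))"
      using \<beta> by (intro sum_nonneg) auto
    have "\<exists>m. 1 / Q x < 4 ^ m" by (rule real_arch_pow) simp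
    define m where "m = (LEAST m. 1 / Q x < 4 ^ m)"
    have m: "1 / Q x < 4 ^ m" unfolding m_def by (rule LeastI_ex) fact
    have inv: "Q x powr (- 1 / 32) = (1 / Q x) powr (1 / 32)"
      using q by (simp add: powr_divide powr_minus_divide)
    show ?thesis
    proof (cases m)
      case 0
      then have "(1 / Q x) powr (1 / 32) \<le> 1" using m q by (intro powr_le1) auto
      then show ?thesis using True s0 inv by (simp add: add_increasing2)
    next
      case (Suc i)
      have small: "Q x \<le> 1 / 4 ^ i"
      proof (rule ccontr)
        assume "\<not> ?thesis"
        then have "1 / Q x < 4 ^ i" using q by (simp add: field_simps)
        then have "m \<le> i" unfolding m_def by (rule Least_le)
        then show False using Suc by simp
      qed
      show ?thesis
      proof (cases "i < K")
        case True
        have "(1 / Q x) powr (1 / 32) \<le> (4 ^ Suc i) powr (1 / 32)"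
          using m q Suc by (intro powr_mono2) auto
        also have "\<dots> = \<beta> ^ Suc i"
          unfolding \<beta>_def by (simp add: powr_realpow[symmetric] powr_powr mult.commute powr_mult del: power_Suc)
        also have "\<dots> = \<beta> ^ Suc i * of_bool (Q x \<le> 1 / 4 ^ i)" using small by simp
        also have "\<dots> \<le> (\<Sum>i<K. \<beta> ^ Suc i * of_bool (Q x \<le> 1 / 4 ^ i))"
          using True \<beta> by (intro member_le_sum) auto
        finally have "Q x powr (- 1 / 32) \<le> (\<Sum>i<K. \<beta> ^ Suc i * of_bool (Q x \<le> 1 / 4 ^ i))"
          unfolding inv .
        moreover have "0 \<le> N powr (5 / 32) * of_bool (Q x \<le> 1 / 4 ^ K)" by simp
        moreover have "of_bool (r \<le> Q x) * Q x powr (- 1 / 32) = Q x powr (- 1 / 32)"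
          using \<open>r \<le> Q x\<close> by simp
        ultimately show ?thesis by linarith
      next
        case False
        then have "(1::real) / 4 ^ i \<le> 1 / 4 ^ K" by (intro divide_left_mono power_increasing) auto
        then have sm: "Q x \<le> 1 / 4 ^ K" using small by linarith
        have "N ^ 5 > 0" using N by simp
        moreover have "1 / N ^ 5 \<le> Q x" using True r by linarith
        ultimately have "1 / Q x \<le> N ^ 5" using q by (simp add: pos_divide_le_eq mult.commute)
        then have "(1 / Q x) powr (1 / 32) \<le> (N ^ 5) powr (1 / 32)"
          using q by (intro powr_mono2) auto
        also have "N ^ 5 = N powr 5" using N by (simp add: powr_numeral)
        also have "(N powr 5) powr (1 / 32) = N powr (5 / 32)" by (simp add: powr_powr)
        finally show ?thesis using \<open>r \<le> Q x\<close> inv sm s0 by simp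
      qed
    qed
  next
    case False
    then show ?thesis using \<beta> by (auto intro!: add_nonneg_nonneg sum_nonneg)
  qed
  have "sign_avg I (\<lambda>x. of_bool (r \<le> Q x) * Q x powr (- 1 / 32)) x0 \<le>
    sign_avg I (\<lambda>x. 1 + ((\<Sum>i<K. \<beta> ^ Suc i * of_bool (Q x \<le> 1 / 4 ^ i)) +
      N powr (5 / 32) * of_bool (Q x \<le> 1 / 4 ^ K))) x0"
    by (rule sign_avg_mono) (rule pt)
  also have "\<dots> = 1 + ((\<Sum>i<K. \<beta> ^ Suc i * sign_avg I (\<lambda>x. of_bool (Q x \<le> 1 / 4 ^ i)) x0) +
      N powr (5 / 32) * sign_avg I (\<lambda>x. of_bool (Q x \<le> 1 / 4 ^ K)) x0)"
    by (simp only: sign_avg_add sign_avg_sum sign_avg_cmult sign_avg_const[OF I])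
  also have "\<dots> \<le> 1 + ((\<Sum>i<K. \<beta> ^ Suc i * (3000 / 2 ^ i)) + N powr (5 / 32) * (3000 / 2 ^ K))"
    using \<beta> by (intro add_left_mono add_mono sum_mono mult_left_mono P) auto
  also have "(\<Sum>i<K. \<beta> ^ Suc i * (3000 / 2 ^ i)) \<le> (\<Sum>i<K. 4500 * (3 / 4) ^ i)"
  proof (rule sum_mono)
    fix i
    have "\<beta> ^ Suc i * (3000 / 2 ^ i) \<le> (3 / 2) ^ Suc i * (3000 / 2 ^ i)"
      using \<beta> by (intro mult_right_mono power_mono) auto
    also have "\<dots> = 4500 * ((3 / 2) ^ i / 2 ^ i)" by simp
    also have "(3 / 2) ^ i / 2 ^ i = (3 / 4 :: real) ^ i" by (simp add: power_divide[symmetric])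
    finally show "\<beta> ^ Suc i * (3000 / 2 ^ i) \<le> 4500 * (3 / 4) ^ i" .
  qed
  also have "\<dots> \<le> 18000"
    by (simp add: sum_distrib_left[symmetric] geometric_sum)
  also have "N powr (5 / 32) * (3000 / 2 ^ K) \<le> (2 * 2 ^ K) * (3000 / 2 ^ K)"
    using N5 by (intro mult_right_mono) auto
  finally show ?thesis by simp
qed

section \<open>Expansion along many lines\<close>

text \<open>
  The entry of line \<open>c\<close> at position \<open>i\<close> is \<open>w (c, i)\<close>; lines are rows or columns.
\<close>

definition laplace_steps ::
    "nat set \<Rightarrow> (nat \<times> nat \<Rightarrow> real) \<Rightarrow> nat list \<Rightarrow> (nat set \<Rightarrow> real) \<Rightarrow> nat set \<Rightarrow> real" where
  "laplace_steps R w cs = fold (\<lambda>c. laplace_step R (\<lambda>i. w (c, i))) cs"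

lemma laplace_steps_simps [simp]:
  "laplace_steps R w [] z = z"
  "laplace_steps R w (c # cs) z = laplace_steps R w cs (laplace_step R (\<lambda>i. w (c, i)) z)"
  by (simp_all add: laplace_steps_def)

lemma laplace_steps_append:
  "laplace_steps R w (cs @ ds) z = laplace_steps R w ds (laplace_steps R w cs z)"
  by (simp add: laplace_steps_def)

lemma laplace_steps_cong:
  assumes "\<And>c i. c \<in> set cs \<Longrightarrow> i \<in> R \<Longrightarrow> w (c, i) = w' (c, i)"
  shows "laplace_steps R w cs z = laplace_steps R w' cs z"
  using assms
proof (induction cs arbitrary: z)
  case (Cons c cs)
  have "laplace_step R (\<lambda>i. w (c, i)) z = laplace_step R (\<lambda>i. w' (c, i)) z"
    using Cons.prems by (intro laplace_step_cong) auto
  then show ?case using Cons by simp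
qed simp

text \<open>
  Conditioning on the first line: a bound \<open>h\<close> for the failure probability of the remaining lines,
  valid for every state \<open>y\<close>, may be averaged over the state after the first line.
\<close>

lemma sign_avg_first_line:
  assumes S: "finite S" and R: "finite R" and c: "c \<notin> S"
    and h: "\<And>w y. sign_avg (S \<times> R) (\<lambda>w. f w y) w \<le> h y"
  shows "sign_avg (insert c S \<times> R) (\<lambda>w. f w (laplace_step R (\<lambda>i. w (c, i)) z)) w0 \<le>
    sign_avg R (\<lambda>x. h (laplace_step R x z)) x0"
proof -
  have "sign_avg (insert c S \<times> R) (\<lambda>w. f w (laplace_step R (\<lambda>i. w (c, i)) z)) w0 =
      sign_avg ({c} \<times> R \<union> S \<times> R) (\<lambda>w. f w (laplace_step R (\<lambda>i. w (c, i)) z)) w0"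
    by (simp add: Sigma_Un_distrib1[symmetric])
  also have "\<dots> = sign_avg ({c} \<times> R) (sign_avg (S \<times> R) (\<lambda>w. f w (laplace_step R (\<lambda>i. w (c, i)) z))) w0"
    using S R c by (intro sign_avg_union) auto
  also have "\<dots> \<le> sign_avg ({c} \<times> R) (\<lambda>w. h (laplace_step R (\<lambda>i. w (c, i)) z)) w0"
  proof (rule sign_avg_mono)
    fix w
    have "sign_avg (S \<times> R) (\<lambda>w. f w (laplace_step R (\<lambda>i. w (c, i)) z)) w =
        sign_avg (S \<times> R) (\<lambda>w'. f w' (laplace_step R (\<lambda>i. w (c, i)) z)) w"
      using c by (intro sign_avg_cong_outside) auto
    also have "\<dots> \<le> h (laplace_step R (\<lambda>i. w (c, i)) z)" by (rule h)
    finally show "sign_avg (S \<times> R) (\<lambda>w. f w (laplace_step R (\<lambda>i. w (c, i)) z)) w \<le>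
        h (laplace_step R (\<lambda>i. w (c, i)) z)" .
  qed
  also have "\<dots> = sign_avg (Pair c ` R) (\<lambda>w. h (laplace_step R (\<lambda>i\<in>R. w (c, i)) z)) w0"
  proof -
    have "laplace_step R (\<lambda>i\<in>R. w (c, i)) z = laplace_step R (\<lambda>i. w (c, i)) z" for w
      by (rule laplace_step_cong) simp
    moreover have "Pair c ` R = {c} \<times> R" by auto
    ultimately show ?thesis by simp
  qed
  also have "\<dots> = sign_avg R (\<lambda>x. h (laplace_step R (restrict x R) z)) x0"
    using R by (intro sign_avg_reindex) (auto simp: inj_on_def)
  also have "\<dots> = sign_avg R (\<lambda>x. h (laplace_step R x z)) x0"
  proof -
    have "laplace_step R (restrict x R) z = laplace_step R x z" for x
      by (rule laplace_step_cong) simp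
    then show ?thesis by simp
  qed
  finally show ?thesis .
qed

text \<open>
  The mass can be expected to gain the factor \<open>N\<close> at each step. The probability of falling short of
  the product of these factors by \<open>lam\<close> is estimated by the \<open>1 / 32\<close>-th power of \<open>lam\<close> times a product
  of negative moments, one for each step, while the last term collects the exceptional steps in
  which the mass becomes tiny.
\<close>

lemma mass_lower_tail:
  assumes R: "finite R" and N: "2 * (card R)\<^sup>2 \<le> Suc N ^ 5" and lam: "lam > 0"
    and "distinct cs" "mass R (N + length cs) z > 0"
  shows "sign_avg (set cs \<times> R) (\<lambda>w. of_bool (mass R N (laplace_steps R w cs z) <
      lam * (fact (N + length cs) / fact N) * mass R (N + length cs) z)) w0
    \<le> 30000 ^ length cs * lam powr (1 / 32) + 2 * real (length cs) / 2 ^ N"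
  using lam assms(4,5)
proof (induction cs arbitrary: z w0 lam)
  case Nil
  show ?case
  proof (cases "lam \<le> 1")
    case True
    then have "lam * mass R N z \<le> mass R N z" using Nil by (simp add: mult_left_le_one_le)
    then show ?thesis by (simp add: not_less)
  next
    case False
    then have "1 \<le> lam powr (1 / 32)" by (simp add: ge_one_powr_ge_zero)
    then show ?thesis by simp
  qed
next
  case (Cons c cs)
  define k where "k = length cs"
  define M where "M = N + k"
  define W where "W = mass R (Suc M) z"
  define n where "n = card R"
  define r where "r = 1 / (2 * real n * real (Suc M))"
  define q where "q = (\<lambda>y. mass R M y / (real (Suc M) * W))"
  define thr where "thr = lam * (fact (Suc M) / fact N) * W"
  have W: "W > 0" using Cons.prems by (simp add: W_def M_def k_def)
  have n: "Suc M \<le> n"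
  proof -
    have "level R (Suc M) \<noteq> {}" using W unfolding W_def mass_def by (metis less_irrefl sum.empty)
    then show ?thesis using R by (auto simp: n_def) (metis card_mono)
  qed
  (* If the mass is not tiny after the first line, the induction hypothesis is applied with lam
     divided by the ratio q y that was actually gained. *)
  define h where "h = (\<lambda>y. of_bool (mass R M y < W / (2 * real n)) +
      (30000 ^ k * lam powr (1 / 32)) * (of_bool (r \<le> q y) * q y powr (- 1 / 32)) + 2 * real k / 2 ^ N)"
  have h: "sign_avg (set cs \<times> R) (\<lambda>w. of_bool (mass R N (laplace_steps R w cs y) < thr)) w \<le> h y" for w y
  proof (cases "mass R M y < W / (2 * real n)")
    case True
    have "sign_avg (set cs \<times> R) (\<lambda>w. of_bool (mass R N (laplace_steps R w cs y) < thr)) w \<le> 1"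
      using R by (intro sign_avg_le_const) auto
    also have "1 \<le> h y" using True by (auto simp: h_def intro!: add_nonneg_nonneg)
    finally show ?thesis .
  next
    case False
    then have my: "mass R M y > 0" using W n by (smt (verit) divide_pos_pos of_nat_0_less_iff zero_less_Suc less_le_trans)
    then have q: "q y > 0" using W by (simp add: q_def)
    have rq: "r \<le> q y"
    proof -
      have "r = W / (2 * real n) / (real (Suc M) * W)" using W by (simp add: r_def)
      also have "\<dots> \<le> q y" unfolding q_def using False W by (intro divide_right_mono) auto
      finally show ?thesis .
    qed
    have "thr = (lam / q y) * (fact (N + length cs) / fact N) * mass R (N + length cs) y"
      using my W by (simp add: thr_def q_def M_def k_def field_simps)
    then have "sign_avg (set cs \<times> R) (\<lambda>w. of_bool (mass R N (laplace_steps R w cs y) < thr)) w \<le>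
        30000 ^ k * (lam / q y) powr (1 / 32) + 2 * real k / 2 ^ N"
      using Cons.IH[of "lam / q y" y w] my q Cons.prems by (simp add: M_def k_def)
    also have "(lam / q y) powr (1 / 32) = lam powr (1 / 32) * q y powr (- 1 / 32)"
      using Cons.prems q by (simp add: powr_divide powr_minus_divide)
    also have "30000 ^ k * (lam powr (1 / 32) * q y powr (- 1 / 32)) + 2 * real k / 2 ^ N \<le> h y"
      using rq by (simp add: h_def)
    finally show ?thesis .
  qed
  have ball: "sign_avg R (\<lambda>x. of_bool (q (laplace_step R x z) \<le> t\<^sup>2)) (\<lambda>_. 0) \<le>
      1500 * (t + 1 / (t\<^sup>2 * sqrt (real (Suc M))))" if "t > 0" for t
  proof -
    have "q y \<le> t\<^sup>2 \<longleftrightarrow> mass R M y \<le> t\<^sup>2 * (real (Suc M) * mass R (Suc M) z)" for y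
      using W unfolding q_def W_def[symmetric] by (simp add: pos_divide_le_eq)
    then show ?thesis using mass_step_small_ball[OF R _ that, of M z] W by (simp add: W_def)
  qed
  have rN: "1 / real (Suc M) ^ 5 \<le> r"
  proof -
    have "2 * n * Suc M \<le> 2 * n * n" using n by (rule mult_le_mono2)
    also have "\<dots> \<le> Suc N ^ 5" using N by (simp add: n_def power2_eq_square)
    also have "\<dots> \<le> Suc M ^ 5" by (intro power_mono) (auto simp: M_def)
    finally have "real (2 * n * Suc M) \<le> real (Suc M ^ 5)" by (rule of_nat_mono)
    then have "2 * real n * real (Suc M) \<le> real (Suc M) ^ 5"
      by (simp only: of_nat_mult of_nat_power of_nat_numeral)
    then show ?thesis unfolding r_def using n by (intro divide_left_mono mult_pos_pos zero_less_power) auto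
  qed
  have "sign_avg (set (c # cs) \<times> R) (\<lambda>w. of_bool (mass R N (laplace_steps R w (c # cs) z) <
      lam * (fact (N + length (c # cs)) / fact N) * mass R (N + length (c # cs)) z)) w0
    = sign_avg (insert c (set cs) \<times> R) (\<lambda>w. of_bool (mass R N (laplace_steps R w cs
        (laplace_step R (\<lambda>i. w (c, i)) z)) < thr)) w0"
    by (simp add: thr_def W_def M_def k_def)
  also have "\<dots> \<le> sign_avg R (\<lambda>x. h (laplace_step R x z)) (\<lambda>_. 0)"
    using R Cons.prems h by (intro sign_avg_first_line) auto
  also have "\<dots> = sign_avg R (\<lambda>x. of_bool (mass R M (laplace_step R x z) < W / (2 * real n))) (\<lambda>_. 0) +
      30000 ^ k * lam powr (1 / 32) * sign_avg R (\<lambda>x. of_bool (r \<le> q (laplace_step R x z)) *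
        q (laplace_step R x z) powr (- 1 / 32)) (\<lambda>_. 0) + 2 * real k / 2 ^ N"
    using R by (simp only: h_def sign_avg_add sign_avg_cmult sign_avg_const)
  also have "\<dots> \<le> 2 / 2 ^ Suc M + 30000 ^ k * lam powr (1 / 32) * 30000 + 2 * real k / 2 ^ N"
    using R rN ball unfolding W_def n_def
    by (intro add_mono mult_left_mono mass_step_not_tiny negative_moment order.refl) auto
  also have "\<dots> \<le> 2 / 2 ^ N + 30000 ^ k * lam powr (1 / 32) * 30000 + 2 * real k / 2 ^ N"
    by (intro add_mono order.refl divide_left_mono power_increasing) (auto simp: M_def)
  also have "\<dots> = 30000 ^ length (c # cs) * lam powr (1 / 32) + 2 * real (length (c # cs)) / 2 ^ N"
    by (simp add: k_def field_simps)
  finally show ?case .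
qed

text \<open>
  A solution of the inequality \<open>skip_bound_step\<close>, the recursion for the probability that a large
  minor with \<open>M\<close> uncovered positions does not reach level 0 when \<open>s\<close> lines may be skipped. The ratio
  3/4 may be any number above 1/2, the failure probability at \<open>M = 1\<close>.
\<close>

definition skip_bound :: "nat \<Rightarrow> nat \<Rightarrow> real" where
  "skip_bound M s = (if M = 0 then 0 else 9 / 8 * (2 - 8 / 3 / 2 ^ M) * (3 / 4) ^ s)"

lemma skip_bound_step:
  assumes "M > 0"
  shows "skip_bound (M - 1) s + 1 / 2 ^ M * (if s = 0 then 1 else skip_bound M (s - 1)) \<le> skip_bound M s"
proof -
  obtain m where m: "M = Suc m" using assms by (cases M) auto
  have p: "2 ^ m \<ge> (1 :: real)" by simp
  show ?thesis
  proof (cases s)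
    case 0
    then show ?thesis using p by (cases "m = 0") (auto simp: skip_bound_def m field_simps)
  next
    case (Suc t)
    define a :: real where "a = (3 / 4) ^ t"
    have a: "a > 0" by (simp add: a_def)
    show ?thesis
    proof (cases "m = 0")
      case True
      then show ?thesis by (simp add: skip_bound_def m Suc)
    next
      case False
      define p :: real where "p = 1 / 2 ^ m"
      have p: "p > 0" by (simp add: p_def)
      have e1: "skip_bound M s = 9 / 8 * (2 - 4 / 3 * p) * (3 / 4 * a)"
        unfolding skip_bound_def m Suc a_def p_def by simp
      have e2: "skip_bound (M - 1) s = 9 / 8 * (2 - 8 / 3 * p) * (3 / 4 * a)"
        using False unfolding skip_bound_def m Suc a_def p_def by simp
      have e3: "skip_bound M (s - 1) = 9 / 8 * (2 - 4 / 3 * p) * a"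
        unfolding skip_bound_def m Suc a_def p_def by simp
      have e4: "1 / 2 ^ M = p / 2" by (simp add: m p_def)
      have "skip_bound M s - skip_bound (M - 1) s - 1 / 2 ^ M * skip_bound M (s - 1) = a * p\<^sup>2 * (3 / 4)"
        unfolding e1 e2 e3 e4 by (simp add: power2_eq_square algebra_simps)
      moreover have "a * p\<^sup>2 * (3 / 4) \<ge> 0" using a by simp
      ultimately show ?thesis using Suc by simp
    qed
  qed
qed

text \<open>
  Each line either turns the current large minor into a large minor on one position fewer, or it is
  skipped; a line has to be skipped with probability at most \<open>1 / 2 ^ card C\<close>. The lines \<open>us\<close> that are
  used depend on the outcome.
\<close>

lemma absorb_lines:
  assumes R: "finite R" and T: "T > 0"
    and "C \<subseteq> R" "T \<le> \<bar>z C\<bar>" "distinct cs" "length cs = card C + s"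
  shows "sign_avg (set cs \<times> R) (\<lambda>w. of_bool (\<forall>us. distinct us \<and> set us \<subseteq> set cs \<and> length us = card C
      \<longrightarrow> \<bar>laplace_steps R w us z {}\<bar> < T)) w0 \<le> skip_bound (card C) s"
  using assms(3-)
proof (induction cs arbitrary: z w0 C s)
  case Nil
  then have "card C = 0" "C = {}" using R finite_subset by (fastforce, fastforce)
  then show ?case using Nil by (simp add: skip_bound_def)
next
  case (Cons c cs)
  have fC: "finite C" using Cons.prems R finite_subset by blast
  define bad where "bad = (\<lambda>cs M w z. \<forall>us. distinct us \<and> set us \<subseteq> set cs \<and> length us = M
      \<longrightarrow> \<bar>laplace_steps R w us z {}\<bar> < T)"
  show ?case
  proof (cases "card C = 0")
    case True
    then have "C = {}" using fC by simp
    then have "\<not> bad (c # cs) 0 w z" for w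
      using Cons.prems by (auto simp: bad_def)
    then show ?thesis using True R by (simp add: bad_def skip_bound_def)
  next
    case False
    define M where "M = card C"
    define good where "good = (\<lambda>y. \<exists>j\<in>C. T \<le> \<bar>y (C - {j})\<bar>)"
    define b where "b = (if s = 0 then 1 else skip_bound M (s - 1))"
    (* Failure means that both continuations fail: using the first line and skipping it. *)
    define f where "f = (\<lambda>w y. of_bool (bad cs (M - 1) w y \<and> bad cs M w z) :: real)"
    define h where "h = (\<lambda>y. skip_bound (M - 1) s + b * of_bool (\<not> good y))"
    have sb: "skip_bound m t \<ge> 0" for m t
    proof -
      have "(8::real) / 3 / 2 ^ m \<le> 2" if "m > 0" 
      proof -
        have "(2::real) ^ 1 \<le> 2 ^ m" using that by (intro power_increasing) auto
        then show ?thesis by (simp add: field_simps)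
      qed
      then have "m > 0 \<Longrightarrow> 0 \<le> 9 / 8 * (2 - 8 / 3 / 2 ^ m) * (3 / 4 :: real) ^ t"
        by (intro mult_nonneg_nonneg) auto
      then show ?thesis unfolding skip_bound_def by (cases "m = 0") auto
    qed
    have b: "b \<ge> 0" using sb by (simp add: b_def)
    have imp: "bad (c # cs) M w z \<Longrightarrow> bad cs (M - 1) w (laplace_step R (\<lambda>i. w (c, i)) z) \<and> bad cs M w z" for w
    proof (intro conjI)
      assume bd: "bad (c # cs) M w z"
      show "bad cs (M - 1) w (laplace_step R (\<lambda>i. w (c, i)) z)"
        unfolding bad_def
      proof (intro allI impI)
        fix us assume us: "distinct us \<and> set us \<subseteq> set cs \<and> length us = M - 1"
        then have "distinct (c # us) \<and> set (c # us) \<subseteq> set (c # cs) \<and> length (c # us) = M"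
          using Cons.prems False by (auto simp: M_def)
        then have "\<bar>laplace_steps R w (c # us) z {}\<bar> < T" using bd unfolding bad_def by blast
        then show "\<bar>laplace_steps R w us (laplace_step R (\<lambda>i. w (c, i)) z) {}\<bar> < T" by simp
      qed
      show "bad cs M w z" using bd by (auto simp: bad_def)
    qed
    have h: "sign_avg (set cs \<times> R) (\<lambda>w. f w y) w \<le> h y" for w y
    proof (cases "good y")
      case True
      then obtain j where j: "j \<in> C" "T \<le> \<bar>y (C - {j})\<bar>" by (auto simp: good_def)
      have cd: "card (C - {j}) = M - 1" using j fC by (simp add: M_def)
      have "sign_avg (set cs \<times> R) (\<lambda>w. f w y) w \<le>
          sign_avg (set cs \<times> R) (\<lambda>w. of_bool (bad cs (M - 1) w y)) w"
        by (rule sign_avg_mono) (auto simp: f_def)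
      also have "\<dots> \<le> skip_bound (M - 1) s"
        unfolding bad_def cd[symmetric]
      proof (rule Cons.IH)
        show "length cs = card (C - {j}) + s"
          using Cons.prems False by (simp add: cd M_def)
      qed (use j Cons.prems in auto)
      finally show ?thesis using True by (simp add: h_def)
    next
      case False
      have "sign_avg (set cs \<times> R) (\<lambda>w. f w y) w \<le> b"
      proof (cases "s = 0")
        case True
        then show ?thesis using R by (intro sign_avg_le_const) (auto simp: f_def b_def)
      next
        case s: False
        have "sign_avg (set cs \<times> R) (\<lambda>w. f w y) w \<le>
            sign_avg (set cs \<times> R) (\<lambda>w. of_bool (bad cs M w z)) w"
          by (rule sign_avg_mono) (auto simp: f_def)
        also have "\<dots> \<le> skip_bound M (s - 1)"
          unfolding bad_def M_def using Cons.prems s by (intro Cons.IH) auto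
        finally show ?thesis using s by (simp add: b_def)
      qed
      then show ?thesis using False sb[of "M - 1" s] by (simp add: h_def)
    qed
    have "sign_avg (set (c # cs) \<times> R) (\<lambda>w. of_bool (bad (c # cs) M w z)) w0 \<le>
       sign_avg (insert c (set cs) \<times> R) (\<lambda>w. f w (laplace_step R (\<lambda>i. w (c, i)) z)) w0"
      using imp by (simp only: list.set, intro sign_avg_mono) (auto simp: f_def)
    also have "\<dots> \<le> sign_avg R (\<lambda>x. h (laplace_step R x z)) (\<lambda>_. 0)"
      using R Cons.prems h by (intro sign_avg_first_line) auto
    also have "\<dots> = skip_bound (M - 1) s + b * sign_avg R (\<lambda>x. of_bool (\<not> good (laplace_step R x z))) (\<lambda>_. 0)"
      using R by (simp only: h_def sign_avg_add sign_avg_cmult sign_avg_const)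
    also have "sign_avg R (\<lambda>x. of_bool (\<not> good (laplace_step R x z))) (\<lambda>_. 0) \<le>
       sign_avg R (\<lambda>x. of_bool (\<forall>j\<in>C. \<bar>laplace_step R x z (C - {j})\<bar> < \<bar>z C\<bar>)) (\<lambda>_. 0)"
      using Cons.prems by (intro sign_avg_mono) (auto simp: good_def not_le intro: less_le_trans)
    also have "\<dots> \<le> 1 / 2 ^ M"
      unfolding M_def using Cons.prems by (intro exists_surviving_child R) auto
    finally have "sign_avg (set (c # cs) \<times> R) (\<lambda>w. of_bool (bad (c # cs) M w z)) w0 \<le>
        skip_bound (M - 1) s + b * (1 / 2 ^ M)" using b by (simp add: mult_left_mono)
    also have "\<dots> \<le> skip_bound M s"
      using skip_bound_step[of M s] False by (simp add: b_def M_def mult.commute)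
    finally show ?thesis by (simp add: bad_def M_def)
  qed
qed

section \<open>Antichains, the Littlewood--Offord bound and sparse digraphs\<close>

text \<open>
  Induction on \<open>S\<close>: if \<open>S\<close> itself is not in \<open>F\<close>, the left-hand side is the average over \<open>x \<in> S\<close> of the same sums
  for the subfamilies of sets that avoid \<open>x\<close>, which are antichains in \<open>S - {x}\<close>.
\<close>

lemma antichain_LYM:
  assumes "finite S" "F \<subseteq> Pow S" "\<And>A B. A \<in> F \<Longrightarrow> B \<in> F \<Longrightarrow> A \<subseteq> B \<Longrightarrow> A = B"
  shows "(\<Sum>A\<in>F. 1 / real (card S choose card A)) \<le> 1"
  using assms
proof (induction "card S" arbitrary: S F)
  case 0
  then have "F \<subseteq> {{}}" by auto
  then have "F = {} \<or> F = {{}}" by blast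
  then show ?case by auto
next
  case (Suc k)
  have finF: "finite F" using Suc.prems finite_subset by (metis finite_Pow_iff)
  show ?case
  proof (cases "S \<in> F")
    case True
    then have "F = {S}" using Suc.prems(2) Suc.prems(3)[OF _ True] by blast
    then show ?thesis by simp
  next
    case False
    let ?m = "real (card S)"
    have m: "?m > 0" using Suc.hyps(2) by linarith
    have each: "1 / real (card S choose card A) =
        (\<Sum>x\<in>S. (1 / ?m) * (of_bool (x \<notin> A) * (1 / real (k choose card A))))" if A: "A \<in> F" for A
    proof -
      have AS: "A \<subseteq> S" "A \<noteq> S" using A Suc.prems False by auto
      have lt: "card A < card S" using AS Suc.prems(1) psubset_card_mono by blast
      have "(card S - card A) * (card S choose card A) = card S * (k choose card A)"
        using binomial_absorb_comp[of "card S" "card A"] Suc.hyps(2) by (metis diff_Suc_1)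
      then have eq: "real (card S - card A) * real (card S choose card A) = ?m * real (k choose card A)"
        by (metis of_nat_mult)
      have pos: "real (card S choose card A) > 0" "real (k choose card A) > 0"
        using lt Suc.hyps(2) by (auto simp: zero_less_binomial)
      have "(\<Sum>x\<in>S. (1 / ?m) * (of_bool (x \<notin> A) * (1 / real (k choose card A)))) =
          (1 / ?m) * (1 / real (k choose card A)) * (\<Sum>x\<in>S. of_bool (x \<notin> A))"
        by (simp add: sum_distrib_left sum_divide_distrib mult_ac)
      also have "(\<Sum>x\<in>S. of_bool (x \<notin> A)) = real (card (S - A))"
        using Suc.prems(1) by (simp add: set_diff_eq Int_def)
      also have "card (S - A) = card S - card A"
        using AS Suc.prems(1) finite_subset by (intro card_Diff_subset) auto
      finally have sum: "(\<Sum>x\<in>S. (1 / ?m) * (of_bool (x \<notin> A) * (1 / real (k choose card A)))) =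
          (1 / ?m) * (1 / real (k choose card A)) * real (card S - card A)" .
      have "1 / b = (1 / m) * (1 / d) * e" if "e * b = m * d" "b > 0" "d > 0" "m > 0" for b d e m :: real
        using that by (simp add: field_simps)
      then show ?thesis unfolding sum using eq pos m by blast
    qed
    have "(\<Sum>A\<in>F. 1 / real (card S choose card A)) =
       (\<Sum>A\<in>F. \<Sum>x\<in>S. (1 / ?m) * (of_bool (x \<notin> A) * (1 / real (k choose card A))))"
      by (intro sum.cong refl each)
    also have "\<dots> = (\<Sum>x\<in>S. (1 / ?m) * (\<Sum>A\<in>F. of_bool (x \<notin> A) * (1 / real (k choose card A))))"
      by (subst sum.swap) (simp only: sum_distrib_left)
    also have "\<dots> \<le> (\<Sum>x\<in>S. (1 / ?m) * 1)"
    proof (intro sum_mono mult_left_mono)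
      fix x assume x: "x \<in> S"
      have cd: "k = card (S - {x})" using x Suc.hyps(2) by simp
      have "(\<Sum>A\<in>F. of_bool (x \<notin> A) * (1 / real (k choose card A))) =
          (\<Sum>A\<in>{A\<in>F. x \<notin> A}. 1 / real (k choose card A))"
        using finF by (intro sum.mono_neutral_cong_right) auto
      also have "\<dots> \<le> 1"
        unfolding cd using Suc.prems by (intro Suc.hyps(1) cd) auto
      finally show "(\<Sum>A\<in>F. of_bool (x \<notin> A) * (1 / real (k choose card A))) \<le> 1" .
    qed (use m in auto)
    also have "\<dots> = 1" using m by simp
    finally show ?thesis .
  qed
qed

lemma Sperner:
  assumes "finite S" "F \<subseteq> Pow S" "\<And>A B. A \<in> F \<Longrightarrow> B \<in> F \<Longrightarrow> A \<subseteq> B \<Longrightarrow> A = B"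
  shows "card F \<le> card S choose (card S div 2)"
proof -
  let ?c = "real (card S choose (card S div 2))"
  have c: "?c > 0" by (simp add: zero_less_binomial)
  have "real (card F) * (1 / ?c) = (\<Sum>A\<in>F. 1 / ?c)" by simp
  also have "\<dots> \<le> (\<Sum>A\<in>F. 1 / real (card S choose card A))"
  proof (rule sum_mono)
    fix A assume "A \<in> F"
    then have "card A \<le> card S" using assms by (intro card_mono) auto
    then have "real (card S choose card A) > 0" by (simp add: zero_less_binomial)
    then show "1 / ?c \<le> 1 / real (card S choose card A)"
      using binomial_maximum[of "card S" "card A"] by (intro divide_left_mono) auto
  qed
  also have "\<dots> \<le> 1" by (rule antichain_LYM[OF assms])
  finally have "real (card F) \<le> ?c" using c by (simp add: field_simps)
  then show ?thesis by simp
qed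

lemma central_binomial_bound: "real (2 * h choose h) / 2 ^ (2 * h) \<le> 1 / sqrt (real (2 * h + 1))"
proof -
  have "(real (2 * h choose h) / 2 ^ (2 * h))\<^sup>2 \<le> 1 / real (2 * h + 1)"
  proof (induction h)
    case (Suc h)
    let ?b = "real (2 * h choose h) / 2 ^ (2 * h)"
    let ?x = "real h"
    have "real (2 * Suc h choose Suc h) * (?x + 1) = 2 * (2 * ?x + 1) * real (2 * h choose h)"
    proof -
      have "Suc h * (Suc (2 * h + 1) choose Suc h) = Suc (2 * h + 1) * (2 * h + 1 choose h)"
        by (rule Suc_times_binomial)
      moreover have "(2 * h + 1 choose h) = (Suc (2 * h) choose Suc h)"
        using binomial_symmetric[of h "2 * h + 1"] by simp
      moreover have "Suc h * (Suc (2 * h) choose Suc h) = Suc (2 * h) * (2 * h choose h)"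
        by (rule Suc_times_binomial)
      ultimately have "Suc h * (Suc h * (2 * Suc h choose Suc h)) = Suc h * (2 * (Suc (2 * h) * (2 * h choose h)))"
        by (simp only: ) (simp add: algebra_simps)
      then have "Suc h * (2 * Suc h choose Suc h) = 2 * (Suc (2 * h) * (2 * h choose h))"
        using nat_mult_eq_cancel1[of "Suc h"] by blast
      then have "real (Suc h * (2 * Suc h choose Suc h)) = real (2 * (Suc (2 * h) * (2 * h choose h)))"
        by (rule arg_cong)
      then show ?thesis by (simp add: algebra_simps del: binomial_Suc_Suc)
    qed
    moreover have "B / (4 * p) = b / p * ((2 * x + 1) / (2 * x + 2))"
      if "B * (x + 1) = 2 * (2 * x + 1) * b" "p > 0" "x \<ge> 0" for B b p x :: real
      using that by (simp add: divide_simps) (simp add: algebra_simps)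
    ultimately have "real (2 * Suc h choose Suc h) / (4 * 2 ^ (2 * h)) = ?b * ((2 * ?x + 1) / (2 * ?x + 2))"
      by simp
    moreover have "(2::real) ^ (2 * Suc h) = 4 * 2 ^ (2 * h)" by simp
    ultimately have "real (2 * Suc h choose Suc h) / 2 ^ (2 * Suc h) = ?b * ((2 * ?x + 1) / (2 * ?x + 2))"
      by (simp only:)
    then have "(real (2 * Suc h choose Suc h) / 2 ^ (2 * Suc h))\<^sup>2 = ?b\<^sup>2 * ((2 * ?x + 1) / (2 * ?x + 2))\<^sup>2"
      by (simp only: power_mult_distrib)
    also have "\<dots> \<le> 1 / (2 * ?x + 1) * ((2 * ?x + 1) / (2 * ?x + 2))\<^sup>2"
      using Suc by (intro mult_right_mono) (auto simp: algebra_simps)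
    also have "\<dots> = (2 * ?x + 1) / (2 * ?x + 2)\<^sup>2"
      by (simp add: power2_eq_square)
    also have "\<dots> \<le> 1 / (2 * ?x + 3)"
    proof -
      have "a / b \<le> 1 / c" if "a * c \<le> b" "b > 0" "c > 0" for a b c :: real
        using that by (simp add: field_simps)
      moreover have "(2 * ?x + 1) * (2 * ?x + 3) \<le> (2 * ?x + 2)\<^sup>2"
        by (simp add: power2_eq_square algebra_simps)
      moreover have "(2 * ?x + 2)\<^sup>2 > 0" by (simp add: add_pos_nonneg)
      ultimately show ?thesis by simp
    qed
    finally show ?case by (simp add: algebra_simps)
  qed simp
  then have "sqrt ((real (2 * h choose h) / 2 ^ (2 * h))\<^sup>2) \<le> sqrt (1 / real (2 * h + 1))"
    by (rule real_sqrt_le_mono)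
  then show ?thesis by (simp add: real_sqrt_divide)
qed

text \<open>
  After changing signs so that all coefficients are positive, two nested sets of plus signs give sums
  that differ by at least \<open>2 * \<theta>\<close>. Hence the sets of plus signs with a small sum form an antichain.
\<close>

lemma Littlewood_Offord_all:
  fixes a :: "'i \<Rightarrow> real"
  assumes S: "finite S" and \<theta>: "\<theta> > 0" and a: "\<And>i. i \<in> S \<Longrightarrow> \<theta> \<le> \<bar>a i\<bar>"
  shows "sign_avg S (\<lambda>w. of_bool (\<bar>c + (\<Sum>i\<in>S. w i * a i)\<bar> < \<theta>)) w0 \<le>
    real (card S choose (card S div 2)) / 2 ^ card S"
proof -
  define N where "N = {i \<in> S. a i < 0}"
  define V where "V = (\<lambda>A. c + (\<Sum>i\<in>S. if i \<in> A then \<bar>a i\<bar> else - \<bar>a i\<bar>))"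
  define F where "F = {A \<in> Pow S. \<bar>V A\<bar> < \<theta>}"
  let ?flip = "\<lambda>A. (A - N) \<union> (N - A)"
  have "(\<Sum>T\<in>Pow S. of_bool (\<bar>c + (\<Sum>i\<in>S. (if i \<in> T then 1 else if i \<in> S then -1 else w0 i) * a i)\<bar> < \<theta>) :: real)
      = (\<Sum>A\<in>Pow S. of_bool (\<bar>V A\<bar> < \<theta>))"
  proof (rule sum.reindex_bij_witness[of _ ?flip ?flip])
    fix T assume "T \<in> Pow S"
    have "V (?flip T) = c + (\<Sum>i\<in>S. (if i \<in> T then 1 else if i \<in> S then -1 else w0 i) * a i)"
      unfolding V_def by (intro arg_cong2[of _ _ _ _ "(+)"] refl sum.cong) (auto simp: N_def)
    then show "of_bool (\<bar>V (?flip T)\<bar> < \<theta>) =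
        (of_bool (\<bar>c + (\<Sum>i\<in>S. (if i \<in> T then 1 else if i \<in> S then -1 else w0 i) * a i)\<bar> < \<theta>) :: real)"
      by simp
  qed (auto simp: N_def)
  also have "\<dots> = real (card F)"
    using S by (simp add: F_def Int_def Collect_conj_eq[symmetric] Pow_def)
  finally have "sign_avg S (\<lambda>w. of_bool (\<bar>c + (\<Sum>i\<in>S. w i * a i)\<bar> < \<theta>)) w0 = real (card F) / 2 ^ card S"
    by (simp add: sign_avg_def)
  moreover have "card F \<le> card S choose (card S div 2)"
  proof (rule Sperner[OF S])
    fix A B assume AB: "A \<in> F" "B \<in> F" "A \<subseteq> B"
    show "A = B"
    proof (rule ccontr)
      assume "A \<noteq> B"
      then obtain i where i: "i \<in> B" "i \<notin> A" using AB by blast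
      have iS: "i \<in> S" using i AB by (auto simp: F_def)
      have "V B - V A = (\<Sum>j\<in>S. (if j \<in> B then \<bar>a j\<bar> else - \<bar>a j\<bar>) - (if j \<in> A then \<bar>a j\<bar> else - \<bar>a j\<bar>))"
        by (simp add: V_def sum_subtractf)
      also have "\<dots> \<ge> (if i \<in> B then \<bar>a i\<bar> else - \<bar>a i\<bar>) - (if i \<in> A then \<bar>a i\<bar> else - \<bar>a i\<bar>)"
        using S iS AB by (intro member_le_sum) auto
      finally have "V B - V A \<ge> 2 * \<theta>" using i a[OF iS] by simp
      then show False using AB by (auto simp: F_def)
    qed
  qed (auto simp: F_def)
  ultimately show ?thesis by (simp add: divide_right_mono)
qed

text \<open>
  It suffices that some of the coefficients are large; the other signs are fixed first.
\<close>

lemma Littlewood_Offord: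
  fixes a :: "'i \<Rightarrow> real"
  assumes J: "finite J" and S: "S \<subseteq> J" "2 * h \<le> card S"
    and \<theta>: "\<theta> > 0" and a: "\<And>i. i \<in> S \<Longrightarrow> \<theta> \<le> \<bar>a i\<bar>"
  shows "sign_avg J (\<lambda>w. of_bool (\<bar>\<Sum>i\<in>J. w i * a i\<bar> < \<theta>)) w0 \<le> 1 / sqrt (real (2 * h + 1))"
proof -
  obtain X where X: "X \<subseteq> S" "card X = 2 * h" "finite X"
    using obtain_subset_with_card_n[OF S(2)] by blast
  have XJ: "X \<subseteq> J" using X S by blast
  let ?P = "\<lambda>w. \<bar>(\<Sum>i\<in>J - X. w i * a i) + (\<Sum>i\<in>X. w i * a i)\<bar> < \<theta>"
  have "sign_avg J (\<lambda>w. of_bool (\<bar>\<Sum>i\<in>J. w i * a i\<bar> < \<theta>)) w0 = sign_avg (J - X \<union> X) (\<lambda>w. of_bool (?P w)) w0"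
    using sum.subset_diff[OF XJ J, of "\<lambda>i. _ i * a i"] XJ by (simp add: Un_absorb2)
  also have "\<dots> = sign_avg (J - X) (sign_avg X (\<lambda>w. of_bool (?P w))) w0"
    using J X by (intro sign_avg_union) auto
  also have "\<dots> \<le> 1 / sqrt (real (2 * h + 1))"
  proof (rule sign_avg_le_const)
    fix y
    have "sign_avg X (\<lambda>w. of_bool (?P w)) y =
       sign_avg X (\<lambda>w. of_bool (\<bar>(\<Sum>i\<in>J - X. y i * a i) + (\<Sum>i\<in>X. w i * a i)\<bar> < \<theta>)) y"
      by (rule sign_avg_cong_outside) simp
    also have "\<dots> \<le> real (card X choose (card X div 2)) / 2 ^ card X"
      using X \<theta> a by (intro Littlewood_Offord_all) auto
    also have "\<dots> \<le> 1 / sqrt (real (2 * h + 1))"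
      using central_binomial_bound[of h] by (simp add: X(2))
    finally show "sign_avg X (\<lambda>w. of_bool (?P w)) y \<le> 1 / sqrt (real (2 * h + 1))" .
  qed (use J in auto)
  finally show ?thesis .
qed

text \<open>
  Greedy choice: some vertex has in-degree at most \<open>H\<close>, because the average in-degree is at most \<open>H\<close>. It is
  selected and removed together with its at most \<open>2 * H\<close> neighbours.
\<close>

lemma sparse_digraph_independent_set:
  assumes "finite V" "\<And>s. s \<in> V \<Longrightarrow> card {t \<in> V. E s t} \<le> H"
  shows "\<exists>S\<subseteq>V. (\<forall>s\<in>S. \<forall>t\<in>S. s \<noteq> t \<longrightarrow> \<not> E s t) \<and> card V \<le> (2 * H + 1) * card S"
  using assms
proof (induction "card V" arbitrary: V rule: less_induct)
  case less
  show ?case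
  proof (cases "V = {}")
    case False
    have "\<exists>t\<in>V. card {s \<in> V. E s t} \<le> H"
    proof (rule ccontr)
      assume "\<not> ?thesis"
      then have "(\<Sum>t\<in>V. H) < (\<Sum>t\<in>V. card {s \<in> V. E s t})"
        using less.prems(1) False by (intro sum_strict_mono) (auto simp: not_le)
      also have "\<dots> = (\<Sum>t\<in>V. \<Sum>s\<in>V. of_bool (E s t))"
        using less.prems(1) by (simp add: Int_def)
      also have "\<dots> = (\<Sum>s\<in>V. \<Sum>t\<in>V. of_bool (E s t))" by (rule sum.swap)
      also have "\<dots> = (\<Sum>s\<in>V. card {t \<in> V. E s t})"
        using less.prems(1) by (simp add: Int_def)
      also have "\<dots> \<le> (\<Sum>s\<in>V. H)" by (intro sum_mono less.prems(2))
      finally show False by simp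
    qed
    then obtain t where t: "t \<in> V" "card {s \<in> V. E s t} \<le> H" by blast
    define X where "X = insert t ({s \<in> V. E s t} \<union> {s \<in> V. E t s})"
    have X: "X \<subseteq> V" "finite X" "t \<in> X" using t less.prems(1) by (auto simp: X_def)
    have "card X \<le> Suc (card {s \<in> V. E s t} + card {s \<in> V. E t s})"
      unfolding X_def using card_Un_le[of "{s \<in> V. E s t}" "{s \<in> V. E t s}"]
      by (intro order.trans[OF card_insert_le_m1]) (auto simp: card_insert_if less.prems(1))
    also have "\<dots> \<le> 2 * H + 1" using t less.prems(2)[OF t(1)] by simp
    finally have cX: "card X \<le> 2 * H + 1" .
    have lt: "card (V - X) < card V"
      using X t less.prems(1) by (intro psubset_card_mono) auto
    have "\<exists>S\<subseteq>V - X. (\<forall>s\<in>S. \<forall>t\<in>S. s \<noteq> t \<longrightarrow> \<not> E s t) \<and> card (V - X) \<le> (2 * H + 1) * card S"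
    proof (rule less.hyps[OF lt])
      fix s assume "s \<in> V - X"
      then have "card {t \<in> V. E s t} \<le> H" using less.prems(2) by auto
      moreover have "card {t \<in> V - X. E s t} \<le> card {t \<in> V. E s t}"
        using less.prems(1) by (intro card_mono) auto
      ultimately show "card {t \<in> V - X. E s t} \<le> H" by simp
    qed (use less.prems in auto)
    then obtain S where S: "S \<subseteq> V - X" "\<forall>s\<in>S. \<forall>t\<in>S. s \<noteq> t \<longrightarrow> \<not> E s t"
      "card (V - X) \<le> (2 * H + 1) * card S" by blast
    have fS: "finite S" "t \<notin> S" using S less.prems(1) finite_subset X(3) by (blast, blast)
    have "card V = card (V - X) + card X"
      using X less.prems(1) by (simp add: card_Diff_subset card_mono)
    also have "\<dots> \<le> (2 * H + 1) * card (insert t S)"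
      using S(3) cX fS by (simp add: algebra_simps)
    finally show ?thesis
      using S(1,2) t by (intro exI[of _ "insert t S"]) (auto simp: X_def)
  qed simp
qed

section \<open>From disjoint large minors to the full expansion\<close>

text \<open>
  If each sum has many large coefficients, each is small only with small probability, and Markov's
  inequality applies to the number of small sums.
\<close>

lemma many_heavy_sums_dense:
  fixes a :: "'s \<Rightarrow> 'i \<Rightarrow> real"
  assumes J: "finite J" and A: "finite A" "A \<noteq> {}" and \<theta>: "\<theta> > 0"
    and dense: "\<And>s. s \<in> A \<Longrightarrow> 2 * h \<le> card {j \<in> J. \<theta> \<le> \<bar>a s j\<bar>}"
    and k: "2 * k \<le> card A"
  shows "sign_avg J (\<lambda>w. of_bool (card {s \<in> A. \<theta> \<le> \<bar>\<Sum>j\<in>J. w j * a s j\<bar>} < k)) w0 \<le> 2 / sqrt (real (2 * h + 1))"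
proof -
  let ?p = "1 / sqrt (real (2 * h + 1))"
  let ?bad = "\<lambda>w s. \<bar>\<Sum>j\<in>J. w j * a s j\<bar> < \<theta>"
  define f where "f = (\<lambda>w. \<Sum>s\<in>A. of_bool (?bad w s) :: real)"
  have cA: "real (card A) > 0" using A by (simp add: card_gt_0_iff)
  have "real (card A) / 2 \<le> f w" if "card {s \<in> A. \<theta> \<le> \<bar>\<Sum>j\<in>J. w j * a s j\<bar>} < k" for w
  proof -
    have "card A = card {s \<in> A. ?bad w s} + card {s \<in> A. \<not> ?bad w s}"
      using A(1) by (subst card_Un_disjoint[symmetric]) (auto intro!: arg_cong[of _ _ card])
    then have "real (card A) = f w + real (card {s \<in> A. \<not> ?bad w s})"
      using A(1) by (simp add: f_def Int_def)
    then show ?thesis using that k by (simp add: not_less)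
  qed
  then have "sign_avg J (\<lambda>w. of_bool (card {s \<in> A. \<theta> \<le> \<bar>\<Sum>j\<in>J. w j * a s j\<bar>} < k)) w0 \<le>
      sign_avg J (\<lambda>w. of_bool (real (card A) / 2 \<le> f w)) w0"
    by (intro sign_avg_mono) auto
  also have "\<dots> \<le> sign_avg J f w0 / (real (card A) / 2)"
    using cA by (intro sign_avg_markov) (auto simp: f_def intro!: sum_nonneg)
  also have "sign_avg J f w0 \<le> (\<Sum>s\<in>A. ?p)"
    unfolding f_def sign_avg_sum
    by (intro sum_mono Littlewood_Offord[OF J _ dense \<theta>]) auto
  also have "(\<Sum>s\<in>A. ?p) / (real (card A) / 2) = 2 / sqrt (real (2 * h + 1))"
    using cA by simp
  finally show ?thesis using cA by (simp add: divide_right_mono)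
qed

text \<open>
  Here the large coefficients of different sums sit at different coordinates and hardly interact.
  Given the signs at all other coordinates, the sum \<open>s\<close> is large as soon as the sign at \<open>jj s\<close> agrees
  with one prescribed value, and the number of agreements is a sum of independent fair coins.
\<close>

lemma many_heavy_sums_independent:
  fixes a :: "'s \<Rightarrow> 'i \<Rightarrow> real"
  assumes J: "finite J" and S: "finite S" "S \<noteq> {}" and jj: "inj_on jj S" "jj ` S \<subseteq> J"
    and diag: "\<And>s. s \<in> S \<Longrightarrow> T \<le> \<bar>a s (jj s)\<bar>"
    and off: "\<And>s t. s \<in> S \<Longrightarrow> t \<in> S \<Longrightarrow> s \<noteq> t \<Longrightarrow> \<bar>a s (jj t)\<bar> \<le> \<theta>"
    and \<theta>: "\<theta> \<ge> 0" "real (card S) * \<theta> \<le> T / 2" and k: "4 * k \<le> card S"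
  shows "sign_avg J (\<lambda>w. of_bool (card {s \<in> S. T / 2 \<le> \<bar>\<Sum>j\<in>J. w j * a s j\<bar>} < k)) w0 \<le> 4 / real (card S)"
proof -
  let ?K = "jj ` S"
  let ?y = "\<lambda>w s. \<Sum>j\<in>J. w j * a s j"
  define b where "b = (\<lambda>w s. \<Sum>j\<in>J - ?K. w j * a s j)"
  define \<tau> where "\<tau> = (\<lambda>w s. if 0 \<le> a s (jj s) * b w s then 1 else -1 :: real)"
  have q: "real (card S) > 0" using S by (simp add: card_gt_0_iff)
  have fK: "finite ?K" using S by simp
  have big: "T / 2 \<le> \<bar>?y w s\<bar>" if s: "s \<in> S" and w: "w (jj s) = \<tau> w s" "\<And>j. j \<in> ?K \<Longrightarrow> w j \<in> {1, -1}" for w s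
  proof -
    have "?y w s = b w s + (\<Sum>j\<in>?K. w j * a s j)"
      unfolding b_def using sum.subset_diff[OF jj(2) J] by blast
    also have "(\<Sum>j\<in>?K. w j * a s j) = w (jj s) * a s (jj s) + (\<Sum>j\<in>?K - {jj s}. w j * a s j)"
      using fK s by (intro sum.remove) auto
    finally have y: "?y w s = (b w s + w (jj s) * a s (jj s)) + (\<Sum>j\<in>?K - {jj s}. w j * a s j)" by simp
    have "\<bar>\<Sum>j\<in>?K - {jj s}. w j * a s j\<bar> \<le> (\<Sum>j\<in>?K - {jj s}. \<theta>)"
    proof (intro sum_abs[THEN order.trans] sum_mono)
      fix j assume j: "j \<in> ?K - {jj s}"
      then obtain t where "t \<in> S" "j = jj t" "s \<noteq> t" by auto
      then show "\<bar>w j * a s j\<bar> \<le> \<theta>" using off[OF s] w(2)[of j] j by (auto simp: abs_mult)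
    qed
    also have "\<dots> \<le> real (card S) * \<theta>"
    proof -
      have "card (?K - {jj s}) \<le> card ?K" using fK by (intro card_mono) auto
      also have "\<dots> \<le> card S" using S by (intro card_image_le)
      finally show ?thesis using \<theta> by (simp add: mult_right_mono)
    qed
    finally have small: "\<bar>\<Sum>j\<in>?K - {jj s}. w j * a s j\<bar> \<le> T / 2" using \<theta> by linarith
    have "\<bar>a s (jj s)\<bar> \<le> \<bar>b w s + w (jj s) * a s (jj s)\<bar>"
      unfolding w(1) \<tau>_def by (auto simp: zero_le_mult_iff mult_less_0_iff not_le)
    then have "T \<le> \<bar>b w s + w (jj s) * a s (jj s)\<bar>" using diag[OF s] by linarith
    then show ?thesis unfolding y using small by linarith
  qed
  have "sign_avg J (\<lambda>w. of_bool (card {s \<in> S. T / 2 \<le> \<bar>?y w s\<bar>} < k)) w0 =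
      sign_avg (J - ?K \<union> ?K) (\<lambda>w. of_bool (card {s \<in> S. T / 2 \<le> \<bar>?y w s\<bar>} < k)) w0"
    using jj(2) by (simp add: Un_absorb2)
  also have "\<dots> = sign_avg (J - ?K) (sign_avg ?K (\<lambda>w. of_bool (card {s \<in> S. T / 2 \<le> \<bar>?y w s\<bar>} < k))) w0"
    using J fK by (intro sign_avg_union) auto
  also have "\<dots> \<le> 4 / real (card S)"
  proof (rule sign_avg_le_const)
    fix u
    define \<rho> where "\<rho> = (\<lambda>j. \<tau> u (the_inv_into S jj j))"
    define g where "g = (\<lambda>w. (\<Sum>j\<in>?K. w j * \<rho> j)\<^sup>2)"
    have \<rho>: "\<rho> (jj s) = \<tau> u s" if "s \<in> S" for s
      using that jj by (simp add: \<rho>_def the_inv_into_f_f)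
    have "sign_avg ?K (\<lambda>w. of_bool (card {s \<in> S. T / 2 \<le> \<bar>?y w s\<bar>} < k)) u \<le>
      sign_avg ?K (\<lambda>w. of_bool ((real (card S))\<^sup>2 / 4 \<le> g w)) u"
    proof (rule sign_avg_mono_signs)
      fix w assume w: "\<And>i. i \<in> ?K \<Longrightarrow> w i \<in> {1, -1}" "\<And>i. i \<notin> ?K \<Longrightarrow> w i = u i"
      have "b w s = b u s" for s unfolding b_def using w(2) by (intro sum.cong) auto
      then have tau: "\<tau> w s = \<tau> u s" for s by (simp add: \<tau>_def)
      have "(real (card S))\<^sup>2 / 4 \<le> g w" if few: "card {s \<in> S. T / 2 \<le> \<bar>?y w s\<bar>} < k"
      proof -
        have "(\<Sum>j\<in>?K. w j * \<rho> j) = (\<Sum>s\<in>S. w (jj s) * \<tau> u s)"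
          using jj(1) \<rho> by (simp add: sum.reindex)
        also have "\<dots> = (\<Sum>s\<in>S. 2 * of_bool (w (jj s) = \<tau> u s) - 1)"
        proof (intro sum.cong refl)
          fix s assume "s \<in> S"
          then have "w (jj s) \<in> {1, -1}" using w(1) by auto
          then show "w (jj s) * \<tau> u s = 2 * of_bool (w (jj s) = \<tau> u s) - 1"
            by (auto simp: \<tau>_def)
        qed
        also have "\<dots> = 2 * real (card {s \<in> S. w (jj s) = \<tau> u s}) - real (card S)"
          using S(1) by (simp add: sum_subtractf sum_distrib_left[symmetric] Int_def)
        also have "card {s \<in> S. w (jj s) = \<tau> u s} \<le> card {s \<in> S. T / 2 \<le> \<bar>?y w s\<bar>}"
          using S(1) big w(1) tau by (intro card_mono) auto
        then have "2 * real (card {s \<in> S. w (jj s) = \<tau> u s}) - real (card S) \<le> - (real (card S) / 2)"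
          using few k by linarith
        finally have "(\<Sum>j\<in>?K. w j * \<rho> j) \<le> - (real (card S) / 2)" .
        then have "real (card S) / 2 \<le> \<bar>\<Sum>j\<in>?K. w j * \<rho> j\<bar>" by linarith
        then have "(real (card S) / 2)\<^sup>2 \<le> \<bar>\<Sum>j\<in>?K. w j * \<rho> j\<bar>\<^sup>2" using q by (intro power_mono) auto
        then show ?thesis by (simp add: g_def power_divide)
      qed
      then show "of_bool (card {s \<in> S. T / 2 \<le> \<bar>?y w s\<bar>} < k) \<le>
          (of_bool ((real (card S))\<^sup>2 / 4 \<le> g w) :: real)" by auto
    qed
    also have "\<dots> \<le> sign_avg ?K g u / ((real (card S))\<^sup>2 / 4)"
      using q by (intro sign_avg_markov) (auto simp: g_def)
    also have "sign_avg ?K g u = (\<Sum>j\<in>?K. (\<rho> j)\<^sup>2)"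
      using sign_avg_vector_second[OF fK, where X = "{()}" and c = "\<lambda>_. 0" and v = "\<lambda>j _. \<rho> j" and ?w0.0 = u]
      by (simp add: g_def)
    also have "\<dots> = real (card S)"
    proof -
      have "(\<rho> j)\<^sup>2 = 1" for j by (simp add: \<rho>_def \<tau>_def)
      then show ?thesis using jj(1) by (simp add: card_image)
    qed
    also have "real (card S) / ((real (card S))\<^sup>2 / 4) = 4 / real (card S)"
      using q by (simp add: power2_eq_square)
    finally show "sign_avg ?K (\<lambda>w. of_bool (card {s \<in> S. T / 2 \<le> \<bar>?y w s\<bar>} < k)) u \<le> 4 / real (card S)" .
  qed (use J in auto)
  finally show ?thesis .
qed

text \<open>
  Either half of the sums have at least \<open>2 * h\<close> coefficients above the threshold \<open>T / (2 * m)\<close>, and the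
  dense case applies; or half of them have fewer. In the latter case the digraph in which \<open>s\<close> points
  to \<open>t\<close> when the sum \<open>s\<close> has a coefficient above the threshold at \<open>jj t\<close> is sparse, and a large independent
  set in it satisfies the assumptions of the second case. The threshold is chosen so that \<open>m\<close>
  coefficients below it add up to at most \<open>T / 2\<close>.
\<close>

lemma many_heavy_sums:
  fixes a :: "'s \<Rightarrow> 'i \<Rightarrow> real"
  assumes J: "finite J" and I: "finite I" "card I = m" "m > 0"
    and jj: "inj_on jj I" "jj ` I \<subseteq> J" and T: "T > 0"
    and diag: "\<And>s. s \<in> I \<Longrightarrow> T \<le> \<bar>a s (jj s)\<bar>"
    and k: "8 * (4 * h + 1) * k \<le> m"
  shows "sign_avg J (\<lambda>w. of_bool (card {s \<in> I. T / (2 * real m) \<le> \<bar>\<Sum>j\<in>J. w j * a s j\<bar>} < k)) w0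
    \<le> 2 / sqrt (real (2 * h + 1)) + 8 * (4 * real h + 1) / real m"
proof -
  let ?\<theta> = "T / (2 * real m)"
  let ?y = "\<lambda>w s. \<Sum>j\<in>J. w j * a s j"
  define A where "A = {s \<in> I. 2 * h \<le> card {j \<in> J. ?\<theta> \<le> \<bar>a s j\<bar>}}"
  define B where "B = I - A"
  have fin: "finite A" "finite B" using I by (auto simp: A_def B_def)
  have AB: "card A + card B = m"
    using I fin unfolding B_def by (subst card_Diff_subset) (auto simp: A_def card_mono)
  have \<theta>: "?\<theta> > 0" using T I by simp
  have sub: "sign_avg J (\<lambda>w. of_bool (card {s \<in> I. ?\<theta> \<le> \<bar>?y w s\<bar>} < k)) w0 \<le>
      sign_avg J (\<lambda>w. of_bool (card {s \<in> X. t \<le> \<bar>?y w s\<bar>} < k)) w0" if "X \<subseteq> I" "?\<theta> \<le> t" for X t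
  proof (rule sign_avg_mono)
    fix w
    have "card {s \<in> X. t \<le> \<bar>?y w s\<bar>} \<le> card {s \<in> I. ?\<theta> \<le> \<bar>?y w s\<bar>}"
      using that I by (intro card_mono) auto
    then show "of_bool (card {s \<in> I. ?\<theta> \<le> \<bar>?y w s\<bar>} < k) \<le> (of_bool (card {s \<in> X. t \<le> \<bar>?y w s\<bar>} < k) :: real)"
      by auto
  qed
  show ?thesis
  proof (cases "m \<le> 2 * card A")
    case True
    have "2 * k \<le> card A"
    proof -
      have "8 * k \<le> 8 * (4 * h + 1) * k" by simp
      then show ?thesis using k True by linarith
    qed
    moreover have "A \<noteq> {}" using True I by auto
    ultimately have "sign_avg J (\<lambda>w. of_bool (card {s \<in> A. ?\<theta> \<le> \<bar>?y w s\<bar>} < k)) w0 \<le> 2 / sqrt (real (2 * h + 1))"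
      using J fin \<theta> by (intro many_heavy_sums_dense) (auto simp: A_def)
    moreover have "0 \<le> 8 * (4 * real h + 1) / real m" by simp
    moreover have "A \<subseteq> I" by (auto simp: A_def)
    ultimately show ?thesis using sub[of A ?\<theta>] by linarith
  next
    case False
    have "card {t \<in> B. ?\<theta> \<le> \<bar>a s (jj t)\<bar>} \<le> 2 * h" if s: "s \<in> B" for s
    proof -
      have "inj_on jj {t \<in> B. ?\<theta> \<le> \<bar>a s (jj t)\<bar>}"
        using jj(1) by (rule inj_on_subset) (auto simp: B_def)
      then have "card {t \<in> B. ?\<theta> \<le> \<bar>a s (jj t)\<bar>} = card (jj ` {t \<in> B. ?\<theta> \<le> \<bar>a s (jj t)\<bar>})"
        by (simp add: card_image)
      also have "\<dots> \<le> card {j \<in> J. ?\<theta> \<le> \<bar>a s j\<bar>}"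
        using J jj(2) by (intro card_mono) (auto simp: B_def)
      also have "\<dots> \<le> 2 * h" using s by (auto simp: A_def B_def)
      finally show ?thesis .
    qed
    then obtain S where S: "S \<subseteq> B" "\<forall>s\<in>S. \<forall>t\<in>S. s \<noteq> t \<longrightarrow> \<not> ?\<theta> \<le> \<bar>a s (jj t)\<bar>"
      "card B \<le> (2 * (2 * h) + 1) * card S"
      using sparse_digraph_independent_set[OF fin(2), of "\<lambda>s t. ?\<theta> \<le> \<bar>a s (jj t)\<bar>" "2 * h"] by blast
    have fS: "finite S" using S fin finite_subset by blast
    have SI: "S \<subseteq> I" using S by (auto simp: B_def)
    have mS: "m \<le> 2 * (4 * h + 1) * card S" using S(3) False AB by simp
    have S0: "card S > 0" using mS I by (cases "card S") auto
    have "card S \<le> m" using SI I by (auto intro: card_mono)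
    then have small: "real (card S) * ?\<theta> \<le> T / 2"
      using T I by (simp add: field_simps)
    have k4: "4 * k \<le> card S"
    proof -
      have "(2 * (4 * h + 1)) * (4 * k) \<le> (2 * (4 * h + 1)) * card S" using k mS by (simp add: algebra_simps)
      then show ?thesis by (subst (asm) mult_le_cancel1) simp
    qed
    have "sign_avg J (\<lambda>w. of_bool (card {s \<in> S. T / 2 \<le> \<bar>?y w s\<bar>} < k)) w0 \<le> 4 / real (card S)"
    proof (rule many_heavy_sums_independent[where jj = jj and \<theta> = ?\<theta>])
      show "inj_on jj S" using jj(1) SI by (rule inj_on_subset)
      show "jj ` S \<subseteq> J" using jj(2) SI by blast
      show "\<And>s. s \<in> S \<Longrightarrow> T \<le> \<bar>a s (jj s)\<bar>" using diag SI by blast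
      show "\<And>s t. s \<in> S \<Longrightarrow> t \<in> S \<Longrightarrow> s \<noteq> t \<Longrightarrow> \<bar>a s (jj t)\<bar> \<le> ?\<theta>" using S(2) by (meson not_le less_imp_le)
    qed (use J fS S0 \<theta> small k4 in auto)
    also have "4 / real (card S) \<le> 8 * (4 * real h + 1) / real m"
    proof -
      have "real m \<le> 2 * (4 * real h + 1) * real (card S)"
        using of_nat_mono[OF mS, where 'a = real] by (simp add: algebra_simps)
      moreover have "4 / x \<le> 8 * y / z" if "z \<le> 2 * y * x" "x > 0" "z > 0" for x y z :: real
        using that by (simp add: field_simps)
      moreover have "real (card S) > 0" "real m > 0" using S0 I by auto
      ultimately show ?thesis by blast
    qed
    also have "\<dots> \<le> 2 / sqrt (real (2 * h + 1)) + 8 * (4 * real h + 1) / real m" by simp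
    finally have "sign_avg J (\<lambda>w. of_bool (card {s \<in> S. T / 2 \<le> \<bar>?y w s\<bar>} < k)) w0 \<le>
        2 / sqrt (real (2 * h + 1)) + 8 * (4 * real h + 1) / real m" .
    moreover have "?\<theta> \<le> T / 2"
    proof -
      have "T * 1 \<le> T * real m" using T I by (intro mult_left_mono) auto
      then show ?thesis using I by (simp add: field_simps)
    qed
    ultimately show ?thesis using sub[OF SI, of "T / 2"] by linarith
  qed
qed

text \<open>
  Induction on \<open>L\<close>, adding one row at a time. One position \<open>jj C\<close> is removed from each of the disjoint
  sets \<open>C\<close>; the remaining sets are still disjoint, and by \<open>many_heavy_sums\<close> a prescribed number of the
  minors indexed by them is large after the new row, provided that \<open>m\<close> is large enough. The last row
  is the Littlewood--Offord bound.
\<close>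

lemma disjoint_heavy_minors_survive:
  assumes "L \<ge> 1" "\<epsilon> > 0"
  shows "\<exists>m \<kappa>. m \<ge> 1 \<and> \<kappa> > 0 \<and> (\<forall>R z \<C> T rs w0. finite R \<longrightarrow> \<C> \<subseteq> level R L \<longrightarrow> disjoint \<C> \<longrightarrow> card \<C> = m \<longrightarrow>
      T > 0 \<longrightarrow> (\<forall>C\<in>\<C>. T \<le> \<bar>z C\<bar>) \<longrightarrow> distinct rs \<longrightarrow> length rs = L \<longrightarrow>
      sign_avg (set rs \<times> R) (\<lambda>w. of_bool (\<bar>laplace_steps R w rs z {}\<bar> < \<kappa> * T)) w0 \<le> \<epsilon>)"
  using assms
proof (induction L arbitrary: \<epsilon> rule: dec_induct)
  case base
  obtain h :: nat where h: "real h > 1 / \<epsilon>\<^sup>2" using reals_Archimedean2 by blast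
  have "1 / \<epsilon>\<^sup>2 > 0" using base by simp
  then have "real h > 0" using h by linarith
  then have hpos: "h > 0" by simp
  have sq: "1 / sqrt (real (2 * h + 1)) \<le> \<epsilon>"
  proof -
    have "1 / \<epsilon>\<^sup>2 \<le> real (2 * h + 1)" using h by simp
    then have "sqrt (1 / \<epsilon>\<^sup>2) \<le> sqrt (real (2 * h + 1))" by (rule real_sqrt_le_mono)
    then have "1 / \<epsilon> \<le> sqrt (real (2 * h + 1))" using base by (simp add: real_sqrt_divide)
    moreover have "1 / x \<le> e" if "1 / e \<le> x" "e > 0" for x e :: real
    proof -
      have "x > 0" using that by (smt (verit) zero_less_divide_iff)
      then show ?thesis using that by (simp add: field_simps)
    qed
    ultimately show ?thesis using base by blast
  qed
  show ?case
  proof (intro exI[of _ "2 * h"] exI[of _ "1 :: real"] conjI allI impI)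
    fix R z \<C> T rs w0
    assume R: "finite R" and C: "\<C> \<subseteq> level R 1" "disjoint \<C>" "card \<C> = 2 * h"
      and T: "T > (0::real)" "\<forall>C\<in>\<C>. T \<le> \<bar>z C\<bar>" and rs: "distinct (rs :: nat list)" "length rs = 1"
    obtain r where r: "rs = [r]" using rs by (cases rs) auto
    define S where "S = {j \<in> R. {j} \<in> \<C>}"
    have "\<C> = (\<lambda>j. {j}) ` S"
    proof (intro equalityI subsetI)
      fix C assume "C \<in> \<C>"
      then obtain j where "C = {j}" "j \<in> R" using C(1) by (auto simp: card_1_singleton_iff dest!: subsetD)
      then show "C \<in> (\<lambda>j. {j}) ` S" using \<open>C \<in> \<C>\<close> by (auto simp: S_def)
    qed (auto simp: S_def)
    then have cS: "card S = 2 * h" using C(3) by (simp add: card_image)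
    have "sign_avg (set rs \<times> R) (\<lambda>w. of_bool (\<bar>laplace_steps R w rs z {}\<bar> < 1 * T)) w0 =
       sign_avg (insert r {} \<times> R) (\<lambda>w. (\<lambda>w y. of_bool (\<bar>y {}\<bar> < T)) w (laplace_step R (\<lambda>i. w (r, i)) z)) w0"
      by (simp add: r)
    also have "\<dots> \<le> sign_avg R (\<lambda>x. of_bool (\<bar>laplace_step R x z {}\<bar> < T)) (\<lambda>_. 0)"
      using R by (intro sign_avg_first_line) auto
    also have "\<dots> = sign_avg R (\<lambda>x. of_bool (\<bar>\<Sum>j\<in>R. x j * z {j}\<bar> < T)) (\<lambda>_. 0)"
      by (simp add: laplace_step_def)
    also have "\<dots> \<le> 1 / sqrt (real (2 * h + 1))"
      using R T cS by (intro Littlewood_Offord[where S = S]) (auto simp: S_def)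
    also note sq
    finally show "sign_avg (set rs \<times> R) (\<lambda>w. of_bool (\<bar>laplace_steps R w rs z {}\<bar> < 1 * T)) w0 \<le> \<epsilon>" .
  qed (use hpos in auto)
next
  case (step L)
  have "\<epsilon> / 2 > 0" using step.prems by simp
  from step.IH[OF this] obtain m1 \<kappa>1 where m1: "m1 \<ge> 1" "\<kappa>1 > 0" and
    IH: "\<And>R z \<C> T rs w0. finite R \<Longrightarrow> \<C> \<subseteq> level R L \<Longrightarrow> disjoint \<C> \<Longrightarrow> card \<C> = m1 \<Longrightarrow>
      T > 0 \<Longrightarrow> (\<forall>C\<in>\<C>. T \<le> \<bar>z C\<bar>) \<Longrightarrow> distinct rs \<Longrightarrow> length rs = L \<Longrightarrow>
      sign_avg (set rs \<times> R) (\<lambda>w. of_bool (\<bar>laplace_steps R w rs z {}\<bar> < \<kappa>1 * T)) w0 \<le> \<epsilon> / 2"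
    by blast
  (* h makes the dense case fail with probability at most \<epsilon> / 4; then m is large enough for the
     independent case. *)
  obtain h :: nat where h: "real h > 32 / \<epsilon>\<^sup>2" using reals_Archimedean2 by blast
  have sq: "2 / sqrt (real (2 * h + 1)) \<le> \<epsilon> / 4"
  proof -
    have "64 / \<epsilon>\<^sup>2 \<le> real (2 * h + 1)" using h by simp
    then have "sqrt (64 / \<epsilon>\<^sup>2) \<le> sqrt (real (2 * h + 1))" by (rule real_sqrt_le_mono)
    moreover have "sqrt (64 / \<epsilon>\<^sup>2) = 8 / \<epsilon>"
      using step.prems real_sqrt_unique[of "8 / \<epsilon>" "64 / \<epsilon>\<^sup>2"] by (simp add: power_divide)
    ultimately have "8 / \<epsilon> \<le> sqrt (real (2 * h + 1))" by simp
    moreover have "2 / x \<le> e / 4" if "8 / e \<le> x" "e > 0" for x e :: real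
    proof -
      have "x > 0" using that by (smt (verit) zero_less_divide_iff)
      then show ?thesis using that by (simp add: field_simps)
    qed
    ultimately show ?thesis using step.prems by blast
  qed
  obtain m0 :: nat where m0: "real m0 > 32 * (4 * real h + 1) / \<epsilon>" using reals_Archimedean2 by blast
  define m where "m = max m0 (8 * (4 * h + 1) * m1)"
  have m: "m > 0" using m1 by (simp add: m_def max_def)
  have mb: "8 * (4 * real h + 1) / real m \<le> \<epsilon> / 4"
  proof -
    have "32 * (4 * real h + 1) / \<epsilon> \<le> real m" using m0 by (simp add: m_def)
    moreover have "8 * y / x \<le> e / 4" if "32 * y / e \<le> x" "e > 0" "x > 0" for x y e :: real
      using that by (simp add: field_simps)
    moreover have "real m > 0" using m by simp
    ultimately show ?thesis using step.prems by blast
  qed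
  define \<kappa> where "\<kappa> = \<kappa>1 / (2 * real m)"
  show ?case
  proof (intro exI[of _ m] exI[of _ \<kappa>] conjI allI impI)
    fix R z \<C> T rs w0
    assume R: "finite R" and C: "\<C> \<subseteq> level R (Suc L)" "disjoint \<C>" "card \<C> = m"
      and T: "T > (0::real)" "\<forall>C\<in>\<C>. T \<le> \<bar>z C\<bar>" and rs: "distinct (rs :: nat list)" "length rs = Suc L"
    obtain r rs' where r: "rs = r # rs'" using rs by (cases rs) auto
    define jj where "jj = (\<lambda>C. SOME j :: nat. j \<in> C)"
    have jj: "jj C \<in> C" if "C \<in> \<C>" for C
    proof -
      have "C \<noteq> {}" using that C(1) by auto
      then show ?thesis unfolding jj_def by (simp add: some_in_eq)
    qed
    have finC: "finite C" if "C \<in> \<C>" for C using that C(1) R finite_subset by blast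
    have disj: "C = C'" if "C \<in> \<C>" "C' \<in> \<C>" "x \<in> C" "x \<in> C'" for C C' x
      using that C(2) by (auto simp: disjoint_def)
    have fC: "finite \<C>" using C(3) m card.infinite by force
    define D where "D = (\<lambda>C. C - {jj C})"
    have cD: "card (D C) = L" if "C \<in> \<C>" for C
      using that C(1) jj finC by (auto simp: D_def)
    define H where "H = (\<lambda>y. {C \<in> \<C>. T / (2 * real m) \<le> \<bar>y (D C)\<bar>})"
    define h' where "h' = (\<lambda>y. of_bool (card (H y) < m1) + \<epsilon> / 2)"
    have inner: "sign_avg (set rs' \<times> R) (\<lambda>w. of_bool (\<bar>laplace_steps R w rs' y {}\<bar> < \<kappa> * T)) w \<le> h' y" for w y
    proof (cases "card (H y) < m1")
      case True
      have "sign_avg (set rs' \<times> R) (\<lambda>w. of_bool (\<bar>laplace_steps R w rs' y {}\<bar> < \<kappa> * T)) w \<le> 1"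
        using R by (intro sign_avg_le_const) auto
      then show ?thesis using True step.prems by (simp add: h'_def)
    next
      case False
      then obtain X where X: "X \<subseteq> H y" "card X = m1" "finite X"
        using obtain_subset_with_card_n[of m1 "H y"] by (auto simp: not_less)
      have XC: "X \<subseteq> \<C>" using X by (auto simp: H_def)
      have L: "L \<ge> 1" by fact
      have injD: "inj_on D X"
      proof (rule inj_onI)
        fix C C' assume CC: "C \<in> X" "C' \<in> X" "D C = D C'"
        have "D C \<noteq> {}" using cD[of C] CC XC L by (metis card.empty not_one_le_zero subsetD)
        then obtain x where "x \<in> D C" by blast
        then show "C = C'" using CC XC disj[of C C' x] by (auto simp: D_def)
      qed
      have "sign_avg (set rs' \<times> R) (\<lambda>w. of_bool (\<bar>laplace_steps R w rs' y {}\<bar> < \<kappa>1 * (T / (2 * real m)))) w \<le> \<epsilon> / 2"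
      proof (rule IH[where \<C> = "D ` X"])
        show "D ` X \<subseteq> level R L" using XC C(1) cD by (auto simp: D_def)
        show "disjoint (D ` X)"
          using XC disj by (fastforce simp: disjoint_def D_def)
        show "card (D ` X) = m1" using injD X by (simp add: card_image)
        show "\<forall>C\<in>D ` X. T / (2 * real m) \<le> \<bar>y C\<bar>" using X by (auto simp: H_def)
      qed (use R T m rs r in auto)
      then show ?thesis using False by (simp add: h'_def \<kappa>_def)
    qed
    have "sign_avg (set rs \<times> R) (\<lambda>w. of_bool (\<bar>laplace_steps R w rs z {}\<bar> < \<kappa> * T)) w0 =
       sign_avg (insert r (set rs') \<times> R) (\<lambda>w. of_bool (\<bar>laplace_steps R w rs' (laplace_step R (\<lambda>i. w (r, i)) z) {}\<bar> < \<kappa> * T)) w0"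
      by (simp add: r)
    also have "\<dots> \<le> sign_avg R (\<lambda>x. h' (laplace_step R x z)) (\<lambda>_. 0)"
      using R rs r inner by (intro sign_avg_first_line) auto
    also have "\<dots> = sign_avg R (\<lambda>x. of_bool (card (H (laplace_step R x z)) < m1)) (\<lambda>_. 0) + \<epsilon> / 2"
      using R by (simp only: h'_def sign_avg_add sign_avg_const)
    also have "sign_avg R (\<lambda>x. of_bool (card (H (laplace_step R x z)) < m1)) (\<lambda>_. 0) \<le>
       2 / sqrt (real (2 * h + 1)) + 8 * (4 * real h + 1) / real m"
      unfolding H_def laplace_step_linear[OF R]
    proof (rule many_heavy_sums[where jj = jj])
      show "inj_on jj \<C>" using jj disj by (metis inj_onI)
      show "jj ` \<C> \<subseteq> R" using jj C(1) by blast
      show "T \<le> \<bar>if jj C \<in> D C then 0 else z (insert (jj C) (D C))\<bar>" if "C \<in> \<C>" for C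
        using T(2) jj that by (simp add: D_def insert_absorb)
      show "8 * (4 * h + 1) * m1 \<le> m" by (simp add: m_def)
    qed (use R fC C m T in auto)
    also have "\<dots> \<le> \<epsilon> / 4 + \<epsilon> / 4" using sq mb by (rule add_mono)
    finally show "sign_avg (set rs \<times> R) (\<lambda>w. of_bool (\<bar>laplace_steps R w rs z {}\<bar> < \<kappa> * T)) w0 \<le> \<epsilon>"
      by simp
  qed (use m m1 in \<open>auto simp: \<kappa>_def\<close>)
qed

section \<open>Permanents as sums over bijections\<close>

lemma mass_second_moment:
  assumes R: "finite R" and "distinct cs"
  shows "sign_avg (set cs \<times> R) (\<lambda>w. mass R N (laplace_steps R w cs z)) w0 \<le>
    fact (N + length cs) / fact N * mass R (N + length cs) z"
  using assms(2)
proof (induction cs arbitrary: z w0)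
  case (Cons c cs)
  let ?h = "\<lambda>y. fact (N + length cs) / fact N * mass R (N + length cs) y"
  have "sign_avg (set (c # cs) \<times> R) (\<lambda>w. mass R N (laplace_steps R w (c # cs) z)) w0 =
      sign_avg (insert c (set cs) \<times> R) (\<lambda>w. mass R N (laplace_steps R w cs (laplace_step R (\<lambda>i. w (c, i)) z))) w0"
    by simp
  also have "\<dots> \<le> sign_avg R (\<lambda>x. ?h (laplace_step R x z)) (\<lambda>_. 0)"
    using Cons R by (intro sign_avg_first_line) auto
  also have "\<dots> = fact (N + length (c # cs)) / fact N * mass R (N + length (c # cs)) z"
    unfolding sign_avg_cmult sign_avg_mass_step[OF R] by simp
  finally show ?case .
qed simp

text \<open>
  Bijections are taken to be extensional, so that this set is finite and represents each of them once.
\<close>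

definition bijections :: "'a set \<Rightarrow> 'b set \<Rightarrow> ('a \<Rightarrow> 'b) set" where
  "bijections A B = {f \<in> A \<rightarrow>\<^sub>E B. bij_betw f A B}"

text \<open>
  The permanent of the array \<open>w\<close> on arbitrary index sets of equal size, so that minors need no
  renumbering.
\<close>

definition perm :: "'a set \<Rightarrow> 'b set \<Rightarrow> ('a \<times> 'b \<Rightarrow> real) \<Rightarrow> real" where
  "perm A B w = (\<Sum>f\<in>bijections A B. \<Prod>a\<in>A. w (a, f a))"

lemma finite_bijections: "finite A \<Longrightarrow> finite B \<Longrightarrow> finite (bijections A B)"
  by (rule finite_subset[of _ "A \<rightarrow>\<^sub>E B"]) (auto simp: bijections_def intro: finite_PiE)

lemma bijections_undefined: "f \<in> bijections A B \<Longrightarrow> x \<notin> A \<Longrightarrow> f x = undefined"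
  by (auto simp: bijections_def PiE_def extensional_def)

lemma perm_empty [simp]: "perm {} {} w = 1"
proof -
  have "bijections ({} :: 'a set) ({} :: 'b set) = {\<lambda>_. undefined}"
    by (auto simp: bijections_def bij_betw_def)
  then show ?thesis by (simp add: perm_def)
qed

lemma perm_expand_row:
  assumes "finite A" "finite B" "a \<notin> A"
  shows "perm (insert a A) B w = (\<Sum>b\<in>B. w (a, b) * perm A (B - {b}) w)"
proof -
  have "(\<Sum>b\<in>B. w (a, b) * perm A (B - {b}) w) =
      (\<Sum>b\<in>B. \<Sum>f\<in>bijections A (B - {b}). w (a, b) * (\<Prod>x\<in>A. w (x, f x)))"
    by (simp add: perm_def sum_distrib_left)
  also have "\<dots> = (\<Sum>(b, f)\<in>Sigma B (\<lambda>b. bijections A (B - {b})). w (a, b) * (\<Prod>x\<in>A. w (x, f x)))"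
    using assms by (subst sum.Sigma) (auto simp: finite_bijections)
  also have "\<dots> = (\<Sum>g\<in>bijections (insert a A) B. \<Prod>x\<in>insert a A. w (x, g x))"
  proof (rule sum.reindex_bij_witness[of _ "\<lambda>g. (g a, restrict g A)" "\<lambda>(b, f). f(a := b)"], goal_cases)
    case (1 p)
    then obtain b f where p: "p = (b, f)" "b \<in> B" "f \<in> bijections A (B - {b})" by auto
    then have "restrict (f(a := b)) A = f"
      using assms(3) bijections_undefined[OF p(3)] by (auto simp: fun_eq_iff restrict_def)
    then show ?case using p by simp
  next
    case (2 p)
    then obtain b f where p: "p = (b, f)" "b \<in> B" "f \<in> bijections A (B - {b})" by auto
    then have "bij_betw f A (B - {b})" "f \<in> A \<rightarrow>\<^sub>E B - {b}" by (auto simp: bijections_def)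
    moreover have "bij_betw (f(a := b)) A (B - {b}) = bij_betw f A (B - {b})"
      using assms(3) by (intro bij_betw_cong) auto
    ultimately have "bij_betw (f(a := b)) (insert a A) (insert b (B - {b}))"
      using assms(3) notIn_Un_bij_betw[of a A "f(a := b)" "B - {b}"] by simp
    then have "bij_betw (f(a := b)) (insert a A) B" using p by (simp add: insert_absorb)
    moreover have "f \<in> A \<rightarrow>\<^sub>E B" using \<open>f \<in> A \<rightarrow>\<^sub>E B - {b}\<close> by auto
    then have "f(a := b) \<in> insert a A \<rightarrow>\<^sub>E B" using p by (intro PiE_fun_upd) auto
    ultimately show ?case using p by (simp add: bijections_def)
  next
    case (3 g)
    have "(restrict g A)(a := g a) = g"
      using bijections_undefined[OF 3] by (auto simp: fun_eq_iff restrict_def)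
    then show ?case by simp
  next
    case (4 g)
    then have g: "bij_betw g (insert a A) B" "g \<in> insert a A \<rightarrow>\<^sub>E B" by (auto simp: bijections_def)
    have "bij_betw g A (B - {g a})"
      using g(1) assms(3) by (auto simp: bij_betw_def inj_on_def)
    then have "bij_betw (restrict g A) A (B - {g a})" by (subst bij_betw_cong[of _ _ g]) auto
    then show ?case using g(2) by (auto simp: bijections_def bij_betw_def)
  next
    case (5 p)
    then obtain b f where p: "p = (b, f)" by (cases p)
    have "(\<Prod>x\<in>A. w (x, (f(a := b)) x)) = (\<Prod>x\<in>A. w (x, f x))"
      using assms(3) by (intro prod.cong) auto
    then show ?case using p assms by simp
  qed
  finally show ?thesis by (simp add: perm_def)
qed

lemma perm_transpose: "perm A B w = perm B A (\<lambda>(b, a). w (a, b))"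
proof -
  let ?inv = "\<lambda>A B f. restrict (inv_into A f) B"
  have inv: "?inv A B f \<in> bijections B A" if "f \<in> bijections A B" for A :: "'x set" and B :: "'y set" and f
  proof -
    have b: "bij_betw (inv_into A f) B A" using that by (auto simp: bijections_def bij_betw_inv_into)
    then have "bij_betw (?inv A B f) B A" by (subst bij_betw_cong[of _ _ "inv_into A f"]) auto
    moreover have "?inv A B f \<in> B \<rightarrow>\<^sub>E A" using bij_betw_imp_funcset[OF b] by auto
    ultimately show ?thesis by (simp add: bijections_def)
  qed
  have invinv: "?inv B A (?inv A B f) = f" if f: "f \<in> bijections A B" for A :: "'x set" and B :: "'y set" and f
  proof
    fix x
    show "?inv B A (?inv A B f) x = f x"
    proof (cases "x \<in> A")
      case True
      have b: "bij_betw f A B" using f by (simp add: bijections_def)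
      then have fx: "f x \<in> B" using True by (auto simp: bij_betw_def)
      have "inj_on (?inv A B f) B" using inv[OF f] by (auto simp: bijections_def bij_betw_def)
      moreover have "?inv A B f (f x) = x" using b True fx by (simp add: bij_betw_def)
      ultimately show ?thesis using True fx by (auto intro!: inv_into_f_eq)
    next
      case False
      then show ?thesis using bijections_undefined[OF f] by simp
    qed
  qed
  have "(\<Sum>f\<in>bijections A B. \<Prod>a\<in>A. w (a, f a)) = (\<Sum>g\<in>bijections B A. \<Prod>b\<in>B. w (g b, b))"
  proof (rule sum.reindex_bij_witness[of _ "?inv B A" "?inv A B"])
    fix f assume f: "f \<in> bijections A B"
    then have b: "bij_betw f A B" by (simp add: bijections_def)
    have "(\<Prod>b\<in>B. w (?inv A B f b, b)) = (\<Prod>a\<in>A. w (?inv A B f (f a), f a))"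
      using prod.reindex_bij_betw[OF b, of "\<lambda>b. w (?inv A B f b, b)"] by simp
    also have "\<dots> = (\<Prod>a\<in>A. w (a, f a))"
      using b by (intro prod.cong refl) (auto simp: bij_betw_def)
    finally show "(\<Prod>b\<in>B. w (?inv A B f b, b)) = (\<Prod>a\<in>A. w (a, f a))" .
  qed (auto simp: inv invinv)
  then show ?thesis by (simp add: perm_def)
qed

text \<open>
  The initial family has a single nonzero entry, the empty minor, for which all of \<open>R\<close> is uncovered.
\<close>

lemma laplace_steps_eq_perm:
  assumes "finite R" "distinct rs" "S \<subseteq> R" "card S = length rs"
  shows "laplace_steps R w rs (\<lambda>C. of_bool (C = R)) (R - S) = perm (set rs) S w"
  using assms(2-)
proof (induction rs arbitrary: S rule: rev_induct)
  case Nil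
  then have "S = {}" using assms(1) finite_subset by fastforce
  then show ?case by simp
next
  case (snoc r rs)
  have fS: "finite S" using snoc.prems assms(1) finite_subset by blast
  have "laplace_steps R w (rs @ [r]) (\<lambda>C. of_bool (C = R)) (R - S) =
      (\<Sum>j\<in>R - (R - S). w (r, j) * laplace_steps R w rs (\<lambda>C. of_bool (C = R)) (insert j (R - S)))"
    by (simp add: laplace_steps_append laplace_step_def)
  also have "R - (R - S) = S" using snoc.prems by auto
  also have "(\<Sum>j\<in>S. w (r, j) * laplace_steps R w rs (\<lambda>C. of_bool (C = R)) (insert j (R - S))) =
      (\<Sum>j\<in>S. w (r, j) * perm (set rs) (S - {j}) w)"
  proof (intro sum.cong refl)
    fix j assume j: "j \<in> S"
    then have "insert j (R - S) = R - (S - {j})" using snoc.prems by auto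
    then show "w (r, j) * laplace_steps R w rs (\<lambda>C. of_bool (C = R)) (insert j (R - S)) =
        w (r, j) * perm (set rs) (S - {j}) w"
      using snoc.IH[of "S - {j}"] snoc.prems j fS by auto
  qed
  also have "\<dots> = perm (set (rs @ [r])) S w"
    using snoc.prems fS by (simp add: perm_expand_row)
  finally show ?case .
qed

lemma per_mat_eq_perm:
  "per (mat n n w) = perm {0..<n} {0..<n} w"
proof -
  have "(\<Sum>p\<in>{p. p permutes {0..<n}}. \<Prod>i = 0..<n. mat n n w $$ (i, p i)) =
      (\<Sum>f\<in>bijections {0..<n} {0..<n}. \<Prod>i\<in>{0..<n}. w (i, f i))"
  proof (rule sum.reindex_bij_witness[of _ "\<lambda>f i. if i \<in> {0..<n} then f i else i" "\<lambda>p. restrict p {0..<n}"], goal_cases)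
    case (1 p)
    then show ?case by (auto simp: fun_eq_iff permutes_def)
  next
    case (2 p)
    then have "bij_betw p {0..<n} {0..<n}" using permutes_imp_bij by blast
    then have "bij_betw (restrict p {0..<n}) {0..<n} {0..<n}" by (subst bij_betw_cong[of _ _ p]) auto
    then show ?case by (auto simp: bijections_def bij_betw_def)
  next
    case (3 f)
    show ?case using bijections_undefined[OF 3] by (auto simp: fun_eq_iff restrict_def)
  next
    case (4 f)
    then have "bij_betw f {0..<n} {0..<n}" by (simp add: bijections_def)
    then have "bij_betw (\<lambda>i. if i \<in> {0..<n} then f i else i) {0..<n} {0..<n}"
      by (subst bij_betw_cong[of _ _ f]) auto
    then show ?case by (auto intro!: bij_imp_permutes)
  next
    case (5 p)
    then show ?case by (auto simp: permutes_in_image intro!: prod.cong)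
  qed
  then show ?thesis by (simp add: per_def perm_def)
qed

lemma prob_rademacher_mat:
  "measure_pmf.prob (rademacher_mat_pmf n) {A. Q A} =
     sign_avg ({0..<n} \<times> {0..<n}) (\<lambda>w. of_bool (Q (mat n n w))) (\<lambda>_. 0)"
proof -
  let ?I = "{0..<n} \<times> {0..<n}"
  let ?S = "PiE_dflt ?I 0 (\<lambda>_. {-1, 1 :: real})"
  let ?g = "\<lambda>T i. if i \<in> T then 1 else if i \<in> ?I then -1 else (0 :: real)"
  have bij: "bij_betw ?g (Pow ?I) ?S"
  proof (rule bij_betwI[of _ _ _ "\<lambda>f. {i \<in> ?I. f i = 1}"])
    show "?g \<in> Pow ?I \<rightarrow> ?S" by (auto simp: PiE_dflt_def)
    show "?g {i \<in> ?I. f i = 1} = f" if "f \<in> ?S" for f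
      using that by (auto simp: PiE_dflt_def fun_eq_iff) metis
  qed auto
  have fS: "finite ?S" by (intro finite_PiE_dflt) auto
  have S0: "?S \<noteq> {}" using bij by (auto simp: bij_betw_def)
  have cS: "card ?S = 2 ^ card ?I"
    using bij_betw_same_card[OF bij] by (simp add: card_Pow)
  have "measure_pmf.prob (rademacher_mat_pmf n) {A. Q A} =
      measure_pmf.prob (Pi_pmf ?I 0 (\<lambda>_. pmf_of_set {-1, 1})) (mat n n -` {A. Q A})"
    by (simp add: rademacher_mat_pmf_def rademacher_pmf_def)
  also have "Pi_pmf ?I 0 (\<lambda>_. pmf_of_set {-1, 1 :: real}) = pmf_of_set ?S"
    by (rule Pi_pmf_of_set) auto
  also have "measure_pmf.prob (pmf_of_set ?S) (mat n n -` {A. Q A}) = real (card (?S \<inter> mat n n -` {A. Q A})) / real (card ?S)"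
    by (rule measure_pmf_of_set[OF S0 fS])
  also have "real (card (?S \<inter> mat n n -` {A. Q A})) = (\<Sum>w\<in>?S. of_bool (Q (mat n n w)))"
    using fS by (simp add: vimage_def)
  also have "\<dots> = (\<Sum>T\<in>Pow ?I. of_bool (Q (mat n n (?g T))))"
    by (rule sum.reindex_bij_betw[OF bij, symmetric])
  finally show ?thesis unfolding sign_avg_def by (simp add: cS)
qed

section \<open>The lower tail for a fixed size\<close>

lemma mass_0: "finite R \<Longrightarrow> mass R 0 y = (y {})\<^sup>2"
proof -
  assume R: "finite R"
  have "C = {}" if "C \<subseteq> R" "card C = 0" for C
    using that finite_subset[OF that(1) R] by simp
  then have "level R 0 = {{}}" by auto
  then show ?thesis by (simp add: mass_def)
qed

lemma mass_full: "finite R \<Longrightarrow> mass R (card R) (\<lambda>C. of_bool (C = R)) = 1"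
proof -
  assume R: "finite R"
  then have "level R (card R) = {R}" using card_subset_eq by auto
  then show ?thesis by (simp add: mass_def)
qed

lemma perm_second_moment:
  fixes A R :: "nat set"
  assumes "finite A" "finite R" "card A = card R"
  shows "sign_avg (A \<times> R) (\<lambda>w. (perm A R w)\<^sup>2) w0 \<le> fact (card R)"
proof -
  obtain rs where rs: "set rs = A" "distinct rs" using finite_distinct_list[OF assms(1)] by blast
  then have len: "length rs = card R" using assms(3) distinct_card by metis
  have "(perm A R w)\<^sup>2 = mass R 0 (laplace_steps R w rs (\<lambda>C. of_bool (C = R)))" for w
    using laplace_steps_eq_perm[of R rs R w] assms rs len by (simp add: mass_0)
  then show ?thesis
    using mass_second_moment[OF assms(2) rs(2), of 0 "\<lambda>C. of_bool (C = R)" w0] assms(2) rs(1) len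
    by (simp add: mass_full)
qed

lemma perm_cong:
  assumes "\<And>a b. a \<in> A \<Longrightarrow> b \<in> B \<Longrightarrow> w (a, b) = w' (a, b)"
  shows "perm A B w = perm A B w'"
  unfolding perm_def using assms
  by (intro sum.cong prod.cong refl) (auto simp: bijections_def bij_betw_def)

lemma sign_avg_transpose:
  assumes "finite A" "finite B"
    and F: "\<And>w w'. (\<And>b a. b \<in> B \<Longrightarrow> a \<in> A \<Longrightarrow> w (b, a) = w' (b, a)) \<Longrightarrow> F w = F w'"
  shows "sign_avg (A \<times> B) (\<lambda>w. F (\<lambda>(b, a). w (a, b))) w0 = sign_avg (B \<times> A) F w1"
proof -
  have "sign_avg (prod.swap ` (B \<times> A)) (\<lambda>w. F (\<lambda>i\<in>B \<times> A. w (prod.swap i))) w0 =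
      sign_avg (B \<times> A) (\<lambda>x. F (restrict x (B \<times> A))) w1"
    using assms by (intro sign_avg_reindex) auto
  moreover have "prod.swap ` (B \<times> A) = A \<times> B" by (rule product_swap)
  moreover have "F (\<lambda>i\<in>B \<times> A. w (prod.swap i)) = F (\<lambda>(b, a). w (a, b))" for w
    by (rule F) simp
  moreover have "F (restrict x (B \<times> A)) = F x" for x
    by (rule F) simp
  ultimately show ?thesis by simp
qed

lemma skip_bound_le: "skip_bound M s \<le> 3 * (3 / 4) ^ s"
proof (cases "M = 0")
  case False
  have "9 / 8 * (2 - 8 / 3 / 2 ^ M) \<le> (3 :: real)" by (simp add: algebra_simps add_increasing2)
  then have "9 / 8 * (2 - 8 / 3 / 2 ^ M) * (3 / 4) ^ s \<le> 3 * (3 / 4 :: real) ^ s"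
    by (rule mult_right_mono) simp
  then show ?thesis unfolding skip_bound_def using False by (simp only: if_False)
qed (simp add: skip_bound_def)

text \<open>
  The rows \<open>P\<close> are the positions and the columns \<open>N\<close> are the lines. The columns outside \<open>W\<close> are read
  first; there are still \<open>card W - L\<close> uncovered rows afterwards, so the bound for the mass applies and
  yields one large minor. The columns in \<open>W\<close> are then used to cover the remaining rows, and the \<open>L\<close>
  columns that are skipped form the set \<open>D\<close>.
\<close>

lemma heavy_minor_in_window:
  fixes P N W :: "nat set"
  assumes fin: "finite P" "finite N" and W: "W \<subseteq> N" "L \<le> card W" and card: "card N = card P + L"
    and T: "T > 0" and lam: "lam > 0" and big: "2 * (card P)\<^sup>2 \<le> Suc (card W - L) ^ 5"
    and thr: "T\<^sup>2 * 2 ^ card P \<le> lam * (fact (card P) / fact (card W - L))"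
  shows "sign_avg (P \<times> N) (\<lambda>w. of_bool (\<forall>D\<subseteq>W. card D = L \<longrightarrow> \<bar>perm P (N - D) w\<bar> < T)) w0 \<le>
    30000 ^ card (N - W) * lam powr (1 / 32) + 2 * real (card (N - W)) / 2 ^ (card W - L) + 3 * (3 / 4) ^ L"
    (is "_ \<le> ?b1 + ?b2 + ?b3")
proof -
  define F where "F = (\<lambda>w. of_bool (\<forall>D\<subseteq>W. card D = L \<longrightarrow> \<bar>perm (N - D) P w\<bar> < T) :: real)"
  define M where "M = card W - L"
  define z0 where "z0 = (\<lambda>C. of_bool (C = P) :: real)"
  have fW: "finite W" using W fin finite_subset by blast
  obtain cs1 where cs1: "set cs1 = N - W" "distinct cs1" using finite_distinct_list fin by (metis finite_Diff)
  obtain cs2 where cs2: "set cs2 = W" "distinct cs2" using finite_distinct_list fW by blast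
  have len1: "length cs1 = card (N - W)" and len2: "length cs2 = card W"
    using cs1 cs2 distinct_card by metis+
  have NW: "card (N - W) = card N - card W" using W fW by (simp add: card_Diff_subset)
  have WN: "card W \<le> card N" using W fin by (intro card_mono)
  have lev: "M + length cs1 = card P" using len1 NW W(2) card WN by (simp add: M_def)
  have Fdep: "F w = F w'" if "\<And>c r. c \<in> N \<Longrightarrow> r \<in> P \<Longrightarrow> w (c, r) = w' (c, r)" for w w'
  proof -
    have "perm (N - D) P w = perm (N - D) P w'" for D by (rule perm_cong) (use that in auto)
    then show ?thesis by (simp add: F_def)
  qed
  define z1 where "z1 = (\<lambda>w. laplace_steps P w cs1 z0)"
  define light where "light = (\<lambda>w. mass P M (z1 w) < lam * (fact (M + length cs1) / fact M) * mass P (M + length cs1) z0)"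
  (* If the mass after the columns outside W is not light, some minor has absolute value at least T:
     there are at most 2 ^ card P minors. *)
  have inner: "sign_avg (W \<times> P) F w \<le> of_bool (light w) + ?b3" for w
  proof (cases "light w")
    case True
    have "sign_avg (W \<times> P) F w \<le> 1" using fW fin by (intro sign_avg_le_const) (auto simp: F_def)
    then show ?thesis using True by (simp add: add_increasing2)
  next
    case False
    have m1: "mass P (M + length cs1) z0 = 1" using fin by (simp add: lev z0_def mass_full)
    have heavy: "T\<^sup>2 * 2 ^ card P \<le> mass P M (z1 w)"
      using False thr m1 unfolding light_def lev by (simp add: M_def)
    obtain C where C: "C \<in> level P M" "T\<^sup>2 \<le> (z1 w C)\<^sup>2"
    proof -
      have "\<exists>C\<in>level P M. T\<^sup>2 \<le> (z1 w C)\<^sup>2"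
      proof (rule ccontr)
        assume "\<not> ?thesis"
        then have lt: "(z1 w C)\<^sup>2 < T\<^sup>2" if "C \<in> level P M" for C using that by (meson not_le)
        have ne: "level P M \<noteq> {}"
        proof
          assume "level P M = {}"
          then have "mass P M (z1 w) = 0" by (simp only: mass_def sum.empty)
          moreover have "T\<^sup>2 * 2 ^ card P > 0" using T by simp
          ultimately show False using heavy by linarith
        qed
        have "mass P M (z1 w) < (\<Sum>C\<in>level P M. T\<^sup>2)"
          unfolding mass_def using lt ne fin by (intro sum_strict_mono) auto
        also have "\<dots> = real (card (level P M)) * T\<^sup>2" by simp
        also have "card (level P M) \<le> card (Pow P)" using fin by (intro card_mono) auto
        then have "real (card (level P M)) * T\<^sup>2 \<le> 2 ^ card P * T\<^sup>2"
          using fin by (intro mult_right_mono) (auto simp: card_Pow)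
        finally show False using heavy by (simp add: mult.commute)
      qed
      then show thesis using that by blast
    qed
    have zC: "T \<le> \<bar>z1 w C\<bar>" using C(2) T by (simp add: abs_le_square_iff[symmetric])
    have fC: "finite C" using C fin finite_subset by auto
    have "sign_avg (W \<times> P) F w \<le> sign_avg (set cs2 \<times> P) (\<lambda>w'. of_bool (\<forall>us. distinct us \<and> set us \<subseteq> set cs2 \<and> length us = card C
      \<longrightarrow> \<bar>laplace_steps P w' us (z1 w) {}\<bar> < T)) w"
      unfolding cs2(1)
    proof (rule sign_avg_mono_signs)
      fix w' assume w': "\<And>i. i \<notin> W \<times> P \<Longrightarrow> w' i = w i"
      have z1w: "z1 w = z1 w'"
        unfolding z1_def using w' cs1(1) by (intro laplace_steps_cong) auto
      have "\<bar>laplace_steps P w' us (z1 w) {}\<bar> < T"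
        if D: "\<forall>D\<subseteq>W. card D = L \<longrightarrow> \<bar>perm (N - D) P w'\<bar> < T"
          and us: "distinct us" "set us \<subseteq> W" "length us = card C" for us
      proof -
        have "card (set us) = M"
          using us(3) C(1) distinct_card[OF us(1)] by (metis (mono_tags, lifting) mem_Collect_eq)
        then have "card (W - set us) = card W - M"
          using us(2) card_Diff_subset[of "set us" W] by (metis List.finite_set)
        then have "card (W - set us) = L" using W(2) unfolding M_def by linarith
        then have "\<bar>perm (N - (W - set us)) P w'\<bar> < T"
          using D[rule_format, of "W - set us"] by simp
        also have "N - (W - set us) = set (cs1 @ us)" using us W cs1 by auto
        also have "perm (set (cs1 @ us)) P w' = laplace_steps P w' (cs1 @ us) (\<lambda>C. of_bool (C = P)) (P - P)"
        proof (rule laplace_steps_eq_perm[symmetric])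
          show "distinct (cs1 @ us)" using us(1,2) cs1 by auto
          show "card P = length (cs1 @ us)" using us(3) C(1) lev by simp
        qed (use fin in auto)
        finally show ?thesis unfolding z1w by (simp add: laplace_steps_append z1_def z0_def)
      qed
      then show "F w' \<le> of_bool (\<forall>us. distinct us \<and> set us \<subseteq> W \<and> length us = card C
          \<longrightarrow> \<bar>laplace_steps P w' us (z1 w) {}\<bar> < T)"
        by (auto simp: F_def)
    qed
    also have "\<dots> \<le> skip_bound (card C) L"
      using fin T C zC cs2 len2 W(2) by (intro absorb_lines) (auto simp: M_def)
    also have "\<dots> \<le> ?b3" by (rule skip_bound_le)
    finally show ?thesis using False by simp
  qed
  have "sign_avg (P \<times> N) (\<lambda>w. of_bool (\<forall>D\<subseteq>W. card D = L \<longrightarrow> \<bar>perm P (N - D) w\<bar> < T)) w0 =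
      sign_avg (P \<times> N) (\<lambda>w. F (\<lambda>(c, r). w (r, c))) w0"
    by (subst perm_transpose) (simp add: F_def)
  also have "\<dots> = sign_avg (N \<times> P) F w0"
    by (rule sign_avg_transpose[OF fin Fdep])
  also have "N \<times> P = (N - W) \<times> P \<union> W \<times> P" using W by auto
  also have "sign_avg ((N - W) \<times> P \<union> W \<times> P) F w0 = sign_avg ((N - W) \<times> P) (sign_avg (W \<times> P) F) w0"
    using fin fW by (intro sign_avg_union) auto
  also have "\<dots> \<le> sign_avg ((N - W) \<times> P) (\<lambda>w. of_bool (light w) + ?b3) w0"
    by (rule sign_avg_mono) (rule inner)
  also have "\<dots> = sign_avg (set cs1 \<times> P) (\<lambda>w. of_bool (light w)) w0 + ?b3"
    using fin by (simp add: sign_avg_add cs1(1))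
  also have "sign_avg (set cs1 \<times> P) (\<lambda>w. of_bool (light w)) w0 \<le>
      30000 ^ length cs1 * lam powr (1 / 32) + 2 * real (length cs1) / 2 ^ M"
    unfolding light_def z1_def
    using fin lam big cs1 by (intro mass_lower_tail) (auto simp: M_def[symmetric] lev z0_def mass_full)
  finally show ?thesis by (simp add: len1 M_def)
qed

text \<open>
  For each of \<open>2 * m\<close> disjoint windows of \<open>k\<close> columns the first \<open>n - L\<close> rows have a large minor missing
  only columns of the window, up to probability \<open>\<eta>\<close>. By Markov's inequality at least \<open>m\<close> windows
  succeed with probability at least \<open>1 - 2 * \<eta>\<close>. The missing
  column sets are then disjoint, and the last \<open>L\<close> rows are handled by the assumption \<open>endgame\<close>.
\<close>

lemma permanent_lower_tail:
  fixes w L m n :: nat and \<kappa> \<epsilon> \<eta> T :: real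
  assumes endgame: "\<And>R z \<C> T rs w0. finite R \<Longrightarrow> \<C> \<subseteq> level R L \<Longrightarrow> disjoint \<C> \<Longrightarrow> card \<C> = m \<Longrightarrow>
      T > 0 \<Longrightarrow> (\<forall>C\<in>\<C>. T \<le> \<bar>z C\<bar>) \<Longrightarrow> distinct rs \<Longrightarrow> length rs = L \<Longrightarrow>
      sign_avg (set rs \<times> R) (\<lambda>w. of_bool (\<bar>laplace_steps R w rs z {}\<bar> < \<kappa> * T)) w0 \<le> \<epsilon>"
    and L: "1 \<le> L" "L \<le> n" and m: "m \<ge> 1" and n: "2 * m * k \<le> n" and T: "T > 0" and \<epsilon>: "\<epsilon> \<ge> 0"
    and window: "\<And>W w0. W \<subseteq> {0..<n} \<Longrightarrow> card W = k \<Longrightarrow> sign_avg ({0..<n - L} \<times> {0..<n})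
       (\<lambda>w. of_bool (\<forall>D\<subseteq>W. card D = L \<longrightarrow> \<bar>perm {0..<n - L} ({0..<n} - D) w\<bar> < T)) w0 \<le> \<eta>"
  shows "sign_avg ({0..<n} \<times> {0..<n}) (\<lambda>w. of_bool (\<bar>perm {0..<n} {0..<n} w\<bar> < \<kappa> * T)) w0 \<le> 2 * \<eta> + \<epsilon>"
proof -
  let ?N = "{0..<n}" and ?P = "{0..<n - L}" and ?Q = "{n - L..<n}"
  define z where "z = (\<lambda>w. laplace_steps ?N w [0..<n - L] (\<lambda>C. of_bool (C = ?N)))"
  define W where "W = (\<lambda>s. {s * k..<Suc s * k})"
  define bad where "bad = (\<lambda>w s. \<forall>D\<subseteq>W s. card D = L \<longrightarrow> \<bar>perm ?P (?N - D) w\<bar> < T)"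
  define B where "B = (\<lambda>w. \<Sum>s<2 * m. of_bool (bad w s) :: real)"
  have WN: "W s \<subseteq> ?N" if "s < 2 * m" for s
  proof -
    have "Suc s * k \<le> 2 * m * k" using that by (intro mult_right_mono) auto
    then show ?thesis using n by (auto simp: W_def)
  qed
  have Wdisj: "s = t" if "x \<in> W s" "x \<in> W t" for x s t
  proof -
    have "x div k = s" if "x \<in> W s" for s
      using that by (intro div_nat_eqI) (auto simp: W_def mult.commute)
    then show ?thesis using that by blast
  qed
  have per: "perm ?N ?N w = laplace_steps ?N w [n - L..<n] (z w) {}" for w
  proof -
    have "perm ?N ?N w = laplace_steps ?N w [0..<n] (\<lambda>C. of_bool (C = ?N)) (?N - ?N)"
      using laplace_steps_eq_perm[of ?N "[0..<n]" ?N w] by simp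
    also have "[0..<n] = [0..<n - L] @ [n - L..<n]"
      using upt_add_eq_append[of 0 "n - L" L] L(2) by simp
    finally show ?thesis by (simp add: laplace_steps_append z_def)
  qed
  have minor: "perm ?P (?N - D) w = z w D" if "D \<subseteq> ?N" "card D = L" for D w
  proof -
    have fD: "finite D" using that finite_subset by blast
    have "z w (?N - (?N - D)) = perm (set [0..<n - L]) (?N - D) w"
      unfolding z_def using that fD by (intro laplace_steps_eq_perm) (auto simp: card_Diff_subset)
    moreover have "?N - (?N - D) = D" using that by auto
    ultimately show ?thesis by simp
  qed
  have inner: "sign_avg (?Q \<times> ?N) (\<lambda>w. of_bool (\<bar>perm ?N ?N w\<bar> < \<kappa> * T)) w \<le> of_bool (real m \<le> B w) + \<epsilon>" for w
  proof (cases "real m \<le> B w")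
    case True
    have "sign_avg (?Q \<times> ?N) (\<lambda>w. of_bool (\<bar>perm ?N ?N w\<bar> < \<kappa> * T)) w \<le> 1"
      by (intro sign_avg_le_const) auto
    then show ?thesis using True \<epsilon> by simp
  next
    case False
    define G where "G = {s \<in> {..<2 * m}. \<not> bad w s}"
    have "2 * m = card {s \<in> {..<2 * m}. bad w s} + card G"
    proof -
      have "card {..<2 * m} = card ({s \<in> {..<2 * m}. bad w s} \<union> G)"
        by (intro arg_cong[of _ _ card]) (auto simp: G_def)
      also have "\<dots> = card {s \<in> {..<2 * m}. bad w s} + card G"
        by (intro card_Un_disjoint) (auto simp: G_def)
      finally show ?thesis by simp
    qed
    moreover have "B w = real (card {s \<in> {..<2 * m}. bad w s})"
      by (simp add: B_def Int_def lessThan_def)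
    ultimately have "m \<le> card G" using False by simp
    then obtain X where X: "X \<subseteq> G" "card X = m" "finite X" using obtain_subset_with_card_n by metis
    have "\<forall>s\<in>X. \<exists>D. D \<subseteq> W s \<and> card D = L \<and> T \<le> \<bar>perm ?P (?N - D) w\<bar>"
      using X by (auto simp: G_def bad_def not_less)
    then obtain D where D: "\<And>s. s \<in> X \<Longrightarrow> D s \<subseteq> W s \<and> card (D s) = L \<and> T \<le> \<bar>perm ?P (?N - D s) w\<bar>"
      by metis
    have X2: "s < 2 * m" if "s \<in> X" for s using that X by (auto simp: G_def)
    have DN: "D s \<subseteq> ?N" if "s \<in> X" for s using D[OF that] WN[OF X2[OF that]] by blast
    have Dne: "D s \<noteq> {}" if "s \<in> X" for s using D[OF that] L by (metis card.empty not_one_le_zero)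
    have inj: "inj_on D X"
    proof (rule inj_onI)
      fix s t assume st: "s \<in> X" "t \<in> X" "D s = D t"
      then obtain x where "x \<in> D s" using Dne by blast
      then show "s = t" using D st Wdisj[of x s t] by blast
    qed
    have "sign_avg (?Q \<times> ?N) (\<lambda>w. of_bool (\<bar>perm ?N ?N w\<bar> < \<kappa> * T)) w =
        sign_avg (?Q \<times> ?N) (\<lambda>w'. of_bool (\<bar>laplace_steps ?N w' [n - L..<n] (z w) {}\<bar> < \<kappa> * T)) w"
    proof (rule sign_avg_cong_outside)
      fix w' assume w': "\<And>i. i \<notin> ?Q \<times> ?N \<Longrightarrow> w' i = w i"
      have "z w' = z w" unfolding z_def using w' by (intro laplace_steps_cong) auto
      then show "of_bool (\<bar>perm ?N ?N w'\<bar> < \<kappa> * T) =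
          (of_bool (\<bar>laplace_steps ?N w' [n - L..<n] (z w) {}\<bar> < \<kappa> * T) :: real)"
        by (simp add: per)
    qed
    also have "?Q = set [n - L..<n]" by simp
    also have "sign_avg (set [n - L..<n] \<times> ?N) (\<lambda>w'. of_bool (\<bar>laplace_steps ?N w' [n - L..<n] (z w) {}\<bar> < \<kappa> * T)) w \<le> \<epsilon>"
    proof (rule endgame[where \<C> = "D ` X"])
      show "D ` X \<subseteq> level ?N L" using D DN by auto
      show "disjoint (D ` X)"
      proof (rule disjointI)
        fix a b assume "a \<in> D ` X" "b \<in> D ` X" "a \<noteq> b"
        then obtain s t where "a = D s" "b = D t" "s \<in> X" "t \<in> X" "s \<noteq> t" by auto
        then show "a \<inter> b = {}" using D Wdisj by (metis disjoint_iff subsetD)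
      qed
      show "card (D ` X) = m" using inj X by (simp add: card_image)
      show "\<forall>C\<in>D ` X. T \<le> \<bar>z w C\<bar>"
      proof
        fix C assume "C \<in> D ` X"
        then obtain s where "s \<in> X" "C = D s" by blast
        then show "T \<le> \<bar>z w C\<bar>" using D[of s] minor[of "D s" w] DN[of s] by simp
      qed
    qed (use T L in auto)
    finally show ?thesis using False by simp
  qed
  have "?N = ?P \<union> ?Q" using L by auto
  then have "?N \<times> ?N = ?P \<times> ?N \<union> ?Q \<times> ?N" by (metis Sigma_Un_distrib1)
  then have "sign_avg (?N \<times> ?N) (\<lambda>w. of_bool (\<bar>perm ?N ?N w\<bar> < \<kappa> * T)) w0 =
     sign_avg (?P \<times> ?N) (sign_avg (?Q \<times> ?N) (\<lambda>w. of_bool (\<bar>perm ?N ?N w\<bar> < \<kappa> * T))) w0"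
    by (simp only:) (intro sign_avg_union, auto)
  also have "\<dots> \<le> sign_avg (?P \<times> ?N) (\<lambda>w. of_bool (real m \<le> B w) + \<epsilon>) w0"
    by (rule sign_avg_mono) (rule inner)
  also have "\<dots> = sign_avg (?P \<times> ?N) (\<lambda>w. of_bool (real m \<le> B w)) w0 + \<epsilon>"
    by (simp add: sign_avg_add)
  also have "sign_avg (?P \<times> ?N) (\<lambda>w. of_bool (real m \<le> B w)) w0 \<le> sign_avg (?P \<times> ?N) B w0 / real m"
    using m by (intro sign_avg_markov) (auto simp: B_def intro!: sum_nonneg)
  also have "sign_avg (?P \<times> ?N) B w0 \<le> (\<Sum>s<2 * m. \<eta>)"
    unfolding B_def sign_avg_sum bad_def
    by (intro sum_mono window WN) (auto simp: W_def)
  also have "(\<Sum>s<2 * m. \<eta>) / real m = 2 * \<eta>" using m by simp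
  finally show ?thesis using m by (simp add: divide_right_mono)
qed

section \<open>Elementary estimates for factorials\<close>

text \<open>
  The ratio \<open>n\<^sup>n / n!\<close> at least doubles at every step, by Bernoulli's inequality. This saves the
  exponential factor in the upper bound.
\<close>

lemma fact_mult_2_pow_le: "n \<ge> 1 \<Longrightarrow> fact n * 2 ^ n \<le> 2 * real n ^ n"
proof (induction n rule: dec_induct)
  case (step n)
  have n: "real n > 0" using step by simp
  have "2 \<le> (1 + 1 / real n) ^ n"
  proof -
    have "0 \<le> 1 / real n" by simp
    then have "-1 \<le> 1 / real n" by linarith
    then show ?thesis using Bernoulli_inequality[of "1 / real n" n] n by simp
  qed
  then have "2 * real n ^ n \<le> (1 + 1 / real n) ^ n * real n ^ n"
    using n by (intro mult_right_mono) auto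
  also have "\<dots> = (real n + 1) ^ n"
    using n by (simp add: power_mult_distrib[symmetric] field_simps)
  finally have le: "2 * real n ^ n \<le> (real n + 1) ^ n" .
  have "fact (Suc n) * 2 ^ Suc n = 2 * (real n + 1) * (fact n * 2 ^ n)"
    by (simp add: algebra_simps)
  also have "\<dots> \<le> 2 * (real n + 1) * (2 * real n ^ n)"
    by (intro mult_left_mono step.IH) auto
  also have "\<dots> \<le> 2 * (real n + 1) * (real n + 1) ^ n"
    by (intro mult_left_mono le) auto
  also have "\<dots> = 2 * real (Suc n) ^ Suc n" by (simp add: add.commute)
  finally show ?case .
qed simp

lemma power_le_exp_fact: "real n ^ n \<le> exp (real n) * fact n"
proof (induction n)
  case (Suc n)
  have le: "(real n + 1) ^ n \<le> exp 1 * real n ^ n"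
  proof (cases "n = 0")
    case False
    then have n: "real n > 0" by simp
    have "(real n + 1) ^ n = (1 + 1 / real n) ^ n * real n ^ n"
      using n by (simp add: power_mult_distrib[symmetric] field_simps)
    also have "\<dots> \<le> exp (1 / real n) ^ n * real n ^ n"
      by (intro mult_right_mono power_mono exp_ge_add_one_self) auto
    also have "exp (1 / real n) ^ n = exp 1"
      using n by (simp add: exp_of_nat_mult[symmetric])
    finally show ?thesis .
  qed simp
  have "real (Suc n) ^ Suc n = (real n + 1) * (real n + 1) ^ n" by (simp add: add.commute)
  also have "\<dots> \<le> (real n + 1) * (exp 1 * real n ^ n)" by (intro mult_left_mono le) auto
  also have "\<dots> \<le> (real n + 1) * (exp 1 * (exp (real n) * fact n))"
    by (intro mult_left_mono Suc) auto
  also have "\<dots> = exp (real (Suc n)) * fact (Suc n)"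
    by (simp add: exp_add algebra_simps)
  finally show ?case .
qed simp

lemma fact_le_power_mult_fact: "L \<le> n \<Longrightarrow> (fact n :: real) \<le> real n ^ L * fact (n - L)"
proof (induction L)
  case (Suc L)
  have "(fact n :: real) \<le> real n ^ L * fact (n - L)" using Suc by simp
  also have "(fact (n - L) :: real) = real (n - L) * fact (n - Suc L)"
    using Suc.prems by (simp add: fact_reduce)
  also have "real n ^ L * (real (n - L) * fact (n - Suc L)) \<le> real n ^ L * (real n * fact (n - Suc L))"
    by (intro mult_left_mono mult_right_mono) auto
  finally show ?case by (simp add: mult_ac)
qed simp

text \<open>
  The right-hand side is the square of the size of the minors obtained below, with windows of \<open>k\<close>
  columns and shortfall \<open>lam\<close>. The rate \<open>514\<close> is \<open>32 * 16 + 1 + 1\<close>: it comes from \<open>60000 \<le> exp 16\<close>, from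
  \<open>n! \<ge> n\<^sup>n * exp (- n)\<close> and from \<open>2 ^ (n - L) \<le> exp n\<close>.
\<close>

lemma permanent_scale_lower_bound:
  fixes n k L :: nat
  assumes L: "L \<le> k" "k \<le> n" "n \<ge> 1" and k: "real k \<le> sqrt (real n)"
  defines "lam \<equiv> (1 / 60000) ^ (32 * n) :: real"
  shows "real n ^ n * exp (- 514 * real n - real L * ln (real n) - sqrt (real n) * ln (real n))
    \<le> lam * fact (n - L) / fact (k - L) / 2 ^ (n - L)"
proof -
  have n: "real n > 0" using L by simp
  have e2: "2 \<le> exp (1 :: real)" using exp_ge_add_one_self[of 1] by simp
  have lam: "exp (- 512 * real n) \<le> lam"
  proof -
    have "(60000 :: real) \<le> 2 ^ 16" by simp
    also have "\<dots> \<le> exp 1 ^ 16" by (intro power_mono e2) auto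
    also have "\<dots> = exp 16" by (simp add: exp_of_nat_mult[symmetric])
    finally have "1 / exp 16 \<le> (1 / 60000 :: real)" by (intro divide_left_mono) auto
    then have "(1 / exp 16) ^ (32 * n) \<le> lam" unfolding lam_def by (intro power_mono) auto
    moreover have "(1 / exp 16) ^ (32 * n) = exp (- 512 * real n)"
      by (simp add: exp_minus[symmetric] inverse_eq_divide[symmetric] exp_of_nat_mult[symmetric] algebra_simps)
    ultimately show ?thesis by simp
  qed
  have pL: "real n ^ L = exp (real L * ln (real n))"
    using n by (simp add: exp_of_nat_mult)
  have f1: "real n ^ n * exp (- real n) * exp (- real L * ln (real n)) \<le> fact (n - L)"
  proof -
    have "real n ^ n \<le> exp (real n) * (real n ^ L * fact (n - L))"
      using power_le_exp_fact[of n] fact_le_power_mult_fact[of L n] L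
      by (meson exp_ge_zero le_trans mult_left_mono order.trans)
    then have "real n ^ n * (exp (- real n) * exp (- real L * ln (real n))) \<le>
       exp (real n) * (real n ^ L * fact (n - L)) * (exp (- real n) * exp (- real L * ln (real n)))"
      by (intro mult_right_mono) auto
    also have "\<dots> = fact (n - L)"
      unfolding pL by (simp add: exp_minus field_simps)
    finally show ?thesis by (simp add: mult_ac)
  qed
  have f2: "fact (k - L) \<le> exp (sqrt (real n) * ln (real n))"
  proof -
    have "(fact (k - L) :: real) \<le> fact k" by (intro fact_mono) auto
    also have "\<dots> \<le> real k ^ k" using fact_le_power[of k] by simp
    also have "\<dots> \<le> real n ^ k" using L by (intro power_mono) auto
    also have "\<dots> = exp (real k * ln (real n))" using n by (simp add: exp_of_nat_mult)
    also have "\<dots> \<le> exp (sqrt (real n) * ln (real n))"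
      using k L by (simp add: mult_right_mono)
    finally show ?thesis .
  qed
  have f3: "2 ^ (n - L) \<le> exp (real n)"
  proof -
    have "(2 :: real) ^ (n - L) \<le> 2 ^ n" by (intro power_increasing) auto
    also have "\<dots> \<le> exp 1 ^ n" by (intro power_mono e2) auto
    finally show ?thesis by (simp add: exp_of_nat_mult[symmetric])
  qed
  have "real n ^ n * exp (- 514 * real n - real L * ln (real n) - sqrt (real n) * ln (real n)) =
     exp (- 512 * real n) * (real n ^ n * exp (- real n) * exp (- real L * ln (real n))) /
       exp (sqrt (real n) * ln (real n)) / exp (real n)"
    by (simp add: exp_diff exp_minus exp_add[symmetric] field_simps)
  also have "\<dots> \<le> lam * fact (n - L) / fact (k - L) / 2 ^ (n - L)"
    using lam f1 f2 f3 n by (intro frac_le mult_mono divide_nonneg_nonneg mult_nonneg_nonneg) (auto simp: lam_def)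
  finally show ?thesis .
qed

section \<open>Asymptotics\<close>

lemma powr_half_square:
  assumes "n \<ge> 1"
  shows "(real n powr (real n / 2) * exp (c * real n))\<^sup>2 = real n ^ n * exp (2 * c * real n)"
proof -
  have "(real n powr (real n / 2))\<^sup>2 = real n powr real n"
    by (simp add: power2_eq_square powr_add[symmetric])
  also have "\<dots> = real n ^ n" using assms by (simp add: powr_realpow)
  moreover have "(exp (c * real n))\<^sup>2 = exp (2 * c * real n)"
    by (simp add: power2_eq_square exp_add[symmetric] algebra_simps)
  ultimately show ?thesis by (simp add: power_mult_distrib)
qed

lemma permanent_upper_tail:
  "(\<lambda>n. sign_avg ({0..<n} \<times> {0..<n}) (\<lambda>w. of_bool (real n powr (real n / 2) * exp (- (1 / 4) * real n)
      < \<bar>perm {0..<n} {0..<n} w\<bar>)) (\<lambda>_. 0)) \<longlonglongrightarrow> 0"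
proof (rule tendsto_sandwich[OF always_eventually])
  show "\<forall>n. 0 \<le> sign_avg ({0..<n} \<times> {0..<n}) (\<lambda>w. of_bool (real n powr (real n / 2) * exp (- (1 / 4) * real n)
      < \<bar>perm {0..<n} {0..<n} w\<bar>)) (\<lambda>_. 0)"
    by (auto intro!: sign_avg_nonneg)
  show "(\<lambda>n. 2 * (exp (1 / 2) / 2) ^ n) \<longlonglongrightarrow> (0 :: real)"
  proof -
    have "exp (1 / 2 :: real) ^ 2 = exp 1" by (simp add: exp_of_nat_mult[symmetric])
    also have "\<dots> < 2 ^ 2" using exp_le by (simp add: less_le_trans)
    finally have "exp (1 / 2 :: real) < 2" by (rule power_less_imp_less_base) simp
    then have "(\<lambda>n. (exp (1 / 2) / 2 :: real) ^ n) \<longlonglongrightarrow> 0" by (intro LIMSEQ_power_zero) auto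
    then show ?thesis by (rule tendsto_mult_right_zero)
  qed
  show "\<forall>\<^sub>F n in sequentially. sign_avg ({0..<n} \<times> {0..<n}) (\<lambda>w. of_bool (real n powr (real n / 2) * exp (- (1 / 4) * real n)
      < \<bar>perm {0..<n} {0..<n} w\<bar>)) (\<lambda>_. 0) \<le> 2 * (exp (1 / 2) / 2) ^ n"
  proof (rule eventually_sequentiallyI)
    fix n :: nat assume n: "1 \<le> n"
    let ?N = "{0..<n}"
    let ?b = "real n powr (real n / 2) * exp (- (1 / 4) * real n)"
    have b: "?b > 0" using n by simp
    then have b': "?b\<^sup>2 > 0" by (rule zero_less_power)
    have b2: "?b\<^sup>2 = real n ^ n * exp (- (1 / 2) * real n)"
      using powr_half_square[OF n, of "- (1 / 4)"] by simp
    have "sign_avg (?N \<times> ?N) (\<lambda>w. of_bool (?b < \<bar>perm ?N ?N w\<bar>)) (\<lambda>_. 0) \<le>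
        sign_avg (?N \<times> ?N) (\<lambda>w. of_bool (?b\<^sup>2 \<le> (perm ?N ?N w)\<^sup>2)) (\<lambda>_. 0)"
    proof (rule sign_avg_mono)
      fix w
      have "?b\<^sup>2 \<le> (perm ?N ?N w)\<^sup>2" if "?b < \<bar>perm ?N ?N w\<bar>"
        using power_mono[of ?b "\<bar>perm ?N ?N w\<bar>" 2] that b by simp
      then show "of_bool (?b < \<bar>perm ?N ?N w\<bar>) \<le> (of_bool (?b\<^sup>2 \<le> (perm ?N ?N w)\<^sup>2) :: real)" by auto
    qed
    also have "\<dots> \<le> sign_avg (?N \<times> ?N) (\<lambda>w. (perm ?N ?N w)\<^sup>2) (\<lambda>_. 0) / ?b\<^sup>2"
      using b' by (rule sign_avg_markov) simp
    also have "\<dots> \<le> fact n / ?b\<^sup>2"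
      using perm_second_moment[of ?N ?N "\<lambda>_. 0"] by (intro divide_right_mono) auto
    also have "\<dots> \<le> (2 * real n ^ n / 2 ^ n) / ?b\<^sup>2"
      using fact_mult_2_pow_le[OF n] by (intro divide_right_mono) (auto simp: field_simps)
    also have "\<dots> = 2 * (exp (1 / 2 * real n) / 2 ^ n)"
      unfolding b2 using n by (simp add: exp_minus field_simps)
    also have "exp (1 / 2 * real n) = exp (1 / 2) ^ n"
      by (simp add: exp_of_nat_mult[symmetric] mult.commute)
    finally show "sign_avg (?N \<times> ?N) (\<lambda>w. of_bool (?b < \<bar>perm ?N ?N w\<bar>)) (\<lambda>_. 0) \<le> 2 * (exp (1 / 2) / 2) ^ n"
      by (simp add: power_divide)
  qed
qed auto

text \<open>
  Given \<open>\<epsilon>\<close>, first \<open>L\<close> is fixed so that skipping \<open>L\<close> columns fails rarely, then \<open>m\<close> and \<open>\<kappa>\<close> are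
  obtained for the last \<open>L\<close> rows, and only then \<open>n\<close> grows. Windows have \<open>k = \<lfloor>sqrt n\<rfloor>\<close> columns: large
  enough for the bound on the mass to hold throughout, and small enough for the missing factor
  \<open>k!\<close> to be subexponential. The choice \<open>lam = (1 / 60000) ^ (32 * n)\<close> beats the product of the negative moments,
  which is at most \<open>30000 ^ n\<close>.
\<close>

lemma permanent_lower_tail_limit:
  "(\<lambda>n. sign_avg ({0..<n} \<times> {0..<n}) (\<lambda>w. of_bool (\<bar>perm {0..<n} {0..<n} w\<bar> <
      real n powr (real n / 2) * exp (- 260 * real n))) (\<lambda>_. 0)) \<longlonglongrightarrow> 0"
proof (rule order_tendstoI)
  fix a :: real assume "a < 0"
  then show "\<forall>\<^sub>F n in sequentially. a < sign_avg ({0..<n} \<times> {0..<n}) (\<lambda>w. of_bool (\<bar>perm {0..<n} {0..<n} w\<bar> <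
      real n powr (real n / 2) * exp (- 260 * real n))) (\<lambda>_. 0)"
    by (auto intro!: always_eventually less_le_trans[OF _ sign_avg_nonneg])
next
  fix \<epsilon> :: real assume \<epsilon>: "0 < \<epsilon>"
  obtain L0 where L0: "(3 / 4 :: real) ^ L0 < \<epsilon> / 48"
    using real_arch_pow_inv[of "\<epsilon> / 48" "3 / 4"] \<epsilon> by auto
  define L where "L = Suc L0"
  have L: "L \<ge> 1" "3 * (3 / 4) ^ L \<le> \<epsilon> / 16"
  proof -
    have "(3 / 4 :: real) ^ L \<le> (3 / 4) ^ L0" by (intro power_decreasing) (auto simp: L_def)
    then show "3 * (3 / 4) ^ L \<le> \<epsilon> / 16" using L0 by linarith
  qed (simp add: L_def)
  have "\<epsilon> / 4 > 0" using \<epsilon> by simp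
  from disjoint_heavy_minors_survive[OF L(1) this] obtain m \<kappa> where m: "m \<ge> 1" "\<kappa> > 0" and
    endgame: "\<And>R z \<C> T rs w0. finite R \<Longrightarrow> \<C> \<subseteq> level R L \<Longrightarrow> disjoint \<C> \<Longrightarrow> card \<C> = m \<Longrightarrow>
      T > 0 \<Longrightarrow> (\<forall>C\<in>\<C>. T \<le> \<bar>z C\<bar>) \<Longrightarrow> distinct rs \<Longrightarrow> length rs = L \<Longrightarrow>
      sign_avg (set rs \<times> R) (\<lambda>w. of_bool (\<bar>laplace_steps R w rs z {}\<bar> < \<kappa> * T)) w0 \<le> \<epsilon> / 4"
    by blast
  have ev1: "\<forall>\<^sub>F n in sequentially. real L + 1 \<le> sqrt (real n)" by real_asymp
  have ev2: "\<forall>\<^sub>F n in sequentially. 2 * real m * sqrt (real n) \<le> real n" by real_asymp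
  have ev3: "\<forall>\<^sub>F n in sequentially. 2 * (real n)\<^sup>2 \<le> (sqrt (real n) - real L) ^ 5" by real_asymp
  have "(\<lambda>n. (1 / 2 :: real) ^ n) \<longlonglongrightarrow> 0" by real_asymp
  then have ev4: "\<forall>\<^sub>F n in sequentially. (1 / 2 :: real) ^ n < \<epsilon> / 16"
    using \<epsilon> by (intro order_tendstoD(2)) auto
  have "(\<lambda>n. 2 * real n / 2 powr (sqrt (real n) - 1 - real L)) \<longlonglongrightarrow> 0" by real_asymp
  then have ev5: "\<forall>\<^sub>F n in sequentially. 2 * real n / 2 powr (sqrt (real n) - 1 - real L) < \<epsilon> / 16"
    using \<epsilon> by (intro order_tendstoD(2)) auto
  have "(\<lambda>n. exp (- 6 * real n + real L * ln (real n) + sqrt (real n) * ln (real n))) \<longlonglongrightarrow> 0"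
    by real_asymp
  then have ev6: "\<forall>\<^sub>F n in sequentially. exp (- 6 * real n + real L * ln (real n) + sqrt (real n) * ln (real n)) < \<kappa>\<^sup>2"
    using m by (intro order_tendstoD(2)) auto
  show "\<forall>\<^sub>F n in sequentially. sign_avg ({0..<n} \<times> {0..<n}) (\<lambda>w. of_bool (\<bar>perm {0..<n} {0..<n} w\<bar> <
      real n powr (real n / 2) * exp (- 260 * real n))) (\<lambda>_. 0) < \<epsilon>"
    using ev1 ev2 ev3 ev4 ev5 ev6 eventually_ge_at_top[of 1]
  proof eventually_elim
    case (elim n)
    note e = elim
    let ?N = "{0..<n}" and ?P = "{0..<n - L}"
    define k where "k = nat \<lfloor>sqrt (real n)\<rfloor>"
    have k1: "real k \<le> sqrt (real n)" and k2: "sqrt (real n) - 1 < real k"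
      by (auto simp: k_def)
    have Lk: "L \<le> k" using e(1) k2 by linarith
    have kn: "k \<le> n"
    proof -
      have "sqrt (real n) \<le> sqrt (real n) * sqrt (real n)" using e(1) by (intro mult_le_cancel_left1[THEN iffD2]) auto
      then have "real k \<le> real n" using k1 by simp
      then show ?thesis by simp
    qed
    have mk: "2 * m * k \<le> n"
    proof -
      have "real (2 * m * k) \<le> 2 * real m * sqrt (real n)" using k1 by (simp add: mult_left_mono)
      then have "real (2 * m * k) \<le> real n" using e(2) by linarith
      then show ?thesis by (simp only: of_nat_le_iff)
    qed
    have big: "2 * (n - L)\<^sup>2 \<le> Suc (k - L) ^ 5"
    proof -
      have "real (2 * (n - L)\<^sup>2) \<le> 2 * (real n)\<^sup>2"
        by (simp add: power_mono)
      also have "\<dots> \<le> (sqrt (real n) - real L) ^ 5" by (rule e(3))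
      also have "\<dots> \<le> real (Suc (k - L)) ^ 5"
        using e(1) k2 Lk by (intro power_mono) (auto simp: of_nat_diff)
      finally have "real (2 * (n - L)\<^sup>2) \<le> real (Suc (k - L) ^ 5)" by (simp only: of_nat_power)
      then show ?thesis by (simp only: of_nat_le_iff)
    qed
    define lam :: real where "lam = (1 / 60000) ^ (32 * n)"
    have lam0: "lam > 0" by (simp add: lam_def)
    have lamr: "lam powr (1 / 32) = (1 / 60000) ^ n"
    proof -
      have "lam = ((1 / 60000) ^ n) powr 32"
        by (simp add: lam_def powr_numeral power_mult[symmetric] mult.commute)
      then have "lam powr (1 / 32) = ((1 / 60000) ^ n) powr (32 * (1 / 32))"
        by (simp only: powr_powr)
      then show ?thesis by simp
    qed
    define S where "S = lam * fact (n - L) / fact (k - L) / 2 ^ (n - L)"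
    have S0: "S > 0" using lam0 by (simp add: S_def)
    define T where "T = sqrt S"
    have T0: "T > 0" using S0 by (simp add: T_def)
    have T2: "T\<^sup>2 = S" using S0 by (simp add: T_def)
    define \<eta> where "\<eta> = 3 * \<epsilon> / 16"
    have window: "sign_avg (?P \<times> ?N) (\<lambda>w. of_bool (\<forall>D\<subseteq>W. card D = L \<longrightarrow> \<bar>perm ?P (?N - D) w\<bar> < T)) w0 \<le> \<eta>"
      if W: "W \<subseteq> ?N" "card W = k" for W w0
    proof -
      have cNW: "card (?N - W) = n - k"
        using W card_Diff_subset[of W ?N] finite_subset[OF W(1)] by simp
      have "sign_avg (?P \<times> ?N) (\<lambda>w. of_bool (\<forall>D\<subseteq>W. card D = L \<longrightarrow> \<bar>perm ?P (?N - D) w\<bar> < T)) w0 \<le>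
        30000 ^ card (?N - W) * lam powr (1 / 32) + 2 * real (card (?N - W)) / 2 ^ (card W - L) + 3 * (3 / 4) ^ L"
      proof (rule heavy_minor_in_window)
        show "T\<^sup>2 * 2 ^ card ?P \<le> lam * (fact (card ?P) / fact (card W - L))"
          unfolding T2 W(2) by (simp add: S_def)
      qed (use W Lk kn T0 lam0 big in auto)
      also have "30000 ^ card (?N - W) * lam powr (1 / 32) \<le> 30000 ^ n * (1 / 60000) ^ n"
        unfolding lamr cNW by (intro mult_right_mono power_increasing) auto
      also have "30000 ^ n * (1 / 60000) ^ n = (1 / 2 :: real) ^ n"
        by (simp only: power_mult_distrib[symmetric]) simp
      also have "\<dots> \<le> \<epsilon> / 16" using e(4) by simp
      also have "2 * real (card (?N - W)) / 2 ^ (card W - L) \<le> 2 * real n / 2 powr (sqrt (real n) - 1 - real L)"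
      proof (rule frac_le)
        have "2 powr (sqrt (real n) - 1 - real L) \<le> 2 powr real (k - L)"
          using k2 Lk by (intro powr_mono) (auto simp: of_nat_diff)
        then show "2 powr (sqrt (real n) - 1 - real L) \<le> 2 ^ (card W - L)"
          by (simp add: W(2) powr_realpow)
      qed (auto simp: cNW)
      also have "\<dots> \<le> \<epsilon> / 16" using e(5) by simp
      also note L(2)
      finally show ?thesis by (simp add: \<eta>_def)
    qed
    have low: "sign_avg (?N \<times> ?N) (\<lambda>w. of_bool (\<bar>perm ?N ?N w\<bar> < \<kappa> * T)) (\<lambda>_. 0) \<le> 2 * \<eta> + \<epsilon> / 4"
      using endgame L(1) Lk kn m(1) mk T0 \<epsilon> window by (intro permanent_lower_tail[where L = L and m = m and k = k]) auto
    have "real n powr (real n / 2) * exp (- 260 * real n) \<le> \<kappa> * T"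
    proof (rule power2_le_imp_le)
      let ?e = "- 514 * real n - real L * ln (real n) - sqrt (real n) * ln (real n)"
      have "(real n powr (real n / 2) * exp (- 260 * real n))\<^sup>2 = real n ^ n * exp (- 520 * real n)"
        using powr_half_square[OF e(7), of "- 260"] by simp
      also have "exp (- 520 * real n) = exp (- 6 * real n + real L * ln (real n) + sqrt (real n) * ln (real n)) * exp ?e"
        by (simp add: exp_add[symmetric])
      also have "\<dots> \<le> \<kappa>\<^sup>2 * exp ?e"
        using e(6) by (intro mult_right_mono) auto
      also have "real n ^ n * (\<kappa>\<^sup>2 * exp ?e) = \<kappa>\<^sup>2 * (real n ^ n * exp ?e)" by simp
      also have "\<dots> \<le> \<kappa>\<^sup>2 * S"
        unfolding S_def lam_def using Lk kn e(7) k1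
        by (intro mult_left_mono permanent_scale_lower_bound) auto
      also have "\<dots> = (\<kappa> * T)\<^sup>2" by (simp add: power_mult_distrib T2)
      finally show "(real n powr (real n / 2) * exp (- 260 * real n))\<^sup>2 \<le> (\<kappa> * T)\<^sup>2"
        by (simp add: mult_left_mono)
    qed (use m T0 in auto)
    then have "sign_avg (?N \<times> ?N) (\<lambda>w. of_bool (\<bar>perm ?N ?N w\<bar> < real n powr (real n / 2) * exp (- 260 * real n))) (\<lambda>_. 0)
        \<le> sign_avg (?N \<times> ?N) (\<lambda>w. of_bool (\<bar>perm ?N ?N w\<bar> < \<kappa> * T)) (\<lambda>_. 0)"
      by (intro sign_avg_mono) auto
    also note low
    also have "2 * \<eta> + \<epsilon> / 4 < \<epsilon>" using \<epsilon> by (simp add: \<eta>_def)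
    finally show ?case .
  qed
qed

theorem corollary1p3:
  shows "\<exists>c\<^sub>1 C\<^sub>1 :: real. 0 < c\<^sub>1 \<and> c\<^sub>1 < C\<^sub>1 \<and>
    (\<lambda>n. measure_pmf.prob (rademacher_mat_pmf n)
       {A. real n powr (real n / 2) * exp (- C\<^sub>1 * real n) \<le> \<bar>per A\<bar> \<and>
           \<bar>per A\<bar> \<le> real n powr (real n / 2) * exp (- c\<^sub>1 * real n)}) \<longlonglongrightarrow> 1"
proof (intro exI conjI)
  let ?lo = "\<lambda>n. real n powr (real n / 2) * exp (- 260 * real n)"
  let ?hi = "\<lambda>n. real n powr (real n / 2) * exp (- (1 / 4) * real n)"
  let ?p = "\<lambda>n. perm {0..<n} {0..<n}"
  define av where "av = (\<lambda>(n::nat) f. sign_avg ({0..<n} \<times> {0..<n}) f (\<lambda>_. 0) :: real)"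
  define X where "X = (\<lambda>n. av n (\<lambda>w. of_bool (?lo n \<le> \<bar>?p n w\<bar> \<and> \<bar>?p n w\<bar> \<le> ?hi n)))"
  define lo where "lo = (\<lambda>n. av n (\<lambda>w. of_bool (\<bar>?p n w\<bar> < ?lo n)))"
  define hi where "hi = (\<lambda>n. av n (\<lambda>w. of_bool (?hi n < \<bar>?p n w\<bar>)))"
  have "X \<longlonglongrightarrow> 1"
  proof (rule tendsto_sandwich[OF always_eventually always_eventually])
    have "lo \<longlonglongrightarrow> 0" "hi \<longlonglongrightarrow> 0"
      unfolding lo_def hi_def av_def using permanent_lower_tail_limit permanent_upper_tail by auto
    then have "(\<lambda>n. 1 - (lo n + hi n)) \<longlonglongrightarrow> 1 - (0 + 0)" by (intro tendsto_intros)
    then show "(\<lambda>n. 1 - (lo n + hi n)) \<longlonglongrightarrow> 1" by simp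
    show "\<forall>n. 1 - (lo n + hi n) \<le> X n"
    proof
      fix n
      have "av n (\<lambda>_. 1) \<le> av n (\<lambda>w. of_bool (?lo n \<le> \<bar>?p n w\<bar> \<and> \<bar>?p n w\<bar> \<le> ?hi n) +
          (of_bool (\<bar>?p n w\<bar> < ?lo n) + of_bool (?hi n < \<bar>?p n w\<bar>)))"
        unfolding av_def by (rule sign_avg_mono) auto
      then show "1 - (lo n + hi n) \<le> X n"
        by (simp add: av_def X_def lo_def hi_def sign_avg_add)
    qed
    show "\<forall>n. X n \<le> 1" unfolding X_def av_def by (auto intro!: sign_avg_le_const)
  qed auto
  moreover have "measure_pmf.prob (rademacher_mat_pmf n) {A. ?lo n \<le> \<bar>per A\<bar> \<and> \<bar>per A\<bar> \<le> ?hi n} = X n" for n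
    unfolding prob_rademacher_mat X_def av_def per_mat_eq_perm ..
  ultimately show "(\<lambda>n. measure_pmf.prob (rademacher_mat_pmf n) {A. ?lo n \<le> \<bar>per A\<bar> \<and> \<bar>per A\<bar> \<le> ?hi n}) \<longlonglongrightarrow> 1"
    by simp
qed auto

end
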